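(* Let $\beta>0$ and let $m,n\to\infty$ with $mn^{-1}\to\beta$. Consider the inhomogeneous random intersection graph $G=G(n,m,\mathrm{P}_X,\mathrm{P}_Y)$ and suppose that $\mathbf{E} X_1^2<\infty$, $\mathbf{E} X_1^3=\infty$, $\mathbf{E} Y_1<\infty$, $\mathbf{E} Y_1^2=\infty$. Let $a_2=\mathbf{E} X_1^2$, $b_1=\mathbf{E} Y_1$, $\kappa=\beta^{3/2}a_2^2b_1^{-1}$, $S_X=\sum_{i=1}^m X_i^3$ and $S_Y=\sum_{j=1}^n Y_j^2$. Then the global clustering coefficient satisfies $$C_G=\bigl(1+\kappa S_Y/S_X\bigr)^{-1}+o_P(1).$$
   Context: Inhomogeneous random intersection graph $G(n,m,\mathrm{P}_X,\mathrm{P}_Y)$: vertex set $V=\{v_1,\dots,v_n\}$, attribute set $W=\{w_1,\dots,w_m\}$. Attributes $w_i$ and vertices $v_j$ are assigned independent non-negative random weights $X_i$ and $Y_j$, where $X_1,\dots,X_m$ are iid with distribution $\mathrm{P}_X$ and $Y_1,\dots,Y_n$ are iid with distribution $\mathrm{P}_Y$ (these distributions do not depend on $m,n$). Conditionally on the weights, every pair $(w_i,v_j)$ is linked in a bipartite graph $H$ independently with probability $p_{ij}=\min\{1,X_iY_j/\sqrt{mn}\}$. Two distinct vertices of $V$ are adjacent in $G$ iff they have a common neighbour in $H$. The global clustering coefficient is $C_G=3\Delta/\Lambda$, where $\Delta$ is the number of triangles and $\Lambda$ the number of paths of length $2$ in $G$. $o_P(1)$ denotes a quantity converging to $0$ in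 probability. *)

theory Defs
  imports "HOL-Probability.Probability"
begin

type_synonym sample = "(nat \<Rightarrow> real) \<times> (nat \<Rightarrow> real) \<times> (nat \<Rightarrow> nat \<Rightarrow> real)"

text \<open>Sample space: attribute weights X_i (i = 0,1,...), vertex weights Y_j (j = 0,1,...),
  and independent uniform [0,1] variables U i j used to realise the conditional
  Bernoulli(p_ij) edges of H: attribute i ~ vertex j iff U i j <= p_ij.
  The graph G(n,m,P_X,P_Y) uses attributes 0..m-1 and vertices 0..n-1.\<close>

definition model :: "real measure \<Rightarrow> real measure \<Rightarrow> sample measure" where
  "model PX PY = PiM UNIV (\<lambda>_. PX) \<Otimes>\<^sub>M (PiM UNIV (\<lambda>_. PY) \<Otimes>\<^sub>M
      PiM UNIV (\<lambda>_. PiM UNIV (\<lambda>_. uniform_measure lborel {0..1::real})))"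

definition edgeH :: "nat \<Rightarrow> nat \<Rightarrow> sample \<Rightarrow> nat \<Rightarrow> nat \<Rightarrow> bool" where
  "edgeH m n \<omega> i j \<longleftrightarrow> (case \<omega> of (x, y, u) \<Rightarrow>
      u i j \<le> min 1 (x i * y j / sqrt (real m * real n)))"

definition adjG :: "nat \<Rightarrow> nat \<Rightarrow> sample \<Rightarrow> nat \<Rightarrow> nat \<Rightarrow> bool" where
  "adjG m n \<omega> a b \<longleftrightarrow> a \<noteq> b \<and> (\<exists>i<m. edgeH m n \<omega> i a \<and> edgeH m n \<omega> i b)"

definition num_triangles :: "nat \<Rightarrow> nat \<Rightarrow> sample \<Rightarrow> nat" where
  "num_triangles m n \<omega> = card {T. T \<subseteq> {..<n} \<and> card T = 3 \<and>
      (\<forall>a\<in>T. \<forall>b\<in>T. a \<noteq> b \<longrightarrow> adjG m n \<omega> a b)}"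

definition degG :: "nat \<Rightarrow> nat \<Rightarrow> sample \<Rightarrow> nat \<Rightarrow> nat" where
  "degG m n \<omega> v = card {w. w < n \<and> adjG m n \<omega> v w}"

definition num_paths2 :: "nat \<Rightarrow> nat \<Rightarrow> sample \<Rightarrow> nat" where
  "num_paths2 m n \<omega> = (\<Sum>v<n. degG m n \<omega> v choose 2)"

definition clustering :: "nat \<Rightarrow> nat \<Rightarrow> sample \<Rightarrow> real" where
  "clustering m n \<omega> = 3 * real (num_triangles m n \<omega>) / real (num_paths2 m n \<omega>)"

end

theory Submission
  imports Defs "HOL-Combinatorics.Multiset_Permutations" "HOL-Real_Asymp.Real_Asymp"
begin

text \<open>
  Condition on the weights and write \<open>s = sqrt (m n)\<close>, \<open>\<alpha> = b1 / sqrt \<beta>\<close>, \<open>\<rho> = a2 b1\<close>,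
  \<open>A = S_X \<alpha>^3\<close> and \<open>B = S_Y \<rho>^2\<close>. For weights that satisfy finitely many laws of large
  numbers, the number \<open>T\<close> of ordered triangles and the number \<open>Q\<close> of ordered paths of length 2
  satisfy \<open>E |T - A| \<le> C \<epsilon> (A + B)\<close> and \<open>E |Q - (A + B)| \<le> C \<epsilon> (A + B)\<close>, so that
  \<open>C_G = T / Q\<close> is close to \<open>A / (A + B)\<close>, which is the claimed limit.

  Upper bounds are first moments: a path of length 2 either lies in the clique of one attribute
  (contributing \<open>A\<close>) or uses two attributes (contributing \<open>B\<close>), and a triangle not lying in one
  clique needs three different attributes, which has expectation \<open>o(B)\<close>.

  For the lower bounds, fix \<open>K\<close> and then \<open>L\<close> much larger. As the third moment of \<open>X\<close> and the second
  moment of \<open>Y\<close> are infinite, only attributes and vertices of weight above \<open>L\<close> matter in \<open>S_X\<close> and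
  \<open>S_Y\<close>. An attribute above \<open>L\<close> has a concentrated number of neighbours of weight at most \<open>K\<close>, and a
  vertex above \<open>L\<close> has a concentrated number of neighbours of weight at most \<open>K\<close> reached through
  attributes of weight at most \<open>K\<close>; the first kind gives almost all of \<open>A\<close>, the second almost all of
  \<open>B\<close>. The two kinds of paths have centres below \<open>K\<close> and above \<open>L\<close> respectively, hence are disjoint.
\<close>

section \<open>Tuples of distinct indices\<close>

text \<open>Two obstacles shape the proof. First, the summands of \<open>S_X\<close> and
  \<open>S_Y\<close> have infinite mean, so no law of large numbers with a finite limit replaces
  these sums by deterministic quantities. They are kept as they are: every error is measured
  relative to \<open>A + B\<close> at the given weights, whatever the sizes of \<open>A\<close> and
  \<open>B\<close> relative to each other. Second, the cap in \<open>min 1 (x i * y j / s)\<close>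
  is harmless for upper bounds but spoils lower bounds. A linear bound on the sum of
  \<open>x i ^ 2\<close> gives max x = O(sqrt m), and a small tail of the sum of \<open>y j\<close>
  gives max y = o(n), so the cap is inactive as soon as one of the two weights is at most
  \<open>K\<close>. Lower bounds therefore use only links with at least one such end.

  Origin of the constants: \<alpha> is the limit of \<open>y1 / s\<close> and \<rho> that of
  \<open>x2 * y1 / s ^ 2\<close>, where \<open>x2\<close> and \<open>y1\<close> are the sums of the
  \<open>x i ^ 2\<close> and of the \<open>y j\<close>. Thus an attribute of weight x has about x
  \<alpha> neighbours, hence about (x \<alpha>)^3 ordered triples in its clique, and a vertex of
  weight y has about y \<rho> neighbours. Finally \<open>B / A = \<kappa> * S_Y / S_X\<close>,
  because \<rho>^2 / \<alpha>^3 = \<beta>^(3/2) a2^2 / b1.\<close>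

definition distinct2 :: "'a set \<Rightarrow> ('a \<times> 'a) set" where
  "distinct2 V = (SIGMA j:V. V - {j})"

definition distinct3 :: "'a set \<Rightarrow> ('a \<times> 'a \<times> 'a) set" where
  "distinct3 V = (SIGMA j:V. SIGMA k:V - {j}. V - {j, k})"

lemma finite_distinct2 [simp]: "finite V \<Longrightarrow> finite (distinct2 V)"
  by (simp add: distinct2_def)

lemma finite_distinct3 [simp]: "finite V \<Longrightarrow> finite (distinct3 V)"
  by (simp add: distinct3_def)

lemma mem_distinct2 [simp]: "(j, k) \<in> distinct2 V \<longleftrightarrow> j \<in> V \<and> k \<in> V \<and> j \<noteq> k"
  by (auto simp: distinct2_def)

lemma mem_distinct3 [simp]:
  "(j, k, l) \<in> distinct3 V \<longleftrightarrow> j \<in> V \<and> k \<in> V \<and> l \<in> V \<and> j \<noteq> k \<and> j \<noteq> l \<and> k \<noteq> l"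
  by (auto simp: distinct3_def)

text \<open>A falling factorial for 0/1-valued \<open>b\<close>: excluding the index
  \<open>j\<close> lowers the inner sum by \<open>b j\<close>, and \<open>b j * b j = b j\<close>
  turns this into a loss of exactly 1.\<close>

lemma sum_distinct2_idempotent:
  fixes b :: "'a \<Rightarrow> real"
  assumes "finite V" and idem: "\<And>v. b v * b v = b v"
  shows "(\<Sum>(j, k)\<in>distinct2 V. b j * b k) = sum b V * (sum b V - 1)"
proof -
  have "(\<Sum>(j, k)\<in>distinct2 V. b j * b k) = (\<Sum>j\<in>V. \<Sum>k\<in>V - {j}. b j * b k)"
    unfolding distinct2_def using assms by (subst sum.Sigma) auto
  also have "\<dots> = (\<Sum>j\<in>V. b j * (sum b V - 1))"
  proof (rule sum.cong)
    fix j assume "j \<in> V"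
    then have "(\<Sum>k\<in>V - {j}. b j * b k) = b j * (sum b V - b j)"
      using \<open>finite V\<close> by (simp add: sum_distrib_left[symmetric] sum_diff1)
    then show "(\<Sum>k\<in>V - {j}. b j * b k) = b j * (sum b V - 1)"
      by (simp add: algebra_simps idem)
  qed simp
  finally show ?thesis by (simp add: sum_distrib_right)
qed

lemma sum_distinct3_idempotent:
  fixes b :: "'a \<Rightarrow> real"
  assumes "finite V" and idem: "\<And>v. b v * b v = b v"
  shows "(\<Sum>(j, k, l)\<in>distinct3 V. b j * b k * b l) = sum b V * (sum b V - 1) * (sum b V - 2)"
proof -
  have "(\<Sum>(j, k, l)\<in>distinct3 V. b j * b k * b l)
      = (\<Sum>j\<in>V. \<Sum>k\<in>V - {j}. \<Sum>l\<in>V - {j, k}. b j * b k * b l)"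
    unfolding distinct3_def using assms by (simp add: sum.Sigma)
  also have "\<dots> = (\<Sum>j\<in>V. \<Sum>k\<in>V - {j}. b j * b k * (sum b V - 2))"
  proof (intro sum.cong refl)
    fix j k assume "j \<in> V" "k \<in> V - {j}"
    then have "sum b (V - {j, k}) = sum b V - b j - b k"
      using \<open>finite V\<close> by (auto simp: sum_diff)
    then have "(\<Sum>l\<in>V - {j, k}. b j * b k * b l) = b j * b k * (sum b V - b j - b k)"
      by (simp add: sum_distrib_left[symmetric])
    also have "\<dots> = b j * b k * sum b V - (b j * b j) * b k - b j * (b k * b k)"
      by (simp add: algebra_simps)
    finally show "(\<Sum>l\<in>V - {j, k}. b j * b k * b l) = b j * b k * (sum b V - 2)"
      by (simp add: idem algebra_simps)
  qed
  also have "\<dots> = (\<Sum>(j, k)\<in>distinct2 V. b j * b k) * (sum b V - 2)"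
    unfolding distinct2_def using \<open>finite V\<close> by (simp add: sum.Sigma[symmetric] sum_distrib_right)
  finally show ?thesis using sum_distinct2_idempotent[of V b] assms by simp
qed

lemma sum_distinct2_le:
  fixes f g :: "'a \<Rightarrow> real"
  assumes "finite V" "\<And>v. v \<in> V \<Longrightarrow> 0 \<le> f v" "\<And>v. v \<in> V \<Longrightarrow> 0 \<le> g v"
  shows "(\<Sum>(j, k)\<in>distinct2 V. f j * g k) \<le> sum f V * sum g V"
proof -
  have "(\<Sum>(j, k)\<in>distinct2 V. f j * g k) \<le> (\<Sum>(j, k)\<in>V \<times> V. f j * g k)"
    using assms by (intro sum_mono2) (auto simp: distinct2_def)
  also have "\<dots> = sum f V * sum g V"
    by (simp add: sum.cartesian_product[symmetric] sum_product)
  finally show ?thesis .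
qed

lemma sum_distinct3_le:
  fixes f :: "'a \<Rightarrow> real" and g :: "'a \<Rightarrow> 'a \<Rightarrow> real"
  assumes "finite V" "\<And>v. v \<in> V \<Longrightarrow> 0 \<le> f v" "\<And>u v. u \<in> V \<Longrightarrow> v \<in> V \<Longrightarrow> 0 \<le> g u v"
  shows "(\<Sum>(j, k, l)\<in>distinct3 V. f j * g k l) \<le> sum f V * (\<Sum>k\<in>V. \<Sum>l\<in>V. g k l)"
proof -
  have "(\<Sum>(j, k, l)\<in>distinct3 V. f j * g k l) \<le> (\<Sum>(j, k, l)\<in>V \<times> V \<times> V. f j * g k l)"
    using assms by (intro sum_mono2) (auto simp: distinct3_def)
  also have "\<dots> = (\<Sum>j\<in>V. \<Sum>k\<in>V. \<Sum>l\<in>V. f j * g k l)"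
    by (simp add: sum.cartesian_product[symmetric])
  also have "\<dots> = sum f V * (\<Sum>k\<in>V. \<Sum>l\<in>V. g k l)"
    by (simp add: sum_distrib_left[symmetric] sum_distrib_right[symmetric])
  finally show ?thesis .
qed

text \<open>Bonferroni: \<open>[N \<ge> 1] \<ge> N - N (N - 1)\<close> for the number \<open>N\<close> of indices satisfying \<open>P\<close>.\<close>

lemma of_bool_Bex_ge:
  assumes "finite F"
  shows "(\<Sum>i\<in>F. of_bool (P i)) - (\<Sum>(i, i')\<in>distinct2 F. of_bool (P i \<and> P i'))
     \<le> (of_bool (\<exists>i\<in>F. P i) :: real)"
proof -
  define N where "N = card {i \<in> F. P i}"
  have N: "(\<Sum>i\<in>F. of_bool (P i)) = real N"
    using assms by (simp add: N_def sum_of_bool_eq Int_def)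
  have N2: "(\<Sum>(i, i')\<in>distinct2 F. of_bool (P i \<and> P i')) = real N * (real N - 1)"
    using sum_distinct2_idempotent[OF assms, of "\<lambda>i. of_bool (P i)"] N
    by (simp add: of_bool_conj)
  show ?thesis
  proof (cases "N = 0")
    case True
    then show ?thesis unfolding N N2 by simp
  next
    case False
    then have "{i \<in> F. P i} \<noteq> {}" unfolding N_def by (metis card.empty)
    then have "\<exists>i\<in>F. P i" by auto
    moreover have "0 \<le> (real N - 1)\<^sup>2" by simp
    ultimately show ?thesis unfolding N N2 by (simp add: power2_eq_square algebra_simps)
  qed
qed

text \<open>Each admissible 3-set has 3! = 6 orderings, and the families
  \<open>permutations_of_set T\<close> are disjoint because a list determines its set. Symmetry of
  \<open>R\<close> makes the condition on an ordered triple independent of the order.\<close>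

lemma six_card_triples:
  fixes V :: "'a set"
  assumes "finite V" and sym: "\<And>a b. R a b \<Longrightarrow> R b a"
  shows "6 * card {T. T \<subseteq> V \<and> card T = 3 \<and> (\<forall>a\<in>T. \<forall>b\<in>T. a \<noteq> b \<longrightarrow> R a b)}
    = card {(j, k, l) \<in> distinct3 V. R j k \<and> R j l \<and> R k l}"
proof -
  define F where "F = {T. T \<subseteq> V \<and> card T = 3 \<and> (\<forall>a\<in>T. \<forall>b\<in>T. a \<noteq> b \<longrightarrow> R a b)}"
  define D where "D = {(j, k, l) \<in> distinct3 V. R j k \<and> R j l \<and> R k l}"
  have finF: "finite F" unfolding F_def using assms(1) by (auto intro!: finite_subset[of _ "Pow V"])
  have finT: "finite T" "card T = 3" if "T \<in> F" for T
    using that assms(1) by (auto simp: F_def dest: finite_subset)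
  have "card (\<Union>T\<in>F. permutations_of_set T) = (\<Sum>T\<in>F. card (permutations_of_set T))"
    using finF by (intro card_UN_disjoint) (auto dest: permutations_of_setD)
  also have "\<dots> = (\<Sum>T\<in>F. 6)"
    using finT by (intro sum.cong) (auto simp: fact_numeral)
  finally have 1: "card (\<Union>T\<in>F. permutations_of_set T) = 6 * card F" by simp
  have "bij_betw (\<lambda>(j, k, l). [j, k, l]) D (\<Union>T\<in>F. permutations_of_set T)"
  proof (rule bij_betw_imageI)
    show "inj_on (\<lambda>(j, k, l). [j, k, l]) D" by (auto simp: inj_on_def)
    show "(\<lambda>(j, k, l). [j, k, l]) ` D = (\<Union>T\<in>F. permutations_of_set T)"
    proof (intro equalityI subsetI)
      fix xs assume "xs \<in> (\<lambda>(j, k, l). [j, k, l]) ` D"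
      then obtain j k l where jkl: "xs = [j, k, l]" "(j, k, l) \<in> distinct3 V" "R j k" "R j l" "R k l"
        by (auto simp: D_def)
      then have "{j, k, l} \<in> F" using sym by (auto simp: F_def)
      moreover have "xs \<in> permutations_of_set {j, k, l}"
        using jkl by (intro permutations_of_setI) auto
      ultimately show "xs \<in> (\<Union>T\<in>F. permutations_of_set T)" by blast
    next
      fix xs assume "xs \<in> (\<Union>T\<in>F. permutations_of_set T)"
      then obtain T where T: "T \<in> F" "set xs = T" "distinct xs"
        by (auto dest: permutations_of_setD)
      then have "length xs = 3" using finT distinct_card by metis
      then obtain j k l where "xs = [j, k, l]"
        by (auto simp: length_Suc_conv numeral_3_eq_3)
      then show "xs \<in> (\<lambda>(j, k, l). [j, k, l]) ` D"
        using T by (intro image_eqI[of _ _ "(j, k, l)"]) (auto simp: D_def F_def)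
    qed
  qed
  then have "card D = card (\<Union>T\<in>F. permutations_of_set T)" by (rule bij_betw_same_card)
  then show ?thesis using 1 unfolding F_def D_def by simp
qed

lemma adjG_sym: "adjG m n \<omega> a b \<Longrightarrow> adjG m n \<omega> b a"
  by (auto simp: adjG_def)

lemma num_triangles_eq_sum:
  "6 * real (num_triangles m n \<omega>)
    = (\<Sum>(j, k, l)\<in>distinct3 {..<n}. of_bool (adjG m n \<omega> j k \<and> adjG m n \<omega> j l \<and> adjG m n \<omega> k l))"
proof -
  have "6 * real (num_triangles m n \<omega>) = real (6 * num_triangles m n \<omega>)" by simp
  also have "6 * num_triangles m n \<omega>
      = card {(j, k, l) \<in> distinct3 {..<n}. adjG m n \<omega> j k \<and> adjG m n \<omega> j l \<and> adjG m n \<omega> k l}"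
    unfolding num_triangles_def by (rule six_card_triples) (auto intro: adjG_sym)
  also have "\<dots> = card (distinct3 {..<n} \<inter> {t. adjG m n \<omega> (fst t) (fst (snd t))
      \<and> adjG m n \<omega> (fst t) (snd (snd t)) \<and> adjG m n \<omega> (fst (snd t)) (snd (snd t))})"
    by (intro arg_cong[of _ _ card]) auto
  finally show ?thesis by (simp add: case_prod_beta)
qed

text \<open>The first component is the centre of the path. The factor 2 orders the two ends and
  matches the factor 6 for triangles, since 3/1 = 6/2.\<close>

lemma num_paths2_eq_sum:
  "2 * real (num_paths2 m n \<omega>)
    = (\<Sum>(j, k, l)\<in>distinct3 {..<n}. of_bool (adjG m n \<omega> j k \<and> adjG m n \<omega> j l))"
proof -
  let ?b = "\<lambda>j k. of_bool (adjG m n \<omega> j k) :: real"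
  have choose: "2 * real (d choose 2) = real d * (real d - 1)" for d :: nat
  proof -
    have "real (2 * (d choose 2)) = real (d * (d - 1))"
      using times_binomial_minus1_eq[of 2 d] by (simp only: zero_less_numeral) simp
    then show ?thesis by (cases d) (auto simp: algebra_simps)
  qed
  have "2 * real (num_paths2 m n \<omega>) = (\<Sum>j<n. real (degG m n \<omega> j) * (real (degG m n \<omega> j) - 1))"
    unfolding num_paths2_def by (simp add: sum_distrib_left choose)
  also have "\<dots> = (\<Sum>j<n. \<Sum>(k, l)\<in>distinct2 {..<n}. ?b j k * ?b j l)"
  proof (rule sum.cong)
    fix j
    have "real (degG m n \<omega> j) = (\<Sum>k<n. ?b j k)" by (simp add: degG_def Int_def)
    then show "real (degG m n \<omega> j) * (real (degG m n \<omega> j) - 1) = (\<Sum>(k, l)\<in>distinct2 {..<n}. ?b j k * ?b j l)"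
      by (subst sum_distinct2_idempotent) auto
  qed simp
  also have "\<dots> = (\<Sum>(j, k, l)\<in>{..<n} \<times> distinct2 {..<n}. of_bool (adjG m n \<omega> j k \<and> adjG m n \<omega> j l))"
    unfolding sum.cartesian_product by (intro sum.cong) auto
  \<comment> \<open>Triples with \<open>k = j\<close> or \<open>l = j\<close> contribute 0, because
    \<open>adjG\<close> is irreflexive.\<close>
  also have "\<dots> = (\<Sum>(j, k, l)\<in>distinct3 {..<n}. of_bool (adjG m n \<omega> j k \<and> adjG m n \<omega> j l))"
    by (rule sum.mono_neutral_right) (auto simp: adjG_def)
  finally show ?thesis .
qed

section \<open>A weak law of large numbers\<close>

lemma iid_component:
  assumes "prob_space P"
  shows "distr (PiM UNIV (\<lambda>_. P)) P (\<lambda>x. x i) = P"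
  using distr_PiM_component[of UNIV "\<lambda>_. P" i] assms by simp

lemma iid_integral:
  fixes g :: "'a \<Rightarrow> real"
  assumes "prob_space P" "integrable P g"
  shows "integrable (PiM UNIV (\<lambda>_. P)) (\<lambda>x. g (x i))"
    and "(\<integral>x. g (x i) \<partial>PiM UNIV (\<lambda>_. P)) = (\<integral>z. g z \<partial>P)"
proof -
  have "integrable (distr (PiM UNIV (\<lambda>_. P)) P (\<lambda>x. x i)) g"
    using assms by (simp add: iid_component)
  then show "integrable (PiM UNIV (\<lambda>_. P)) (\<lambda>x. g (x i))"
    by (intro integrable_distr[where M = "PiM UNIV (\<lambda>_. P)" and T = "\<lambda>x. x i" and M' = P]) simp_all
  have "(\<integral>z. g z \<partial>distr (PiM UNIV (\<lambda>_. P)) P (\<lambda>x. x i)) = (\<integral>x. g (x i) \<partial>PiM UNIV (\<lambda>_. P))"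
    using assms by (intro integral_distr) auto
  then show "(\<integral>x. g (x i) \<partial>PiM UNIV (\<lambda>_. P)) = (\<integral>z. g z \<partial>P)"
    using assms by (simp add: iid_component)
qed

lemma iid_indep_vars:
  assumes "prob_space P"
  shows "prob_space.indep_vars (PiM UNIV (\<lambda>_. P)) (\<lambda>_. P) (\<lambda>i x. x i) UNIV"
proof -
  interpret W: prob_space "PiM UNIV (\<lambda>_. P)" by (intro prob_space_PiM assms(1))
  have "distr (PiM UNIV (\<lambda>_. P)) (PiM UNIV (\<lambda>_. P)) (\<lambda>x. x)
      = PiM UNIV (\<lambda>i. distr (PiM UNIV (\<lambda>_. P)) P (\<lambda>x. x i))"
    using assms by (simp add: iid_component distr_id2)
  then show ?thesis
    by (subst W.indep_vars_iff_distr_eq_PiM) (auto simp: restrict_UNIV distr_id2)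
qed

lemma integral_tail_tendsto_0:
  fixes f :: "'a \<Rightarrow> real"
  assumes "integrable P f"
  shows "(\<lambda>t::nat. \<integral>x. \<bar>f x - (if \<bar>f x\<bar> \<le> real t then f x else 0)\<bar> \<partial>P) \<longlonglongrightarrow> 0"
proof -
  have meas [measurable]: "f \<in> borel_measurable P" using assms by auto
  have "(\<lambda>t::nat. \<integral>x. \<bar>f x - (if \<bar>f x\<bar> \<le> real t then f x else 0)\<bar> \<partial>P) \<longlonglongrightarrow> (\<integral>x. 0 \<partial>P)"
  proof (rule integral_dominated_convergence[where w = "\<lambda>x. \<bar>f x\<bar>"])
    show "AE x in P. (\<lambda>t. \<bar>f x - (if \<bar>f x\<bar> \<le> real t then f x else 0)\<bar>) \<longlonglongrightarrow> 0"
    proof (rule AE_I2, rule tendsto_eventually)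
      fix x
      show "\<forall>\<^sub>F t in sequentially. \<bar>f x - (if \<bar>f x\<bar> \<le> real t then f x else 0)\<bar> = 0"
        using eventually_ge_at_top[of "nat \<lceil>\<bar>f x\<bar>\<rceil>"]
        by eventually_elim (auto simp: nat_ceiling_le_eq)
    qed
  qed (use assms in \<open>auto intro!: AE_I2\<close>)
  then show ?thesis by simp
qed

text \<open>Only integrability is available, so \<open>f\<close> is cut at a level \<open>t\<close>:
  Hoeffding's inequality controls the bounded part \<open>g\<close>, and Markov's inequality the
  remainder \<open>h\<close>, whose mean is a small fraction of the gap \<open>D\<close> between the
  mean and \<open>c\<close>.\<close>

lemma weak_lln_lower:
  fixes f :: "'a \<Rightarrow> real"
  assumes "prob_space P" and int: "integrable P f" and c: "c < (\<integral>x. f x \<partial>P)"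
  shows "(\<lambda>N. measure (PiM UNIV (\<lambda>_::nat. P))
    {x \<in> space (PiM UNIV (\<lambda>_. P)). (\<Sum>i<N. f (x i)) < c * real N}) \<longlonglongrightarrow> 0"
proof (rule tendstoI)
  let ?W = "PiM UNIV (\<lambda>_::nat. P)"
  fix \<eta> :: real assume "0 < \<eta>"
  interpret P: prob_space P by fact
  interpret W: prob_space ?W by (intro prob_space_PiM assms(1))
  have f [measurable]: "f \<in> borel_measurable P" using int by auto
  define D where "D = (\<integral>x. f x \<partial>P) - c"
  have D: "0 < D" using c by (simp add: D_def)
  \<comment> \<open>The bound \<open>D / 4\<close> limits the shift of the mean caused by cutting;
    \<open>D * \<eta> / 8\<close> makes Markov's inequality at level \<open>N * D / 4\<close> cost
    at most \<open>\<eta> / 2\<close>.\<close>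
  have "\<forall>\<^sub>F t in sequentially. (\<integral>x. \<bar>f x - (if \<bar>f x\<bar> \<le> real t then f x else 0)\<bar> \<partial>P) < min (D / 4) (D * \<eta> / 8)"
    using integral_tail_tendsto_0[OF int] by (rule order_tendstoD) (use D \<open>0 < \<eta>\<close> in auto)
  moreover have "\<forall>\<^sub>F t in sequentially. 1 \<le> (t :: nat)" by (rule eventually_ge_at_top)
  ultimately have "\<forall>\<^sub>F t in sequentially. 1 \<le> (t :: nat) \<and>
      (\<integral>x. \<bar>f x - (if \<bar>f x\<bar> \<le> real t then f x else 0)\<bar> \<partial>P) < min (D / 4) (D * \<eta> / 8)"
    by eventually_elim auto
  then obtain t :: nat where t: "1 \<le> t"
      "(\<integral>x. \<bar>f x - (if \<bar>f x\<bar> \<le> real t then f x else 0)\<bar> \<partial>P) < min (D / 4) (D * \<eta> / 8)"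
    using eventually_happens'[OF sequentially_bot] by blast
  define g where "g x = (if \<bar>f x\<bar> \<le> real t then f x else 0)" for x
  define h where "h x = \<bar>f x - g x\<bar>" for x
  define \<delta> where "\<delta> = (\<integral>x. h x \<partial>P)"
  have g [measurable]: "g \<in> borel_measurable P" unfolding g_def by measurable
  have int_g: "integrable P g"
    by (rule P.integrable_const_bound[of _ "real t"]) (auto simp: g_def)
  have gb: "- real t \<le> g x" "g x \<le> real t" for x by (auto simp: g_def)
  have int_h: "integrable P h" unfolding h_def using int int_g by auto
  have \<delta>: "\<delta> < D / 4" "\<delta> < D * \<eta> / 8" using t(2) unfolding \<delta>_def h_def g_def by auto
  have "(\<integral>x. f x \<partial>P) - (\<integral>x. g x \<partial>P) = (\<integral>x. f x - g x \<partial>P)" using int int_g by simp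
  also have "\<dots> \<le> \<delta>" unfolding \<delta>_def h_def using int int_g by (intro integral_mono) auto
  finally have Eg: "(\<integral>x. f x \<partial>P) - \<delta> \<le> (\<integral>x. g x \<partial>P)" by linarith
  have bound: "W.prob {x \<in> space ?W. (\<Sum>i<N. f (x i)) < c * real N}
      \<le> exp (- 2 * real N * (D / 4)\<^sup>2 / (real t - (- real t))\<^sup>2) + \<eta> / 2" if "1 \<le> N" for N
  proof -
    interpret Hoeffding_ineq_iid ?W "{..<N}" "\<lambda>i x. g (x i)" "\<lambda>x. g (x 0)" "- real t" "real t" "\<integral>x. g x \<partial>P"
    proof unfold_locales
      show "W.indep_vars (\<lambda>_. borel) (\<lambda>i x. g (x i)) {..<N}"
        using W.indep_vars_subset[OF iid_indep_vars[OF \<open>prob_space P\<close>], of "{..<N}"]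
        by (intro W.indep_vars_compose2[where M' = "\<lambda>_. P" and X = "\<lambda>i x. x i" and Y = "\<lambda>_. g"]) auto
      fix i assume "i \<in> {..<N}"
      have "distr ?W borel (\<lambda>x. g (x j)) = distr P borel g" for j
      proof -
        have "distr P borel g = distr (distr ?W P (\<lambda>x. x j)) borel g"
          by (simp add: iid_component[OF \<open>prob_space P\<close>])
        also have "\<dots> = distr ?W borel (\<lambda>x. g (x j))"
          by (subst distr_distr) (auto simp: comp_def)
        finally show ?thesis ..
      qed
      then show "distr ?W borel (\<lambda>x. g (x i)) = distr ?W borel (\<lambda>x. g (x 0))" by simp
    qed (simp_all add: gb iid_integral(2)[OF assms(1) int_g])
    have 1: "W.prob {x \<in> space ?W. (\<Sum>i<N. g (x i)) / real N \<le> (\<integral>x. g x \<partial>P) - D / 4}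
        \<le> exp (- 2 * real N * (D / 4)\<^sup>2 / (real t - (- real t))\<^sup>2)"
      using Hoeffding_ineq_le'[of "D / 4"] D t(1) that
      by (simp add: lessThan_empty_iff)
    have int_hs: "integrable ?W (\<lambda>x. \<Sum>i<N. h (x i))"
      by (intro Bochner_Integration.integrable_sum iid_integral(1)[OF assms(1) int_h])
    have "W.prob {x \<in> space ?W. (\<Sum>i<N. h (x i)) \<ge> real N * (D / 4)}
        \<le> (\<integral>x. (\<Sum>i<N. h (x i)) \<partial>?W) / (real N * (D / 4))"
      by (rule integral_Markov_inequality_measure[where A = "{}"])
        (use int_hs that D in \<open>auto simp: h_def intro!: AE_I2 sum_nonneg\<close>)
    also have "(\<integral>x. (\<Sum>i<N. h (x i)) \<partial>?W) = real N * \<delta>"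
      by (simp add: \<delta>_def Bochner_Integration.integral_sum iid_integral[OF assms(1) int_h])
    also have "real N * \<delta> / (real N * (D / 4)) \<le> \<eta> / 2"
      using \<delta> that D by (simp add: field_simps)
    finally have 2: "W.prob {x \<in> space ?W. (\<Sum>i<N. h (x i)) \<ge> real N * (D / 4)} \<le> \<eta> / 2" .
    have h [measurable]: "h \<in> borel_measurable P" using int_h by auto
    have "W.prob {x \<in> space ?W. (\<Sum>i<N. f (x i)) < c * real N}
      \<le> W.prob ({x \<in> space ?W. (\<Sum>i<N. g (x i)) / real N \<le> (\<integral>x. g x \<partial>P) - D / 4}
         \<union> {x \<in> space ?W. (\<Sum>i<N. h (x i)) \<ge> real N * (D / 4)})"
    proof (rule W.finite_measure_mono)
      show "{x \<in> space ?W. (\<Sum>i<N. f (x i)) < c * real N}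
        \<subseteq> {x \<in> space ?W. (\<Sum>i<N. g (x i)) / real N \<le> (\<integral>x. g x \<partial>P) - D / 4}
         \<union> {x \<in> space ?W. (\<Sum>i<N. h (x i)) \<ge> real N * (D / 4)}"
      proof (rule subsetI, rule ccontr)
        fix x assume x: "x \<in> {x \<in> space ?W. (\<Sum>i<N. f (x i)) < c * real N}"
          and "x \<notin> {x \<in> space ?W. (\<Sum>i<N. g (x i)) / real N \<le> (\<integral>x. g x \<partial>P) - D / 4}
           \<union> {x \<in> space ?W. (\<Sum>i<N. h (x i)) \<ge> real N * (D / 4)}"
        then have g: "(\<Sum>i<N. g (x i)) > real N * ((\<integral>x. g x \<partial>P) - D / 4)"
          and h: "(\<Sum>i<N. h (x i)) < real N * (D / 4)"
          using that by (auto simp: field_simps)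
        \<comment> \<open>Budget per summand: the gap \<open>D\<close> loses \<open>D / 4\<close> to
          cutting, \<open>D / 4\<close> to the deviation of \<open>g\<close> and
          \<open>D / 4\<close> to \<open>h\<close>, so a positive \<open>D / 4\<close> above
          \<open>c\<close> remains.\<close>
        have "(\<Sum>i<N. g (x i)) - (\<Sum>i<N. h (x i)) \<le> (\<Sum>i<N. f (x i))"
          unfolding sum_subtractf[symmetric] by (intro sum_mono) (auto simp: h_def)
        moreover have "real N * c + real N * (D / 4) + real N * (D / 4) \<le> real N * ((\<integral>x. g x \<partial>P) - D / 4)"
          using Eg \<delta> unfolding D_def distrib_left[symmetric] by (intro mult_left_mono) (auto simp: field_simps)
        moreover have "0 \<le> real N * (D / 4)" using D by simp
        moreover have "(\<Sum>i<N. f (x i)) < real N * c" using x by (simp add: mult.commute)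
        ultimately show False using g h by linarith
      qed
    qed measurable
    also have "\<dots> \<le> W.prob {x \<in> space ?W. (\<Sum>i<N. g (x i)) / real N \<le> (\<integral>x. g x \<partial>P) - D / 4}
         + W.prob {x \<in> space ?W. (\<Sum>i<N. h (x i)) \<ge> real N * (D / 4)}"
      by (rule measure_Un_le) measurable
    finally show ?thesis using 1 2 by linarith
  qed
  define r where "r = 2 * (D / 4)\<^sup>2 / (real t - (- real t))\<^sup>2"
  have "0 < r" using D t(1) by (simp add: r_def)
  then have "(\<lambda>N. exp (- (r * real N))) \<longlonglongrightarrow> 0" by real_asymp
  then have "\<forall>\<^sub>F N in sequentially. exp (- (r * real N)) < \<eta> / 2"
    by (rule order_tendstoD) (use \<open>0 < \<eta>\<close> in auto)
  moreover have "\<forall>\<^sub>F N in sequentially. 1 \<le> (N :: nat)" by (rule eventually_ge_at_top)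
  ultimately show "\<forall>\<^sub>F N in sequentially.
      dist (W.prob {x \<in> space ?W. (\<Sum>i<N. f (x i)) < c * real N}) 0 < \<eta>"
  proof eventually_elim
    case (elim N)
    have "- 2 * real N * (D / 4)\<^sup>2 / (real t - (- real t))\<^sup>2 = - (r * real N)"
      by (simp add: r_def)
    then show ?case using bound[OF elim(2)] elim(1) by simp
  qed
qed

lemma weak_lln_upper:
  fixes f :: "'a \<Rightarrow> real"
  assumes "prob_space P" and int: "integrable P f" and c: "(\<integral>x. f x \<partial>P) < c"
  shows "(\<lambda>N. measure (PiM UNIV (\<lambda>_::nat. P))
    {x \<in> space (PiM UNIV (\<lambda>_. P)). c * real N < (\<Sum>i<N. f (x i))}) \<longlonglongrightarrow> 0"
  using weak_lln_lower[of P "\<lambda>x. - f x" "- c"] assms by (simp add: sum_negf)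

section \<open>First moments in a random bipartite graph\<close>

text \<open>Independence enters only through the probability that a finite set of links is present.
  As \<open>S\<close> is a set, a link required twice counts once; this is the source of the
  diagonal terms in second moments.\<close>

locale random_bipartite = prob_space M for M :: "'w measure" +
  fixes H :: "nat \<Rightarrow> nat \<Rightarrow> 'w \<Rightarrow> bool" and p :: "nat \<Rightarrow> nat \<Rightarrow> real"
  assumes pred_H [measurable]: "\<And>i j. Measurable.pred M (H i j)"
    and prob_links: "\<And>S. finite S \<Longrightarrow>
      prob {\<omega> \<in> space M. \<forall>(i, j)\<in>S. H i j \<omega>} = (\<Prod>(i, j)\<in>S. p i j)"
begin

definition links :: "(nat \<times> nat) set \<Rightarrow> 'w \<Rightarrow> real" where
  "links S \<omega> = of_bool (\<forall>(i, j)\<in>S. H i j \<omega>)"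

lemma pred_links: "finite S \<Longrightarrow> Measurable.pred M (\<lambda>\<omega>. \<forall>(i, j)\<in>S. H i j \<omega>)"
  unfolding case_prod_beta by measurable

lemma integrable_of_bool:
  "Measurable.pred M P \<Longrightarrow> integrable M (\<lambda>\<omega>. of_bool (P \<omega>) :: real)"
  by (rule integrable_const_bound[of _ 1]) auto

lemma integrable_links [simp, intro]: "finite S \<Longrightarrow> integrable M (links S)"
  unfolding links_def by (intro integrable_of_bool pred_links)

lemma expectation_links:
  assumes "finite S" shows "expectation (links S) = (\<Prod>(i, j)\<in>S. p i j)"
proof -
  have "expectation (links S) = expectation (indicator {\<omega> \<in> space M. \<forall>(i, j)\<in>S. H i j \<omega>})"
    by (rule Bochner_Integration.integral_cong) (auto simp: links_def indicator_def)
  also have "\<dots> = prob {\<omega> \<in> space M. \<forall>(i, j)\<in>S. H i j \<omega>}"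
    by (auto intro!: arg_cong[of _ _ prob])
  finally show ?thesis using prob_links[OF assms] by simp
qed

lemma p_bounds: "0 \<le> p i j" "p i j \<le> 1"
  using prob_links[of "{(i, j)}"] measure_nonneg[of M "{\<omega> \<in> space M. \<forall>(i, j)\<in>{(i, j)}. H i j \<omega>}"]
    prob_le_1[of "{\<omega> \<in> space M. \<forall>(i, j)\<in>{(i, j)}. H i j \<omega>}"] by auto

end

text \<open>An upper bound on \<open>p\<close> suffices at this stage, so capped probabilities are
  allowed: first-moment upper bounds do not see the cap.\<close>

locale weighted_bipartite = random_bipartite M H p
  for M :: "'w measure" and H p +
  fixes x y :: "nat \<Rightarrow> real" and s :: real and m n :: nat
  assumes s_pos: "0 < s"
    and x_nonneg: "\<And>i. i < m \<Longrightarrow> 0 \<le> x i" and y_nonneg: "\<And>j. j < n \<Longrightarrow> 0 \<le> y j"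
    and p_le: "\<And>i j. i < m \<Longrightarrow> j < n \<Longrightarrow> p i j \<le> x i * y j / s"
begin

definition x2 :: real where "x2 = (\<Sum>i<m. x i ^ 2)"
definition x3 :: real where "x3 = (\<Sum>i<m. x i ^ 3)"
definition y1 :: real where "y1 = (\<Sum>j<n. y j)"
definition y2 :: real where "y2 = (\<Sum>j<n. y j ^ 2)"

definition adj :: "nat \<Rightarrow> nat \<Rightarrow> 'w \<Rightarrow> bool" where
  "adj j k \<omega> \<longleftrightarrow> (\<exists>i<m. H i j \<omega> \<and> H i k \<omega>)"

definition triangles :: "'w \<Rightarrow> real" where
  "triangles \<omega> = (\<Sum>(j, k, l)\<in>distinct3 {..<n}. of_bool (adj j k \<omega> \<and> adj j l \<omega> \<and> adj k l \<omega>))"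

definition cherries :: "'w \<Rightarrow> real" where
  "cherries \<omega> = (\<Sum>(j, k, l)\<in>distinct3 {..<n}. of_bool (adj j k \<omega> \<and> adj j l \<omega>))"

lemma pred_adj [measurable]: "Measurable.pred M (adj j k)"
  unfolding adj_def by measurable

lemma moments_nonneg: "0 \<le> x2" "0 \<le> x3" "0 \<le> y1" "0 \<le> y2"
  unfolding x2_def x3_def y1_def y2_def using x_nonneg y_nonneg by (auto intro!: sum_nonneg)

lemma integrable_counts: "integrable M triangles" "integrable M cherries"
  unfolding triangles_def cherries_def case_prod_beta
  by (intro Bochner_Integration.integrable_sum integrable_of_bool; measurable)+

lemma expectation_links_le:
  assumes "S \<subseteq> {..<m} \<times> {..<n}" "finite S"
  shows "expectation (links S) \<le> (\<Prod>(i, j)\<in>S. x i * y j / s)"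
  unfolding expectation_links[OF assms(2)]
  using assms p_le p_bounds by (intro prod_mono) auto

text \<open>The three ways in which edges arise: a star puts all three vertices under one attribute,
  a cherry is a path centred at \<open>j\<close> using two attributes, and a cycle is a triangle
  using three. Their 3, 4 and 6 links explain the powers of \<open>s\<close> below.\<close>

abbreviation star_links :: "nat \<Rightarrow> nat \<Rightarrow> nat \<Rightarrow> nat \<Rightarrow> (nat \<times> nat) set" where
  "star_links j k l i \<equiv> {(i, j), (i, k), (i, l)}"

abbreviation cherry_links :: "nat \<Rightarrow> nat \<Rightarrow> nat \<Rightarrow> nat \<Rightarrow> nat \<Rightarrow> (nat \<times> nat) set" where
  "cherry_links j k l i i' \<equiv> {(i, j), (i, k), (i', j), (i', l)}"

abbreviation cycle_links :: "nat \<Rightarrow> nat \<Rightarrow> nat \<Rightarrow> nat \<Rightarrow> nat \<Rightarrow> nat \<Rightarrow> (nat \<times> nat) set" where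
  "cycle_links j k l i i' i'' \<equiv> {(i, j), (i, k), (i', j), (i', l), (i'', k), (i'', l)}"

lemma expectation_stars_le:
  assumes "(j, k, l) \<in> distinct3 {..<n}"
  shows "(\<Sum>i<m. expectation (links (star_links j k l i))) \<le> x3 / s ^ 3 * (y j * y k * y l)"
proof -
  have "(\<Sum>i<m. expectation (links (star_links j k l i)))
      \<le> (\<Sum>i<m. x i ^ 3 / s ^ 3 * (y j * y k * y l))"
  proof (rule sum_mono)
    fix i assume "i \<in> {..<m}"
    then have "expectation (links (star_links j k l i)) \<le> (\<Prod>(i, j)\<in>star_links j k l i. x i * y j / s)"
      using assms by (intro expectation_links_le) auto
    also have "\<dots> = x i ^ 3 / s ^ 3 * (y j * y k * y l)"
      using assms by (simp add: power3_eq_cube mult_ac)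
    finally show "expectation (links (star_links j k l i)) \<le> x i ^ 3 / s ^ 3 * (y j * y k * y l)" .
  qed
  then show ?thesis by (simp add: x3_def sum_distrib_right sum_divide_distrib)
qed

lemma expectation_cherries_le:
  assumes "(j, k, l) \<in> distinct3 {..<n}"
  shows "(\<Sum>(i, i')\<in>distinct2 {..<m}. expectation (links (cherry_links j k l i i')))
    \<le> x2 ^ 2 / s ^ 4 * (y j ^ 2 * (y k * y l))"
proof -
  have "(\<Sum>(i, i')\<in>distinct2 {..<m}. expectation (links (cherry_links j k l i i')))
      \<le> (\<Sum>(i, i')\<in>distinct2 {..<m}. x i ^ 2 * (x i' ^ 2 * (y j ^ 2 * (y k * y l) / s ^ 4)))"
  proof (intro sum_mono, clarify)
    fix i i' assume i: "(i, i') \<in> distinct2 {..<m}"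
    then have "expectation (links (cherry_links j k l i i'))
        \<le> (\<Prod>(i, j)\<in>cherry_links j k l i i'. x i * y j / s)"
      using assms by (intro expectation_links_le) auto
    also have "\<dots> = x i ^ 2 * (x i' ^ 2 * (y j ^ 2 * (y k * y l) / s ^ 4))"
      using assms i by (simp add: power2_eq_square power4_eq_xxxx mult_ac)
    finally show "expectation (links (cherry_links j k l i i'))
        \<le> x i ^ 2 * (x i' ^ 2 * (y j ^ 2 * (y k * y l) / s ^ 4))" .
  qed
  also have "\<dots> \<le> (\<Sum>i<m. x i ^ 2) * (\<Sum>i<m. x i ^ 2 * (y j ^ 2 * (y k * y l) / s ^ 4))"
    using assms y_nonneg s_pos by (intro sum_distinct2_le) auto
  also have "\<dots> = x2 ^ 2 / s ^ 4 * (y j ^ 2 * (y k * y l))"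
    by (simp add: x2_def sum_distrib_right[symmetric] power2_eq_square sum_divide_distrib[symmetric])
  finally show ?thesis .
qed

text \<open>The bound is arranged as that of a two-attribute path times
  \<open>x2 / s ^ 2 * (y k * y l)\<close>, which bounds the expected number of attributes joining
  \<open>k\<close> and \<open>l\<close>. The last factor is the one that gets capped at 1
  afterwards.\<close>

lemma expectation_cycles_le:
  assumes "(j, k, l) \<in> distinct3 {..<n}"
  shows "(\<Sum>(i, i', i'')\<in>distinct3 {..<m}. expectation (links (cycle_links j k l i i' i'')))
    \<le> x2 ^ 2 / s ^ 4 * (y j ^ 2 * (y k * y l)) * (x2 / s ^ 2 * (y k * y l))"
proof -
  let ?c = "y j ^ 2 * y k ^ 2 * y l ^ 2 / s ^ 6"
  have "(\<Sum>(i, i', i'')\<in>distinct3 {..<m}. expectation (links (cycle_links j k l i i' i'')))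
      \<le> (\<Sum>(i, i', i'')\<in>distinct3 {..<m}. x i ^ 2 * (x i' ^ 2 * x i'' ^ 2 * ?c))"
  proof (intro sum_mono, clarify)
    fix i i' i'' assume i: "(i, i', i'') \<in> distinct3 {..<m}"
    then have "expectation (links (cycle_links j k l i i' i''))
        \<le> (\<Prod>(i, j)\<in>cycle_links j k l i i' i''. x i * y j / s)"
      using assms by (intro expectation_links_le) auto
    also have "\<dots> = x i ^ 2 * (x i' ^ 2 * x i'' ^ 2 * ?c)"
      using assms i by (simp add: eval_nat_numeral mult_ac)
    finally show "expectation (links (cycle_links j k l i i' i''))
        \<le> x i ^ 2 * (x i' ^ 2 * x i'' ^ 2 * ?c)" .
  qed
  also have "\<dots> \<le> (\<Sum>i<m. x i ^ 2) * (\<Sum>i'<m. \<Sum>i''<m. x i' ^ 2 * x i'' ^ 2 * ?c)"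
    using assms y_nonneg s_pos by (intro sum_distinct3_le) auto
  also have "\<dots> = x2 * (x2 * x2 * ?c)"
    unfolding sum_distrib_right[symmetric] sum_product[symmetric] x2_def ..
  also have "\<dots> = x2 ^ 2 / s ^ 4 * (y j ^ 2 * (y k * y l)) * (x2 / s ^ 2 * (y k * y l))"
    by (simp add: eval_nat_numeral mult_ac)
  finally show ?thesis .
qed

lemma cherry_le_links:
  "of_bool (adj j k \<omega> \<and> adj j l \<omega>)
    \<le> (\<Sum>i<m. links (star_links j k l i) \<omega>)
      + (\<Sum>(i, i')\<in>distinct2 {..<m}. links (cherry_links j k l i i') \<omega>)"
proof (cases "adj j k \<omega> \<and> adj j l \<omega>")
  case True
  then obtain i i' where i: "i < m" "i' < m" "H i j \<omega>" "H i k \<omega>" "H i' j \<omega>" "H i' l \<omega>"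
    by (auto simp: adj_def)
  show ?thesis
  proof (cases "i = i'")
    case True
    have "1 \<le> links (star_links j k l i) \<omega>" using i True by (simp add: links_def)
    also have "\<dots> \<le> (\<Sum>i<m. links (star_links j k l i) \<omega>)"
      using i by (intro member_le_sum) (auto simp: links_def)
    finally have "1 \<le> (\<Sum>i<m. links (star_links j k l i) \<omega>)" .
    moreover have "0 \<le> (\<Sum>(i, i')\<in>distinct2 {..<m}. links (cherry_links j k l i i') \<omega>)"
      by (intro sum_nonneg) (auto simp: links_def)
    moreover have "of_bool b \<le> (1 :: real)" for b by simp
    ultimately show ?thesis by (meson add_increasing add_increasing2 order_trans)
  next
    case False
    have "1 \<le> (case (i, i') of (i, i') \<Rightarrow> links (cherry_links j k l i i') \<omega>)"
      using i by (simp add: links_def)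
    also have "\<dots> \<le> (\<Sum>(i, i')\<in>distinct2 {..<m}. links (cherry_links j k l i i') \<omega>)"
      using i False by (intro member_le_sum) (auto simp: links_def)
    finally have "1 \<le> (\<Sum>(i, i')\<in>distinct2 {..<m}. links (cherry_links j k l i i') \<omega>)" .
    moreover have "0 \<le> (\<Sum>i<m. links (star_links j k l i) \<omega>)"
      by (intro sum_nonneg) (auto simp: links_def)
    moreover have "of_bool b \<le> (1 :: real)" for b by simp
    ultimately show ?thesis by (meson add_increasing add_increasing2 order_trans)
  qed
next
  case False
  have "0 \<le> (\<Sum>i<m. links (star_links j k l i) \<omega>)"
    "0 \<le> (\<Sum>(i, i')\<in>distinct2 {..<m}. links (cherry_links j k l i i') \<omega>)"
    by (auto intro!: sum_nonneg simp: links_def)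
  then show ?thesis using False by auto
qed

text \<open>If two of the three edges come from the same attribute, that attribute covers the whole triangle.\<close>

lemma triangle_le_links:
  "of_bool (adj j k \<omega> \<and> adj j l \<omega> \<and> adj k l \<omega>)
    \<le> (\<Sum>i<m. links (star_links j k l i) \<omega>)
      + (\<Sum>(i, i', i'')\<in>distinct3 {..<m}. links (cycle_links j k l i i' i'') \<omega>)"
proof (cases "adj j k \<omega> \<and> adj j l \<omega> \<and> adj k l \<omega>")
  case True
  then obtain i i' i'' where i: "i < m" "i' < m" "i'' < m" "H i j \<omega>" "H i k \<omega>" "H i' j \<omega>" "H i' l \<omega>"
     "H i'' k \<omega>" "H i'' l \<omega>"
    by (auto simp: adj_def)
  show ?thesis
  proof (cases "(i, i', i'') \<in> distinct3 {..<m}")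
    case False
    then have "\<exists>i<m. H i j \<omega> \<and> H i k \<omega> \<and> H i l \<omega>" using i by auto
    then obtain a where a: "a < m" "H a j \<omega>" "H a k \<omega>" "H a l \<omega>" by auto
    have "1 \<le> links (star_links j k l a) \<omega>" using a by (simp add: links_def)
    also have "\<dots> \<le> (\<Sum>i<m. links (star_links j k l i) \<omega>)"
      using a by (intro member_le_sum) (auto simp: links_def)
    finally have "1 \<le> (\<Sum>i<m. links (star_links j k l i) \<omega>)" .
    moreover have "0 \<le> (\<Sum>(i, i', i'')\<in>distinct3 {..<m}. links (cycle_links j k l i i' i'') \<omega>)"
      by (intro sum_nonneg) (auto simp: links_def)
    moreover have "of_bool b \<le> (1 :: real)" for b by simp
    ultimately show ?thesis by (meson add_increasing add_increasing2 order_trans)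
  next
    case True
    have "1 \<le> (case (i, i', i'') of (i, i', i'') \<Rightarrow> links (cycle_links j k l i i' i'') \<omega>)"
      using i by (simp add: links_def)
    also have "\<dots> \<le> (\<Sum>(i, i', i'')\<in>distinct3 {..<m}. links (cycle_links j k l i i' i'') \<omega>)"
      using i True by (intro member_le_sum) (auto simp: links_def)
    finally have "1 \<le> (\<Sum>(i, i', i'')\<in>distinct3 {..<m}. links (cycle_links j k l i i' i'') \<omega>)" .
    moreover have "0 \<le> (\<Sum>i<m. links (star_links j k l i) \<omega>)"
      by (intro sum_nonneg) (auto simp: links_def)
    moreover have "of_bool b \<le> (1 :: real)" for b by simp
    ultimately show ?thesis by (meson add_increasing add_increasing2 order_trans)
  qed
next
  case False
  have "0 \<le> (\<Sum>i<m. links (star_links j k l i) \<omega>)"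
    "0 \<le> (\<Sum>(i, i', i'')\<in>distinct3 {..<m}. links (cycle_links j k l i i' i'') \<omega>)"
    by (auto intro!: sum_nonneg simp: links_def)
  then show ?thesis using False by auto
qed

lemma expectation_cherry_le:
  assumes "(j, k, l) \<in> distinct3 {..<n}"
  shows "expectation (\<lambda>\<omega>. of_bool (adj j k \<omega> \<and> adj j l \<omega>))
    \<le> x3 / s ^ 3 * (y j * (y k * y l)) + x2 ^ 2 / s ^ 4 * (y j ^ 2 * (y k * y l))"
proof -
  have "expectation (\<lambda>\<omega>. of_bool (adj j k \<omega> \<and> adj j l \<omega>))
    \<le> expectation (\<lambda>\<omega>. (\<Sum>i<m. links (star_links j k l i) \<omega>)
      + (\<Sum>(i, i')\<in>distinct2 {..<m}. links (cherry_links j k l i i') \<omega>))"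
    unfolding case_prod_beta
    by (intro integral_mono integrable_of_bool Bochner_Integration.integrable_add
        Bochner_Integration.integrable_sum) (auto simp: cherry_le_links[unfolded case_prod_beta])
  also have "\<dots> = (\<Sum>i<m. expectation (links (star_links j k l i)))
      + (\<Sum>(i, i')\<in>distinct2 {..<m}. expectation (links (cherry_links j k l i i')))"
    unfolding case_prod_beta
    by (subst Bochner_Integration.integral_add) (auto simp: Bochner_Integration.integral_sum)
  finally show ?thesis using expectation_stars_le[OF assms] expectation_cherries_le[OF assms]
    by (simp add: mult.assoc)
qed

text \<open>A triangle contains a path of length 2, so the smaller of the two bounds applies. The
  cap is essential: without it, summing over \<open>k\<close> and \<open>l\<close> would produce
  \<open>y2 ^ 2\<close>, which is not under control when the second moment of the vertex weights is
  infinite.\<close>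

lemma expectation_triangle_le:
  assumes "(j, k, l) \<in> distinct3 {..<n}"
  shows "expectation (\<lambda>\<omega>. of_bool (adj j k \<omega> \<and> adj j l \<omega> \<and> adj k l \<omega>))
    \<le> x3 / s ^ 3 * (y j * (y k * y l))
      + x2 ^ 2 / s ^ 4 * (y j ^ 2 * (y k * y l * min 1 (x2 / s ^ 2 * (y k * y l))))"
proof -
  have "expectation (\<lambda>\<omega>. of_bool (adj j k \<omega> \<and> adj j l \<omega> \<and> adj k l \<omega>))
    \<le> expectation (\<lambda>\<omega>. (\<Sum>i<m. links (star_links j k l i) \<omega>)
      + (\<Sum>(i, i', i'')\<in>distinct3 {..<m}. links (cycle_links j k l i i' i'') \<omega>))"
    unfolding case_prod_beta
    by (intro integral_mono integrable_of_bool Bochner_Integration.integrable_add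
        Bochner_Integration.integrable_sum) (auto simp: triangle_le_links[unfolded case_prod_beta])
  also have "\<dots> = (\<Sum>i<m. expectation (links (star_links j k l i)))
      + (\<Sum>(i, i', i'')\<in>distinct3 {..<m}. expectation (links (cycle_links j k l i i' i'')))"
    unfolding case_prod_beta
    by (subst Bochner_Integration.integral_add) (auto simp: Bochner_Integration.integral_sum)
  finally have "expectation (\<lambda>\<omega>. of_bool (adj j k \<omega> \<and> adj j l \<omega> \<and> adj k l \<omega>))
    \<le> x3 / s ^ 3 * (y j * (y k * y l))
      + x2 ^ 2 / s ^ 4 * (y j ^ 2 * (y k * y l)) * (x2 / s ^ 2 * (y k * y l))"
    using expectation_stars_le[OF assms] expectation_cycles_le[OF assms]
    by (simp add: mult.assoc)
  moreover have "expectation (\<lambda>\<omega>. of_bool (adj j k \<omega> \<and> adj j l \<omega> \<and> adj k l \<omega>))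
    \<le> expectation (\<lambda>\<omega>. of_bool (adj j k \<omega> \<and> adj j l \<omega>) :: real)"
    by (rule integral_mono[OF integrable_of_bool integrable_of_bool]) (auto simp: of_bool_def)
  ultimately show ?thesis using expectation_cherry_le[OF assms]
    by (auto simp: min_def mult.assoc)
qed

lemma expectation_cherries_total:
  "expectation cherries \<le> x3 * (y1 / s) ^ 3 + y2 * (x2 * y1 / s ^ 2) ^ 2"
proof -
  have "expectation cherries
      = (\<Sum>(j, k, l)\<in>distinct3 {..<n}. expectation (\<lambda>\<omega>. of_bool (adj j k \<omega> \<and> adj j l \<omega>)))"
    unfolding cherries_def case_prod_beta
    by (intro Bochner_Integration.integral_sum integrable_of_bool) measurable
  also have "\<dots> \<le> (\<Sum>(j, k, l)\<in>distinct3 {..<n}. x3 / s ^ 3 * (y j * (y k * y l))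
        + x2 ^ 2 / s ^ 4 * (y j ^ 2 * (y k * y l)))"
    using expectation_cherry_le by (intro sum_mono) auto
  also have "\<dots> = x3 / s ^ 3 * (\<Sum>(j, k, l)\<in>distinct3 {..<n}. y j * (y k * y l))
        + x2 ^ 2 / s ^ 4 * (\<Sum>(j, k, l)\<in>distinct3 {..<n}. y j ^ 2 * (y k * y l))"
    by (simp add: case_prod_beta sum.distrib sum_distrib_left)
  also have "\<dots> \<le> x3 / s ^ 3 * (y1 * (\<Sum>k<n. \<Sum>l<n. y k * y l))
        + x2 ^ 2 / s ^ 4 * (y2 * (\<Sum>k<n. \<Sum>l<n. y k * y l))"
    unfolding y1_def y2_def using y_nonneg moments_nonneg s_pos
    by (intro add_mono mult_left_mono sum_distinct3_le) auto
  also have "(\<Sum>k<n. \<Sum>l<n. y k * y l) = y1 * y1" by (simp add: y1_def sum_product)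
  finally show ?thesis by (simp add: eval_nat_numeral ac_simps)
qed

lemma expectation_triangles_total:
  "expectation triangles \<le> x3 * (y1 / s) ^ 3
    + y2 * (x2 / s ^ 2) ^ 2 * (\<Sum>k<n. \<Sum>l<n. y k * y l * min 1 (x2 / s ^ 2 * (y k * y l)))"
proof -
  let ?g = "\<lambda>k l. y k * y l * min 1 (x2 / s ^ 2 * (y k * y l))"
  have "expectation triangles = (\<Sum>(j, k, l)\<in>distinct3 {..<n}.
      expectation (\<lambda>\<omega>. of_bool (adj j k \<omega> \<and> adj j l \<omega> \<and> adj k l \<omega>)))"
    unfolding triangles_def case_prod_beta
    by (intro Bochner_Integration.integral_sum integrable_of_bool) measurable
  also have "\<dots> \<le> (\<Sum>(j, k, l)\<in>distinct3 {..<n}. x3 / s ^ 3 * (y j * (y k * y l))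
        + x2 ^ 2 / s ^ 4 * (y j ^ 2 * ?g k l))"
    using expectation_triangle_le by (intro sum_mono) auto
  also have "\<dots> = x3 / s ^ 3 * (\<Sum>(j, k, l)\<in>distinct3 {..<n}. y j * (y k * y l))
        + x2 ^ 2 / s ^ 4 * (\<Sum>(j, k, l)\<in>distinct3 {..<n}. y j ^ 2 * ?g k l)"
    by (simp add: case_prod_beta sum.distrib sum_distrib_left)
  also have "\<dots> \<le> x3 / s ^ 3 * (y1 * (\<Sum>k<n. \<Sum>l<n. y k * y l))
        + x2 ^ 2 / s ^ 4 * (y2 * (\<Sum>k<n. \<Sum>l<n. ?g k l))"
    unfolding y1_def y2_def using y_nonneg moments_nonneg s_pos
    by (intro add_mono mult_left_mono sum_distinct3_le) auto
  also have "(\<Sum>k<n. \<Sum>l<n. y k * y l) = y1 * y1" by (simp add: y1_def sum_product)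
  finally show ?thesis by (simp add: eval_nat_numeral ac_simps)
qed

end

section \<open>Lower bounds from light and heavy weights\<close>

context random_bipartite begin

lemma links_Un: "links (S \<union> T) \<omega> = links S \<omega> * links T \<omega>"
  by (auto simp: links_def)

lemma expectation_square_sum_links:
  assumes "finite T" "\<And>t. t \<in> T \<Longrightarrow> finite (S t)"
  shows "integrable M (\<lambda>\<omega>. ((\<Sum>t\<in>T. links (S t) \<omega>) - c)\<^sup>2)"
    and "expectation (\<lambda>\<omega>. ((\<Sum>t\<in>T. links (S t) \<omega>) - c)\<^sup>2)
      = (\<Sum>t\<in>T. \<Sum>t'\<in>T. expectation (links (S t \<union> S t')))
        - 2 * c * (\<Sum>t\<in>T. expectation (links (S t))) + c\<^sup>2"
proof -
  have eq: "((\<Sum>t\<in>T. links (S t) \<omega>) - c)\<^sup>2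
      = (\<Sum>t\<in>T. \<Sum>t'\<in>T. links (S t \<union> S t') \<omega>) - 2 * c * (\<Sum>t\<in>T. links (S t) \<omega>) + c\<^sup>2" for \<omega>
    by (simp add: links_Un sum_product[symmetric] power2_eq_square algebra_simps)
  have i1: "integrable M (\<lambda>\<omega>. \<Sum>t\<in>T. \<Sum>t'\<in>T. links (S t \<union> S t') \<omega>)"
    and i2: "integrable M (\<lambda>\<omega>. 2 * c * (\<Sum>t\<in>T. links (S t) \<omega>))"
    using assms by (intro Bochner_Integration.integrable_sum integrable_mult_right; auto)+
  show "integrable M (\<lambda>\<omega>. ((\<Sum>t\<in>T. links (S t) \<omega>) - c)\<^sup>2)"
    unfolding eq using i1 i2 by simp
  show "expectation (\<lambda>\<omega>. ((\<Sum>t\<in>T. links (S t) \<omega>) - c)\<^sup>2)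
      = (\<Sum>t\<in>T. \<Sum>t'\<in>T. expectation (links (S t \<union> S t')))
        - 2 * c * (\<Sum>t\<in>T. expectation (links (S t))) + c\<^sup>2"
    unfolding eq using i1 i2 assms by (simp add: prob_space)
qed

text \<open>The arithmetic-geometric mean inequality in the form |t| \<le> \<eta> c + t^2 / (\<eta>
  c). If the mean square deviation is at most \<open>c * v\<close>, the error is a small multiple of
  \<open>c\<close> plus the constant \<open>v / \<eta>\<close>, which is absorbed once
  \<open>c\<close> is large.\<close>

lemma expectation_abs_le:
  fixes c v \<eta> :: real
  assumes "integrable M (\<lambda>\<omega>. (Z \<omega> - c)\<^sup>2)" "integrable M Z"
    "expectation (\<lambda>\<omega>. (Z \<omega> - c)\<^sup>2) \<le> c * v" "0 < c" "0 < \<eta>"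
  shows "expectation (\<lambda>\<omega>. \<bar>Z \<omega> - c\<bar>) \<le> \<eta> * c + v / \<eta>"
proof -
  have pt: "\<bar>t\<bar> \<le> \<eta> * c + t\<^sup>2 / (\<eta> * c)" for t
  proof -
    have ec: "0 < \<eta> * c" using assms by simp
    have "\<bar>t\<bar> * (\<eta> * c) \<le> (\<eta> * c)\<^sup>2 + t\<^sup>2"
    proof -
      have "0 \<le> \<bar>t\<bar> * (\<eta> * c)" using ec by simp
      moreover have "2 * (\<bar>t\<bar> * (\<eta> * c)) \<le> t\<^sup>2 + (\<eta> * c)\<^sup>2"
        using sum_squares_bound[of "\<bar>t\<bar>" "\<eta> * c"] by (simp add: mult.assoc)
      ultimately show ?thesis by linarith
    qed
    then have "\<bar>t\<bar> \<le> ((\<eta> * c)\<^sup>2 + t\<^sup>2) / (\<eta> * c)"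
      using ec by (simp add: pos_le_divide_eq)
    also have "\<dots> = \<eta> * c + t\<^sup>2 / (\<eta> * c)"
      using ec by (simp add: add_divide_distrib power2_eq_square)
    finally show ?thesis .
  qed
  have "expectation (\<lambda>\<omega>. \<bar>Z \<omega> - c\<bar>) \<le> expectation (\<lambda>\<omega>. \<eta> * c + (Z \<omega> - c)\<^sup>2 / (\<eta> * c))"
    using assms pt by (intro integral_mono) auto
  also have "\<dots> = \<eta> * c + expectation (\<lambda>\<omega>. (Z \<omega> - c)\<^sup>2) / (\<eta> * c)"
    using assms by (simp add: prob_space)
  also have "\<dots> \<le> \<eta> * c + c * v / (\<eta> * c)"
    using assms by (intro add_mono divide_right_mono) auto
  also have "\<dots> = \<eta> * c + v / \<eta>" using assms by simp
  finally show ?thesis .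
qed

end

text \<open>\<open>p_eq\<close> states that the cap is inactive when one end has weight at most
  \<open>K\<close>. Weights in the gap between \<open>K\<close> and \<open>L\<close> belong neither
  to the light nor to the heavy class and are simply given up in the lower bounds.\<close>

locale truncated_bipartite = weighted_bipartite M H p x y s m n
  for M :: "'w measure" and H p x y s m n +
  fixes K L :: real
  assumes K_nonneg: "0 \<le> K" and K_le_L: "K \<le> L"
    and p_eq: "\<And>i j. i < m \<Longrightarrow> j < n \<Longrightarrow> x i \<le> K \<or> y j \<le> K \<Longrightarrow> p i j = x i * y j / s"
begin

definition light_vertices :: "nat set" where "light_vertices = {j. j < n \<and> y j \<le> K}"
definition heavy_vertices :: "nat set" where "heavy_vertices = {j. j < n \<and> L < y j}"
definition light_attrs :: "nat set" where "light_attrs = {i. i < m \<and> x i \<le> K}"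
definition heavy_attrs :: "nat set" where "heavy_attrs = {i. i < m \<and> L < x i}"

definition y1K :: real where "y1K = (\<Sum>k\<in>light_vertices. y k)"
definition x2K :: real where "x2K = (\<Sum>i\<in>light_attrs. x i ^ 2)"

text \<open>\<open>\<mu> i\<close> is the mean of the number \<open>deg i\<close> of light
  neighbours of an attribute, and \<open>\<nu> j\<close> is, for a heavy vertex \<open>j\<close>,
  the mean of the number \<open>walks j\<close> of walks to a light vertex through a light
  attribute.\<close>

definition \<mu> :: "nat \<Rightarrow> real" where "\<mu> i = x i * (y1K / s)"
definition \<nu> :: "nat \<Rightarrow> real" where "\<nu> j = y j * (x2K * y1K / s ^ 2)"

lemma finite_classes [simp]:
  "finite light_vertices" "finite heavy_vertices" "finite light_attrs" "finite heavy_attrs"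
  by (auto simp: light_vertices_def heavy_vertices_def light_attrs_def heavy_attrs_def)

lemma light_vertexD: "k \<in> light_vertices \<Longrightarrow> k < n \<and> y k \<le> K \<and> 0 \<le> y k"
  using y_nonneg by (auto simp: light_vertices_def)

lemma heavy_vertexD: "k \<in> heavy_vertices \<Longrightarrow> k < n \<and> L < y k \<and> 0 \<le> y k \<and> k \<notin> light_vertices"
  using y_nonneg K_le_L by (auto simp: heavy_vertices_def light_vertices_def)

lemma light_attrD: "i \<in> light_attrs \<Longrightarrow> i < m \<and> x i \<le> K \<and> 0 \<le> x i"
  using x_nonneg by (auto simp: light_attrs_def)

lemma heavy_attrD: "i \<in> heavy_attrs \<Longrightarrow> i < m \<and> L < x i \<and> 0 \<le> x i"
  using x_nonneg by (auto simp: heavy_attrs_def)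

lemma truncated_nonneg: "0 \<le> y1K" "0 \<le> x2K"
  unfolding y1K_def x2K_def using light_vertexD by (simp_all add: sum_nonneg)

lemma y1K_le: "y1K \<le> y1"
  unfolding y1K_def y1_def using y_nonneg by (intro sum_mono2) (auto simp: light_vertices_def)

lemma x2K_le: "x2K \<le> x2"
  unfolding x2K_def x2_def using x_nonneg by (intro sum_mono2) (auto simp: light_attrs_def)

lemma sum_y_sq_le: "(\<Sum>k\<in>light_vertices. y k ^ 2) \<le> K * y1K"
  unfolding y1K_def sum_distrib_left power2_eq_square
  using light_vertexD by (intro sum_mono mult_right_mono) auto

lemma sum_x_cube_le: "(\<Sum>i\<in>light_attrs. x i ^ 3) \<le> K * x2K"
  unfolding x2K_def sum_distrib_left
proof (rule sum_mono)
  fix i assume "i \<in> light_attrs"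
  then have "x i * x i ^ 2 \<le> K * x i ^ 2" using light_attrD by (intro mult_right_mono) auto
  then show "x i ^ 3 \<le> K * x i ^ 2" by (simp add: power3_eq_cube power2_eq_square)
qed

section \<open>Triples of light vertices below one heavy attribute\<close>

definition deg :: "nat \<Rightarrow> 'w \<Rightarrow> real" where
  "deg i \<omega> = (\<Sum>k\<in>light_vertices. links {(i, k)} \<omega>)"

lemma integrable_deg: "integrable M (deg i)"
  unfolding deg_def by (intro Bochner_Integration.integrable_sum) auto

text \<open>For independent links the variance is at most the mean: two different light vertices
  contribute a product, and the diagonal \<open>k = k'\<close> collapses to a single link and adds
  \<open>\<mu> i\<close>. Hence \<open>expectation_abs_le\<close> applies with
  \<open>v = 1\<close>.\<close>

lemma expectation_abs_deg:
  assumes "i < m" "0 < \<mu> i" "0 < \<eta>"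
  shows "expectation (\<lambda>\<omega>. \<bar>deg i \<omega> - \<mu> i\<bar>) \<le> \<eta> * \<mu> i + 1 / \<eta>"
proof (rule expectation_abs_le)
  have p: "p i k = x i * y k / s" if "k \<in> light_vertices" for k
    using p_eq light_vertexD that assms by auto
  have mu: "(\<Sum>k\<in>light_vertices. x i * y k / s) = \<mu> i"
    by (simp add: \<mu>_def y1K_def sum_distrib_left sum_divide_distrib)
  have E1: "(\<Sum>k\<in>light_vertices. expectation (links {(i, k)})) = \<mu> i"
    unfolding mu[symmetric] using p by (intro sum.cong) (auto simp: expectation_links)
  have "(\<Sum>k\<in>light_vertices. \<Sum>k'\<in>light_vertices. expectation (links ({(i, k)} \<union> {(i, k')})))
    \<le> (\<Sum>k\<in>light_vertices. \<Sum>k'\<in>light_vertices. (x i * y k / s) * (x i * y k' / s)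
        + (if k = k' then x i * y k / s else 0))"
    using assms light_vertexD s_pos x_nonneg
    by (intro sum_mono) (subst expectation_links, auto simp: p mult_ac intro!: divide_nonneg_pos)
  also have "\<dots> = \<mu> i ^ 2 + \<mu> i"
    by (simp add: sum.distrib mu power2_eq_square sum_product[symmetric] del: times_divide_eq_left times_divide_eq_right times_divide_times_eq)
  finally have E2: "(\<Sum>k\<in>light_vertices. \<Sum>k'\<in>light_vertices.
      expectation (links ({(i, k)} \<union> {(i, k')}))) \<le> \<mu> i ^ 2 + \<mu> i" .
  show "integrable M (\<lambda>\<omega>. (deg i \<omega> - \<mu> i)\<^sup>2)"
    unfolding deg_def by (rule expectation_square_sum_links) auto
  show "expectation (\<lambda>\<omega>. (deg i \<omega> - \<mu> i)\<^sup>2) \<le> \<mu> i * 1"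
    unfolding deg_def using E2
    by (subst expectation_square_sum_links) (auto simp: E1 power2_eq_square)
qed (use assms integrable_deg in auto)

definition triples_of_attr :: "nat \<Rightarrow> 'w \<Rightarrow> real" where
  "triples_of_attr i \<omega> = (\<Sum>(j, k, l)\<in>distinct3 light_vertices. links (star_links j k l i) \<omega>)"

text \<open>The tangent line of the cube at \<open>\<mu>\<close> makes the loss linear in the deviation of the degree, so that
  a bound on the first absolute moment suffices.\<close>

lemma triples_of_attr_ge:
  assumes "1 \<le> \<mu> i"
  shows "\<mu> i ^ 3 - 3 * \<mu> i ^ 2 * (2 + \<bar>deg i \<omega> - \<mu> i\<bar>) \<le> triples_of_attr i \<omega>"
proof -
  define N where "N = card {k \<in> light_vertices. H i k \<omega>}"
  have N: "deg i \<omega> = real N"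
    by (simp add: deg_def links_def N_def sum_of_bool_eq Int_def)
  let ?d = "real N" and ?u = "\<mu> i"
  have "triples_of_attr i \<omega> = ?d * (?d - 1) * (?d - 2)"
    using sum_distinct3_idempotent[of light_vertices "\<lambda>k. links {(i, k)} \<omega>"]
    unfolding deg_def[symmetric] N triples_of_attr_def
    by (simp add: links_def of_bool_conj mult.assoc split_def)
  \<comment> \<open>The difference of the two sides is (d - 2)(3 d - 4), which is negative only for
    4/3 < d < 2; integrality of the degree excludes that range.\<close>
  moreover have "(?d - 2) ^ 3 \<le> ?d * (?d - 1) * (?d - 2)"
  proof -
    have "0 \<le> (?d - 2) * (3 * ?d - 4)"
      by (cases "N \<le> 1") (auto intro!: mult_nonneg_nonneg mult_nonpos_nonpos)
    then show ?thesis by (simp add: power3_eq_cube algebra_simps)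
  qed
  \<comment> \<open>With z = d - 2 the gap between the cube and its tangent at u is (z - u)^2 (z + 2
    u). Here z \<ge> -2 and u \<ge> 1 make the last factor nonnegative.\<close>
  moreover have "?u ^ 3 + 3 * ?u ^ 2 * (?d - 2 - ?u) \<le> (?d - 2) ^ 3"
  proof -
    have "0 \<le> (?d - 2 - ?u) ^ 2 * (?d - 2 + 2 * ?u)" using assms by (intro mult_nonneg_nonneg) auto
    then show ?thesis by (simp add: power3_eq_cube power2_eq_square algebra_simps)
  qed
  moreover have "3 * ?u ^ 2 * (- 2 - \<bar>?d - ?u\<bar>) \<le> 3 * ?u ^ 2 * (?d - 2 - ?u)"
    by (intro mult_left_mono) auto
  ultimately show ?thesis unfolding N by (simp add: algebra_simps)
qed

definition star_count :: "'w \<Rightarrow> real" where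
  "star_count \<omega> = (\<Sum>(j, k, l)\<in>distinct3 light_vertices.
    of_bool (\<exists>i\<in>heavy_attrs. H i j \<omega> \<and> H i k \<omega> \<and> H i l \<omega>))"

definition star_overlap :: "'w \<Rightarrow> real" where
  "star_overlap \<omega> = (\<Sum>(j, k, l)\<in>distinct3 light_vertices. \<Sum>(i, i')\<in>distinct2 heavy_attrs.
    links (star_links j k l i \<union> star_links j k l i') \<omega>)"

definition star_loss :: "'w \<Rightarrow> real" where
  "star_loss \<omega> = (\<Sum>i\<in>heavy_attrs. 3 * \<mu> i ^ 2 * (2 + \<bar>deg i \<omega> - \<mu> i\<bar>)) + star_overlap \<omega>"

text \<open>Summing \<open>triples_of_attr\<close> over heavy attributes counts a triple once for
  each attribute covering it. Bonferroni's inequality passes to triples counted once, at the price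
  of \<open>star_overlap\<close>.\<close>

lemma star_count_ge:
  assumes "\<And>i. i \<in> heavy_attrs \<Longrightarrow> 1 \<le> \<mu> i"
  shows "(\<Sum>i\<in>heavy_attrs. \<mu> i ^ 3) - star_loss \<omega> \<le> star_count \<omega>"
proof -
  have "(\<Sum>i\<in>heavy_attrs. \<mu> i ^ 3 - 3 * \<mu> i ^ 2 * (2 + \<bar>deg i \<omega> - \<mu> i\<bar>))
      \<le> (\<Sum>i\<in>heavy_attrs. triples_of_attr i \<omega>)"
    using assms triples_of_attr_ge by (intro sum_mono) auto
  also have "\<dots> = (\<Sum>(j, k, l)\<in>distinct3 light_vertices. \<Sum>i\<in>heavy_attrs. links (star_links j k l i) \<omega>)"
    unfolding triples_of_attr_def case_prod_beta by (rule sum.swap)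
  finally have 1: "(\<Sum>i\<in>heavy_attrs. \<mu> i ^ 3 - 3 * \<mu> i ^ 2 * (2 + \<bar>deg i \<omega> - \<mu> i\<bar>))
    \<le> (\<Sum>(j, k, l)\<in>distinct3 light_vertices. \<Sum>i\<in>heavy_attrs. links (star_links j k l i) \<omega>)" .
  have "(\<Sum>(j, k, l)\<in>distinct3 light_vertices. (\<Sum>i\<in>heavy_attrs. links (star_links j k l i) \<omega>)
      - (\<Sum>(i, i')\<in>distinct2 heavy_attrs. links (star_links j k l i \<union> star_links j k l i') \<omega>))
      \<le> star_count \<omega>"
    unfolding star_count_def
  proof (intro sum_mono, clarify)
    fix j k l
    show "(\<Sum>i\<in>heavy_attrs. links (star_links j k l i) \<omega>)
      - (\<Sum>(i, i')\<in>distinct2 heavy_attrs. links (star_links j k l i \<union> star_links j k l i') \<omega>)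
      \<le> of_bool (\<exists>i\<in>heavy_attrs. H i j \<omega> \<and> H i k \<omega> \<and> H i l \<omega>)"
      using of_bool_Bex_ge[of heavy_attrs "\<lambda>i. H i j \<omega> \<and> H i k \<omega> \<and> H i l \<omega>"]
      by (simp add: links_def conj_ac del: sum_of_bool_eq)
  qed
  then show ?thesis using 1
    by (simp add: star_loss_def star_overlap_def case_prod_beta sum_subtractf)
qed

lemma integrable_star_loss: "integrable M star_loss"
  unfolding star_loss_def star_overlap_def case_prod_beta
  by (intro Bochner_Integration.integrable_add Bochner_Integration.integrable_sum
      integrable_mult_right integrable_abs Bochner_Integration.integrable_diff integrable_deg) simp_all

lemma star_loss_nonneg: "0 \<le> star_loss \<omega>"
  unfolding star_loss_def star_overlap_def
  unfolding case_prod_beta by (intro add_nonneg_nonneg sum_nonneg) (simp_all add: links_def)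

text \<open>Two attributes above the same three vertices need six links. Squares of light weights
  are traded for \<open>K * y k\<close>, so that the result is of the shape of \<open>A\<close>
  times the small factor \<open>K ^ 3 * x3 / s ^ 3\<close>.\<close>

lemma expectation_star_overlap: "expectation star_overlap \<le> x3 ^ 2 * (K * y1K) ^ 3 / s ^ 6"
proof -
  have "expectation star_overlap = (\<Sum>(j, k, l)\<in>distinct3 light_vertices. \<Sum>(i, i')\<in>distinct2 heavy_attrs.
      expectation (links (star_links j k l i \<union> star_links j k l i')))"
    unfolding star_overlap_def case_prod_beta
    by (simp add: Bochner_Integration.integral_sum)
  also have "\<dots> \<le> (\<Sum>(j, k, l)\<in>distinct3 light_vertices. \<Sum>(i, i')\<in>distinct2 heavy_attrs.
      x i ^ 3 * x i' ^ 3 * (y j ^ 2 * (y k ^ 2 * y l ^ 2) / s ^ 6))"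
  proof (intro sum_mono, clarify, intro sum_mono, clarify)
    fix j k l i i' assume jkl: "(j, k, l) \<in> distinct3 light_vertices" and i: "(i, i') \<in> distinct2 heavy_attrs"
    have "expectation (links (star_links j k l i \<union> star_links j k l i'))
        \<le> (\<Prod>(i, j)\<in>star_links j k l i \<union> star_links j k l i'. x i * y j / s)"
      using jkl i light_vertexD heavy_attrD by (intro expectation_links_le) auto
    also have "\<dots> = x i ^ 3 * x i' ^ 3 * (y j ^ 2 * (y k ^ 2 * y l ^ 2) / s ^ 6)"
      using jkl i by (simp add: eval_nat_numeral mult_ac)
    finally show "expectation (links (star_links j k l i \<union> star_links j k l i'))
        \<le> x i ^ 3 * x i' ^ 3 * (y j ^ 2 * (y k ^ 2 * y l ^ 2) / s ^ 6)" .
  qed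
  also have "\<dots> = (\<Sum>(j, k, l)\<in>distinct3 light_vertices. y j ^ 2 * (y k ^ 2 * y l ^ 2))
      * ((\<Sum>(i, i')\<in>distinct2 heavy_attrs. x i ^ 3 * x i' ^ 3) / s ^ 6)"
  proof -
    have "(\<Sum>(i, i')\<in>distinct2 heavy_attrs. x i ^ 3 * x i' ^ 3 * (c / s ^ 6))
        = c * ((\<Sum>(i, i')\<in>distinct2 heavy_attrs. x i ^ 3 * x i' ^ 3) / s ^ 6)" for c
      unfolding case_prod_beta sum_distrib_right[symmetric] by simp
    then show ?thesis unfolding case_prod_beta sum_distrib_right by simp
  qed
  also have "\<dots> \<le> (K * y1K) ^ 3 * (x3 ^ 2 / s ^ 6)"
  proof (intro mult_mono divide_right_mono)
    have "(\<Sum>(j, k, l)\<in>distinct3 light_vertices. y j ^ 2 * (y k ^ 2 * y l ^ 2))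
      \<le> (\<Sum>j\<in>light_vertices. y j ^ 2) * (\<Sum>k\<in>light_vertices. \<Sum>l\<in>light_vertices. y k ^ 2 * y l ^ 2)"
      by (intro sum_distinct3_le) auto
    also have "\<dots> = (\<Sum>j\<in>light_vertices. y j ^ 2) ^ 3"
      by (simp add: sum_product[symmetric] power3_eq_cube)
    also have "\<dots> \<le> (K * y1K) ^ 3"
      by (intro power_mono sum_y_sq_le sum_nonneg) auto
    finally show "(\<Sum>(j, k, l)\<in>distinct3 light_vertices. y j ^ 2 * (y k ^ 2 * y l ^ 2)) \<le> (K * y1K) ^ 3" .
    have "(\<Sum>(i, i')\<in>distinct2 heavy_attrs. x i ^ 3 * x i' ^ 3)
        \<le> (\<Sum>i\<in>heavy_attrs. x i ^ 3) * (\<Sum>i\<in>heavy_attrs. x i ^ 3)"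
      using heavy_attrD by (intro sum_distinct2_le) auto
    also have "\<dots> = (\<Sum>i\<in>heavy_attrs. x i ^ 3) ^ 2" by (simp add: power2_eq_square)
    also have "\<dots> \<le> x3 ^ 2"
      unfolding x3_def using x_nonneg
      by (intro power_mono sum_mono2 sum_nonneg) (auto simp: heavy_attrs_def)
    finally show "(\<Sum>(i, i')\<in>distinct2 heavy_attrs. x i ^ 3 * x i' ^ 3) \<le> x3 ^ 2" .
    have "0 \<le> (\<Sum>(i, i')\<in>distinct2 heavy_attrs. x i ^ 3 * x i' ^ 3)"
      using heavy_attrD by (intro sum_nonneg) auto
    then show "0 \<le> (\<Sum>(i, i')\<in>distinct2 heavy_attrs. x i ^ 3 * x i' ^ 3) / s ^ 6"
      using s_pos by simp
  qed (use truncated_nonneg K_nonneg s_pos in simp_all)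
  finally show ?thesis by (simp add: mult_ac)
qed

lemma expectation_star_loss:
  assumes "0 < \<eta>" and "\<And>i. i \<in> heavy_attrs \<Longrightarrow> 0 < \<mu> i"
  shows "expectation star_loss \<le> (\<Sum>i\<in>heavy_attrs. 3 * \<mu> i ^ 2 * (2 + (\<eta> * \<mu> i + 1 / \<eta>)))
    + x3 ^ 2 * (K * y1K) ^ 3 / s ^ 6"
proof -
  have int: "integrable M (\<lambda>\<omega>. 3 * \<mu> i ^ 2 * (2 + \<bar>deg i \<omega> - \<mu> i\<bar>))" for i
    using integrable_deg by (intro integrable_mult_right Bochner_Integration.integrable_add
      integrable_abs Bochner_Integration.integrable_diff) auto
  have int2: "integrable M star_overlap"
    unfolding star_overlap_def case_prod_beta by (intro Bochner_Integration.integrable_sum) auto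
  have "expectation star_loss
      = (\<Sum>i\<in>heavy_attrs. expectation (\<lambda>\<omega>. 3 * \<mu> i ^ 2 * (2 + \<bar>deg i \<omega> - \<mu> i\<bar>))) + expectation star_overlap"
    unfolding star_loss_def using int int2
    by (simp add: Bochner_Integration.integral_sum Bochner_Integration.integral_add)
  moreover have "(\<Sum>i\<in>heavy_attrs. expectation (\<lambda>\<omega>. 3 * \<mu> i ^ 2 * (2 + \<bar>deg i \<omega> - \<mu> i\<bar>)))
    \<le> (\<Sum>i\<in>heavy_attrs. 3 * \<mu> i ^ 2 * (2 + (\<eta> * \<mu> i + 1 / \<eta>)))"
  proof (rule sum_mono)
    fix i assume i: "i \<in> heavy_attrs"
    have "expectation (\<lambda>\<omega>. 3 * \<mu> i ^ 2 * (2 + \<bar>deg i \<omega> - \<mu> i\<bar>))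
        = 3 * \<mu> i ^ 2 * (2 + expectation (\<lambda>\<omega>. \<bar>deg i \<omega> - \<mu> i\<bar>))"
      using integrable_deg by (simp add: prob_space)
    also have "\<dots> \<le> 3 * \<mu> i ^ 2 * (2 + (\<eta> * \<mu> i + 1 / \<eta>))"
      using expectation_abs_deg[of i \<eta>] assms heavy_attrD i by (intro mult_left_mono add_left_mono) auto
    finally show "expectation (\<lambda>\<omega>. 3 * \<mu> i ^ 2 * (2 + \<bar>deg i \<omega> - \<mu> i\<bar>))
      \<le> 3 * \<mu> i ^ 2 * (2 + (\<eta> * \<mu> i + 1 / \<eta>))" .
  qed
  ultimately show ?thesis using expectation_star_overlap by linarith
qed

lemma triangles_ge: "star_count \<omega> \<le> triangles \<omega>"
proof -
  have "star_count \<omega> \<le> (\<Sum>(j, k, l)\<in>distinct3 light_vertices.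
      of_bool (adj j k \<omega> \<and> adj j l \<omega> \<and> adj k l \<omega>))"
    unfolding star_count_def
    using heavy_attrD by (intro sum_mono) (force simp: adj_def of_bool_def)
  also have "\<dots> \<le> triangles \<omega>"
    unfolding triangles_def by (intro sum_mono2) (auto dest: light_vertexD)
  finally show ?thesis .
qed

end

section \<open>Paths of length 2 centred at a heavy vertex\<close>

context truncated_bipartite begin

definition neighbours :: "nat \<Rightarrow> 'w \<Rightarrow> real" where
  "neighbours j \<omega> = (\<Sum>k\<in>light_vertices. of_bool (\<exists>i\<in>light_attrs. H i j \<omega> \<and> H i k \<omega>))"

definition walks :: "nat \<Rightarrow> 'w \<Rightarrow> real" where
  "walks j \<omega> = (\<Sum>(i, k)\<in>light_attrs \<times> light_vertices. links {(i, j), (i, k)} \<omega>)"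

definition walk_overlap :: "nat \<Rightarrow> 'w \<Rightarrow> real" where
  "walk_overlap j \<omega> = (\<Sum>k\<in>light_vertices. \<Sum>(i, i')\<in>distinct2 light_attrs.
    links {(i, j), (i, k), (i', j), (i', k)} \<omega>)"

lemma integrable_walks: "integrable M (walks j)" "integrable M (walk_overlap j)"
  unfolding walks_def walk_overlap_def case_prod_beta
  by (intro Bochner_Integration.integrable_sum; simp)+

lemma walk_overlap_nonneg: "0 \<le> walk_overlap j \<omega>"
  unfolding walk_overlap_def case_prod_beta by (intro sum_nonneg) (simp add: links_def)

text \<open>Walks count a light vertex once per connecting attribute, neighbours count it once;
  Bonferroni's inequality bounds the difference by pairs of connecting attributes.\<close>

lemma neighbours_ge: "walks j \<omega> - walk_overlap j \<omega> \<le> neighbours j \<omega>"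
proof -
  have "walks j \<omega> = (\<Sum>k\<in>light_vertices. \<Sum>i\<in>light_attrs. links {(i, j), (i, k)} \<omega>)"
    unfolding walks_def by (subst sum.swap) (simp add: sum.cartesian_product)
  then have "walks j \<omega> - walk_overlap j \<omega>
    = (\<Sum>k\<in>light_vertices. (\<Sum>i\<in>light_attrs. links {(i, j), (i, k)} \<omega>)
       - (\<Sum>(i, i')\<in>distinct2 light_attrs. links {(i, j), (i, k), (i', j), (i', k)} \<omega>))"
    by (simp add: walk_overlap_def sum_subtractf)
  also have "\<dots> \<le> neighbours j \<omega>"
    unfolding neighbours_def
  proof (rule sum_mono)
    fix k
    show "(\<Sum>i\<in>light_attrs. links {(i, j), (i, k)} \<omega>)
       - (\<Sum>(i, i')\<in>distinct2 light_attrs. links {(i, j), (i, k), (i', j), (i', k)} \<omega>)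
      \<le> of_bool (\<exists>i\<in>light_attrs. H i j \<omega> \<and> H i k \<omega>)"
      using of_bool_Bex_ge[of light_attrs "\<lambda>i. H i j \<omega> \<and> H i k \<omega>"]
      by (simp add: links_def conj_ac del: sum_of_bool_eq)
  qed
  finally show ?thesis .
qed

text \<open>The analogue of the tangent argument for triples: the square is bounded below by a
  linear function of the deviation, so first moments of
  \<open>\<bar>walks j \<omega> - \<nu> j\<bar>\<close> and of \<open>walk_overlap j\<close> are
  enough.\<close>

lemma neighbours_choose_ge:
  assumes "0 \<le> \<nu> j"
  shows "\<nu> j ^ 2 - (1 + 2 * \<nu> j * (1 + \<bar>walks j \<omega> - \<nu> j\<bar> + walk_overlap j \<omega>))
    \<le> neighbours j \<omega> * (neighbours j \<omega> - 1)"
proof -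
  let ?D = "neighbours j \<omega>" and ?v = "\<nu> j"
  have "?v - ?D \<le> \<bar>walks j \<omega> - ?v\<bar> + walk_overlap j \<omega>"
    using neighbours_ge[of j \<omega>] by linarith
  then have "2 * ?v * (1 + (?v - ?D)) \<le> 2 * ?v * (1 + (\<bar>walks j \<omega> - ?v\<bar> + walk_overlap j \<omega>))"
    using assms by (intro mult_left_mono) auto
  moreover have "?v ^ 2 - 1 - 2 * ?v * (1 + (?v - ?D)) \<le> ?D * (?D - 1)"
  proof -
    have "0 \<le> (?D - 1 - ?v)\<^sup>2" by simp
    moreover have "0 \<le> ?D" by (simp add: neighbours_def)
    ultimately show ?thesis by (simp add: power2_eq_square algebra_simps)
  qed
  ultimately show ?thesis by (simp add: add.assoc)
qed

text \<open>Walks through different attributes share no link. Two walks through the same attribute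
  share the link to \<open>j\<close> and bring in \<open>x i ^ 3\<close>; this is why the attributes
  are taken light, since then \<open>x i ^ 3 \<le> K * x i ^ 2\<close> keeps the variance
  proportional to \<open>\<nu> j\<close>.\<close>

lemma expectation_abs_walks:
  assumes "j \<in> heavy_vertices" "0 < \<nu> j" "0 < \<eta>"
  shows "expectation (\<lambda>\<omega>. \<bar>walks j \<omega> - \<nu> j\<bar>) \<le> \<eta> * \<nu> j + (1 + K * (y1K / s)) / \<eta>"
proof (rule expectation_abs_le)
  have j: "j < n" "j \<notin> light_vertices" "0 \<le> y j" using assms heavy_vertexD by auto
  define q where "q i k = x i * y k / s" for i k
  have p: "p i k = q i k" if "i \<in> light_attrs" "k < n" for i k
    using p_eq light_attrD that unfolding q_def by auto
  have q0: "0 \<le> q i k" if "i \<in> light_attrs" "k < n" for i k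
    using p[OF that] p_bounds by metis
  have ln: "k < n" if "k \<in> light_vertices" for k using light_vertexD that by auto
  let ?S = "\<lambda>(i, k). {(i, j), (i, k)}"
  have qk: "(\<Sum>k\<in>light_vertices. q i k) = x i * y1K / s" for i
    by (simp add: q_def y1K_def sum_distrib_left sum_divide_distrib)
  have nu: "(\<Sum>(i, k)\<in>light_attrs \<times> light_vertices. q i j * q i k) = \<nu> j"
  proof -
    have "(\<Sum>(i, k)\<in>light_attrs \<times> light_vertices. q i j * q i k)
        = (\<Sum>i\<in>light_attrs. q i j * (x i * y1K / s))"
      unfolding sum.cartesian_product[symmetric] sum_distrib_left[symmetric] qk ..
    also have "\<dots> = (\<Sum>i\<in>light_attrs. x i ^ 2 * (y j * y1K / s ^ 2))"
      by (simp add: q_def power2_eq_square mult_ac)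
    finally show ?thesis
      unfolding sum_distrib_right[symmetric] x2K_def[symmetric] \<nu>_def by (simp add: mult_ac)
  qed
  have E1: "(\<Sum>t\<in>light_attrs \<times> light_vertices. expectation (links (?S t))) = \<nu> j"
    unfolding nu[symmetric]
  proof (rule sum.cong, simp, clarify)
    fix i k assume ik: "i \<in> light_attrs" "k \<in> light_vertices"
    then have "j \<noteq> k" "k < n" using j ln by auto
    then show "expectation (links {(i, j), (i, k)}) = q i j * q i k"
      using j p ik by (subst expectation_links) auto
  qed
  \<comment> \<open>The contribution of pairs of walks through one common attribute.\<close>
  have cub: "(\<Sum>i\<in>light_attrs. \<Sum>k\<in>light_vertices. \<Sum>k'\<in>light_vertices. q i j * q i k * q i k')
      \<le> \<nu> j * (K * (y1K / s))"
  proof -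
    have "(\<Sum>i\<in>light_attrs. \<Sum>k\<in>light_vertices. \<Sum>k'\<in>light_vertices. q i j * q i k * q i k')
        = (\<Sum>i\<in>light_attrs. q i j * (x i * y1K / s) * (x i * y1K / s))"
      unfolding sum_distrib_left[symmetric] sum_distrib_right[symmetric] qk ..
    also have "\<dots> = (\<Sum>i\<in>light_attrs. x i ^ 3 * (y j * y1K ^ 2 / s ^ 3))"
      by (simp add: q_def power3_eq_cube power2_eq_square mult_ac)
    also have "\<dots> = (\<Sum>i\<in>light_attrs. x i ^ 3) * (y j * y1K ^ 2 / s ^ 3)"
      unfolding sum_distrib_right[symmetric] ..
    also have "\<dots> \<le> K * x2K * (y j * y1K ^ 2 / s ^ 3)"
      using s_pos j truncated_nonneg by (intro mult_right_mono sum_x_cube_le) auto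
    also have "\<dots> = \<nu> j * (K * (y1K / s))"
      by (simp add: \<nu>_def power3_eq_cube power2_eq_square mult_ac)
    finally show ?thesis .
  qed
  \<comment> \<open>The three terms belong to pairs with different attributes, with the same
    attribute, and to equal walks. They are added rather than selected by cases: the overcount is
    nonnegative and leaves complete sums that factorise. Since \<open>j\<close> is heavy, no light
    \<open>k\<close> equals \<open>j\<close>.\<close>
  have "(\<Sum>t\<in>light_attrs \<times> light_vertices. \<Sum>t'\<in>light_attrs \<times> light_vertices.
      expectation (links (?S t \<union> ?S t')))
    \<le> (\<Sum>(i, k)\<in>light_attrs \<times> light_vertices. \<Sum>(i', k')\<in>light_attrs \<times> light_vertices.
      (q i j * q i k) * (q i' j * q i' k')
      + ((if i = i' then q i j * q i k * q i' k' else 0)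
      + (if i = i' then if k = k' then q i j * q i k else 0 else 0)))"
  proof (intro sum_mono, clarify, intro sum_mono, clarify)
    fix i k i' k' assume ik: "i \<in> light_attrs" "i' \<in> light_attrs" "k \<in> light_vertices" "k' \<in> light_vertices"
    have ne: "k \<noteq> j" "k' \<noteq> j" using ik j by auto
    have nonneg: "0 \<le> q i j" "0 \<le> q i k" "0 \<le> q i' j" "0 \<le> q i' k'" "0 \<le> q i k'"
      using ik j ln by (auto intro!: q0)
    have pp: "p i j = q i j" "p i k = q i k" "p i' j = q i' j" "p i' k' = q i' k'" "p i k' = q i k'"
      using ik j ln by (auto intro!: p)
    have "expectation (links ({(i, j), (i, k)} \<union> {(i', j), (i', k')}))
      = (\<Prod>(i, j)\<in>{(i, j), (i, k)} \<union> {(i', j), (i', k')}. p i j)"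
      by (rule expectation_links) simp
    also have "\<dots> \<le> (q i j * q i k) * (q i' j * q i' k')
      + ((if i = i' then q i j * q i k * q i' k' else 0)
      + (if i = i' then if k = k' then q i j * q i k else 0 else 0))"
    proof (cases "i = i'")
      case False
      then show ?thesis using ne ne[symmetric] pp by (simp add: mult_ac)
    next
      case True
      show ?thesis
      proof (cases "k = k'")
        case True
        then show ?thesis using \<open>i = i'\<close> ne ne[symmetric] pp nonneg by simp
      next
        case False
        have "{(i, j), (i, k)} \<union> {(i, j), (i, k')} = {(i, j), (i, k), (i, k')}" by auto
        then show ?thesis using \<open>i = i'\<close> ne ne[symmetric] pp nonneg False by (simp add: mult_ac)
      qed
    qed
    finally show "expectation (links ({(i, j), (i, k)} \<union> {(i', j), (i', k')}))
      \<le> (q i j * q i k) * (q i' j * q i' k')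
      + ((if i = i' then q i j * q i k * q i' k' else 0)
      + (if i = i' then if k = k' then q i j * q i k else 0 else 0))" .
  qed
  also have "\<dots> = (\<Sum>i\<in>light_attrs. \<Sum>k\<in>light_vertices. \<Sum>i'\<in>light_attrs. \<Sum>k'\<in>light_vertices.
          (q i j * q i k) * (q i' j * q i' k'))
      + ((\<Sum>i\<in>light_attrs. \<Sum>k\<in>light_vertices. \<Sum>i'\<in>light_attrs. \<Sum>k'\<in>light_vertices.
          if i = i' then q i j * q i k * q i' k' else 0)
       + (\<Sum>i\<in>light_attrs. \<Sum>k\<in>light_vertices. \<Sum>i'\<in>light_attrs. \<Sum>k'\<in>light_vertices.
          if i = i' then if k = k' then q i j * q i k else 0 else 0))"
    unfolding sum.cartesian_product[symmetric] sum.distrib ..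
  also have "\<dots> = \<nu> j * \<nu> j + ((\<Sum>i\<in>light_attrs. \<Sum>k\<in>light_vertices. \<Sum>k'\<in>light_vertices. q i j * q i k * q i k')
      + \<nu> j)"
  proof -
    have if_sum: "(\<Sum>k'\<in>light_vertices. if b then f k' else 0)
        = (if b then (\<Sum>k'\<in>light_vertices. f k') else 0)" for b and f :: "nat \<Rightarrow> real"
      by simp
    have nu': "(\<Sum>i\<in>light_attrs. \<Sum>k\<in>light_vertices. q i j * q i k) = \<nu> j"
      unfolding nu[symmetric] sum.cartesian_product ..
    have "(\<Sum>i\<in>light_attrs. \<Sum>k\<in>light_vertices. \<Sum>i'\<in>light_attrs. \<Sum>k'\<in>light_vertices.
          c i k * (q i' j * q i' k')) = (\<Sum>i\<in>light_attrs. \<Sum>k\<in>light_vertices. c i k) * \<nu> j" for c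
      using nu'[unfolded sum_distrib_left[symmetric]]
      unfolding sum_distrib_left[symmetric] sum_distrib_right[symmetric] by simp
    then show ?thesis unfolding if_sum using nu' by simp
  qed
  also have "\<dots> \<le> \<nu> j * \<nu> j + (\<nu> j * (K * (y1K / s)) + \<nu> j)"
    by (intro add_mono order_refl cub)
  finally have E2: "(\<Sum>t\<in>light_attrs \<times> light_vertices. \<Sum>t'\<in>light_attrs \<times> light_vertices.
      expectation (links (?S t \<union> ?S t'))) \<le> \<nu> j * \<nu> j + (\<nu> j * (K * (y1K / s)) + \<nu> j)" .
  have w: "walks j \<omega> = (\<Sum>t\<in>light_attrs \<times> light_vertices. links (?S t) \<omega>)" for \<omega>
    unfolding walks_def by (intro sum.cong) auto
  show "integrable M (\<lambda>\<omega>. (walks j \<omega> - \<nu> j)\<^sup>2)"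
    unfolding w by (rule expectation_square_sum_links) auto
  have "expectation (\<lambda>\<omega>. (walks j \<omega> - \<nu> j)\<^sup>2)
    = (\<Sum>t\<in>light_attrs \<times> light_vertices. \<Sum>t'\<in>light_attrs \<times> light_vertices.
      expectation (links (?S t \<union> ?S t'))) - 2 * \<nu> j * \<nu> j + (\<nu> j)\<^sup>2"
    unfolding w by (subst expectation_square_sum_links) (use E1 in auto)
  then show "expectation (\<lambda>\<omega>. (walks j \<omega> - \<nu> j)\<^sup>2) \<le> \<nu> j * (1 + K * (y1K / s))"
    using E2 by (simp add: power2_eq_square algebra_simps)
qed (use assms integrable_walks in auto)

text \<open>Double connections to the same light vertex could be frequent for a vertex weight of
  order n. The relative factor \<open>K * y j * x2 / s ^ 2\<close> becomes small because every
  single weight is o(n).\<close>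

lemma expectation_walk_overlap:
  assumes "j \<in> heavy_vertices"
  shows "expectation (walk_overlap j) \<le> \<nu> j * (K * y j * x2 / s ^ 2)"
proof -
  have j: "j < n" "j \<notin> light_vertices" "0 \<le> y j" using assms heavy_vertexD by auto
  have "expectation (walk_overlap j) = (\<Sum>k\<in>light_vertices. \<Sum>(i, i')\<in>distinct2 light_attrs.
    expectation (links {(i, j), (i, k), (i', j), (i', k)}))"
    unfolding walk_overlap_def case_prod_beta by (simp add: Bochner_Integration.integral_sum)
  also have "\<dots> \<le> (\<Sum>k\<in>light_vertices. \<Sum>(i, i')\<in>distinct2 light_attrs.
      x i ^ 2 * x i' ^ 2 * (y j ^ 2 * y k ^ 2 / s ^ 4))"
  proof (intro sum_mono, clarify)
    fix k i i' assume k: "k \<in> light_vertices" and i: "(i, i') \<in> distinct2 light_attrs"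
    have "expectation (links {(i, j), (i, k), (i', j), (i', k)})
        \<le> (\<Prod>(i, j)\<in>{(i, j), (i, k), (i', j), (i', k)}. x i * y j / s)"
      using j k i light_vertexD light_attrD by (intro expectation_links_le) auto
    also have "\<dots> = x i ^ 2 * x i' ^ 2 * (y j ^ 2 * y k ^ 2 / s ^ 4)"
    proof -
      have "k \<noteq> j" "j \<noteq> k" using j k by auto
      then show ?thesis using i by (simp add: eval_nat_numeral mult_ac)
    qed
    finally show "expectation (links {(i, j), (i, k), (i', j), (i', k)})
        \<le> x i ^ 2 * x i' ^ 2 * (y j ^ 2 * y k ^ 2 / s ^ 4)" .
  qed
  also have "\<dots> = (\<Sum>k\<in>light_vertices. y k ^ 2)
      * ((\<Sum>(i, i')\<in>distinct2 light_attrs. x i ^ 2 * x i' ^ 2) * (y j ^ 2 / s ^ 4))"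
  proof -
    have "(\<Sum>(i, i')\<in>distinct2 light_attrs. x i ^ 2 * x i' ^ 2 * (y j ^ 2 * c / s ^ 4))
        = c * ((\<Sum>(i, i')\<in>distinct2 light_attrs. x i ^ 2 * x i' ^ 2) * (y j ^ 2 / s ^ 4))" for c
      unfolding case_prod_beta sum_distrib_right[symmetric] by simp
    then show ?thesis unfolding sum_distrib_right by simp
  qed
  also have "\<dots> \<le> (K * y1K) * ((x2K * x2) * (y j ^ 2 / s ^ 4))"
  proof (intro mult_mono sum_y_sq_le)
    have "(\<Sum>(i, i')\<in>distinct2 light_attrs. x i ^ 2 * x i' ^ 2) \<le> x2K * x2K"
      unfolding x2K_def by (intro sum_distinct2_le) auto
    also have "\<dots> \<le> x2K * x2" using truncated_nonneg x2K_le by (intro mult_left_mono) auto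
    finally show "(\<Sum>(i, i')\<in>distinct2 light_attrs. x i ^ 2 * x i' ^ 2) \<le> x2K * x2" .
    have "0 \<le> (\<Sum>(i, i')\<in>distinct2 light_attrs. x i ^ 2 * x i' ^ 2)"
      by (intro sum_nonneg) auto
    then show "0 \<le> (\<Sum>(i, i')\<in>distinct2 light_attrs. x i ^ 2 * x i' ^ 2) * (y j ^ 2 / s ^ 4)"
      using s_pos by simp
  qed (use truncated_nonneg moments_nonneg K_nonneg s_pos in simp_all)
  also have "\<dots> = \<nu> j * (K * y j * x2 / s ^ 2)"
    by (simp add: \<nu>_def eval_nat_numeral mult_ac)
  finally show ?thesis .
qed

definition cherry_loss :: "'w \<Rightarrow> real" where
  "cherry_loss \<omega> = (\<Sum>j\<in>heavy_vertices.
    1 + 2 * \<nu> j * (1 + \<bar>walks j \<omega> - \<nu> j\<bar> + walk_overlap j \<omega>))"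

lemma \<nu>_nonneg: "j \<in> heavy_vertices \<Longrightarrow> 0 \<le> \<nu> j"
  unfolding \<nu>_def using truncated_nonneg heavy_vertexD s_pos by auto

lemma cherries_ge:
  "(\<Sum>j\<in>heavy_vertices. \<nu> j ^ 2) - cherry_loss \<omega> + star_count \<omega> \<le> cherries \<omega>"
proof -
  let ?f = "\<lambda>(j, k, l). of_bool (adj j k \<omega> \<and> adj j l \<omega>) :: real"
  have "(\<Sum>j\<in>heavy_vertices. \<nu> j ^ 2) - cherry_loss \<omega>
      = (\<Sum>j\<in>heavy_vertices. \<nu> j ^ 2 - (1 + 2 * \<nu> j * (1 + \<bar>walks j \<omega> - \<nu> j\<bar> + walk_overlap j \<omega>)))"
    unfolding cherry_loss_def by (simp add: sum_subtractf)
  also have "\<dots> \<le> (\<Sum>j\<in>heavy_vertices. neighbours j \<omega> * (neighbours j \<omega> - 1))"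
    by (intro sum_mono neighbours_choose_ge \<nu>_nonneg)
  also have "\<dots> = (\<Sum>j\<in>heavy_vertices. \<Sum>(k, l)\<in>distinct2 light_vertices.
      of_bool (\<exists>i\<in>light_attrs. H i j \<omega> \<and> H i k \<omega>) * of_bool (\<exists>i\<in>light_attrs. H i j \<omega> \<and> H i l \<omega>))"
    unfolding neighbours_def by (subst sum_distinct2_idempotent) auto
  also have "\<dots> \<le> (\<Sum>j\<in>heavy_vertices. \<Sum>(k, l)\<in>distinct2 light_vertices. ?f (j, k, l))"
    using light_attrD by (intro sum_mono) (force simp: adj_def of_bool_def)
  also have "\<dots> = sum ?f (heavy_vertices \<times> distinct2 light_vertices)"
    unfolding sum.cartesian_product by (intro sum.cong) auto
  finally have 1: "(\<Sum>j\<in>heavy_vertices. \<nu> j ^ 2) - cherry_loss \<omega>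
    \<le> sum ?f (heavy_vertices \<times> distinct2 light_vertices)" .
  have 2: "star_count \<omega> \<le> sum ?f (distinct3 light_vertices)"
    unfolding star_count_def using heavy_attrD by (intro sum_mono) (force simp: adj_def of_bool_def)
  have disj: "heavy_vertices \<times> distinct2 light_vertices \<inter> distinct3 light_vertices = {}"
    by (auto dest: heavy_vertexD)
  have "sum ?f (heavy_vertices \<times> distinct2 light_vertices) + sum ?f (distinct3 light_vertices)
      = sum ?f (heavy_vertices \<times> distinct2 light_vertices \<union> distinct3 light_vertices)"
    using disj by (subst sum.union_disjoint) auto
  also have "\<dots> \<le> cherries \<omega>"
    unfolding cherries_def by (rule sum_mono2) (auto dest: heavy_vertexD light_vertexD)
  finally show ?thesis using 1 2 by linarith
qed

lemma integrable_cherry_loss: "integrable M cherry_loss"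
  unfolding cherry_loss_def
  by (intro Bochner_Integration.integrable_add Bochner_Integration.integrable_sum
      integrable_mult_right integrable_abs Bochner_Integration.integrable_diff integrable_walks) simp_all

lemma cherry_loss_nonneg: "0 \<le> cherry_loss \<omega>"
  unfolding cherry_loss_def
  by (intro sum_nonneg add_nonneg_nonneg mult_nonneg_nonneg \<nu>_nonneg walk_overlap_nonneg) simp_all

lemma expectation_cherry_loss:
  assumes "0 < \<eta>" and "\<And>j. j \<in> heavy_vertices \<Longrightarrow> 0 < \<nu> j"
  shows "expectation cherry_loss \<le> (\<Sum>j\<in>heavy_vertices.
    1 + 2 * \<nu> j * (1 + (\<eta> * \<nu> j + (1 + K * (y1K / s)) / \<eta>) + \<nu> j * (K * y j * x2 / s ^ 2)))"
proof -
  have int: "integrable M (\<lambda>\<omega>. \<bar>walks j \<omega> - \<nu> j\<bar>)" for j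
    by (intro integrable_abs Bochner_Integration.integrable_diff integrable_walks) simp_all
  have "expectation cherry_loss = (\<Sum>j\<in>heavy_vertices.
      expectation (\<lambda>\<omega>. 1 + 2 * \<nu> j * (1 + \<bar>walks j \<omega> - \<nu> j\<bar> + walk_overlap j \<omega>)))"
    unfolding cherry_loss_def
    by (intro Bochner_Integration.integral_sum Bochner_Integration.integrable_add
      integrable_mult_right int integrable_walks) simp_all
  also have "\<dots> \<le> (\<Sum>j\<in>heavy_vertices.
    1 + 2 * \<nu> j * (1 + (\<eta> * \<nu> j + (1 + K * (y1K / s)) / \<eta>) + \<nu> j * (K * y j * x2 / s ^ 2)))"
  proof (rule sum_mono)
    fix j assume j: "j \<in> heavy_vertices"
    have "expectation (\<lambda>\<omega>. 1 + 2 * \<nu> j * (1 + \<bar>walks j \<omega> - \<nu> j\<bar> + walk_overlap j \<omega>))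
      = 1 + 2 * \<nu> j * (1 + expectation (\<lambda>\<omega>. \<bar>walks j \<omega> - \<nu> j\<bar>) + expectation (walk_overlap j))"
      using int integrable_walks by (simp add: prob_space)
    also have "\<dots> \<le> 1 + 2 * \<nu> j * (1 + (\<eta> * \<nu> j + (1 + K * (y1K / s)) / \<eta>) + \<nu> j * (K * y j * x2 / s ^ 2))"
      using assms j \<nu>_nonneg
      by (intro add_mono mult_left_mono order_refl expectation_abs_walks expectation_walk_overlap) auto
    finally show "expectation (\<lambda>\<omega>. 1 + 2 * \<nu> j * (1 + \<bar>walks j \<omega> - \<nu> j\<bar> + walk_overlap j \<omega>))
      \<le> 1 + 2 * \<nu> j * (1 + (\<eta> * \<nu> j + (1 + K * (y1K / s)) / \<eta>) + \<nu> j * (K * y j * x2 / s ^ 2))" .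
  qed
  finally show ?thesis .
qed

end

section \<open>Convergence in mean for good weights\<close>

text \<open>Turns a pointwise lower bound and an upper bound on the mean into convergence in mean:
  if z \<ge> -loss and loss \<ge> 0, then |z| \<le> z + 2 loss, and only the expectation of the
  right-hand side is needed. No second moment of the whole count is used.\<close>

lemma (in prob_space) expectation_abs_diff_le:
  fixes c u l :: real
  assumes "integrable M Z" "integrable M loss" "\<And>\<omega>. 0 \<le> loss \<omega>" "\<And>\<omega>. c - loss \<omega> \<le> Z \<omega>"
    and "expectation Z \<le> c + u" "expectation loss \<le> l"
  shows "expectation (\<lambda>\<omega>. \<bar>Z \<omega> - c\<bar>) \<le> u + 2 * l"
proof -
  have "expectation (\<lambda>\<omega>. \<bar>Z \<omega> - c\<bar>) \<le> expectation (\<lambda>\<omega>. (Z \<omega> - c) + 2 * loss \<omega>)"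
  proof (rule integral_mono)
    fix \<omega> show "\<bar>Z \<omega> - c\<bar> \<le> (Z \<omega> - c) + 2 * loss \<omega>"
      using assms(3)[of \<omega>] assms(4)[of \<omega>] by linarith
  qed (use assms in auto)
  also have "\<dots> = expectation Z - c + 2 * expectation loss"
    using assms(1,2) by (simp add: prob_space)
  finally show ?thesis using assms by linarith
qed

text \<open>\<open>L_large\<close> says that the additive constants in the loss bounds are at most
  \<epsilon> times \<open>\<mu> i\<close> and \<open>\<nu> j\<close>, written with the lower bounds
  \<open>L * \<alpha> / 2\<close> and \<open>L * \<rho> / 2\<close> of these means and with
  \<open>y1K / s\<close> replaced by its upper bound \<open>2 * \<alpha>\<close>.\<close>

locale good_bipartite = truncated_bipartite M H p x y s m n K L
  for M :: "'w measure" and H p x y s m n K L +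
  fixes \<epsilon> \<alpha> \<rho> :: real
  assumes \<epsilon>: "0 < \<epsilon>" "\<epsilon> \<le> 1 / 2" and pos: "0 < \<alpha>" "0 < \<rho>"
    and y1_upper: "y1 / s \<le> (1 + \<epsilon>) * \<alpha>" and x2y1_upper: "x2 * y1 / s ^ 2 \<le> (1 + \<epsilon>) * \<rho>"
    and y1K_lower: "(1 - \<epsilon>) * \<alpha> \<le> y1K / s" and x2y1K_lower: "(1 - \<epsilon>) * \<rho> \<le> x2K * y1K / s ^ 2"
    and x3_heavy: "(1 - \<epsilon>) * x3 \<le> (\<Sum>i\<in>heavy_attrs. x i ^ 3)"
    and y2_heavy: "(1 - \<epsilon>) * y2 \<le> (\<Sum>j\<in>heavy_vertices. y j ^ 2)"
    and small_x2: "K ^ 2 * x2 / s ^ 2 \<le> \<epsilon>" and small_x3: "K ^ 3 * x3 / s ^ 3 \<le> \<epsilon>"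
    and small_y: "\<And>j. j < n \<Longrightarrow> K * y j * x2 / s ^ 2 \<le> \<epsilon>"
    and L_large: "3 * (2 + 1 / \<epsilon>) \<le> \<epsilon> * (L * \<alpha> / 2)"
      "1 + 2 * (1 + (1 + K * (2 * \<alpha>)) / \<epsilon>) \<le> \<epsilon> * (L * \<rho> / 2)"
begin

definition A :: real where "A = x3 * \<alpha> ^ 3"
definition B :: real where "B = y2 * \<rho> ^ 2"

lemma AB_nonneg: "0 \<le> A" "0 \<le> B"
  using moments_nonneg pos by (auto simp: A_def B_def)

lemma cube_bounds: "(1 + \<epsilon>) ^ 3 \<le> 1 + 5 * \<epsilon>" "(1 + \<epsilon>) ^ 2 \<le> 1 + 3 * \<epsilon>" "1 - 4 * \<epsilon> \<le> (1 - \<epsilon>) ^ 4"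
  "1 - 3 * \<epsilon> \<le> (1 - \<epsilon>) ^ 3"
proof -
  have e2: "\<epsilon> * \<epsilon> \<le> 1 / 2 * \<epsilon>" using \<epsilon> by (intro mult_right_mono) auto
  have e3: "\<epsilon> * (\<epsilon> * \<epsilon>) \<le> 1 / 2 * (\<epsilon> * \<epsilon>)" using \<epsilon> by (intro mult_right_mono) auto
  have "(1 + \<epsilon>) ^ 3 = 1 + 3 * \<epsilon> + 3 * (\<epsilon> * \<epsilon>) + \<epsilon> * (\<epsilon> * \<epsilon>)"
    by (simp add: power3_eq_cube algebra_simps)
  then show "(1 + \<epsilon>) ^ 3 \<le> 1 + 5 * \<epsilon>" using e2 e3 \<epsilon> by linarith
  have "(1 + \<epsilon>) ^ 2 = 1 + 2 * \<epsilon> + \<epsilon> * \<epsilon>"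
    by (simp add: power2_eq_square algebra_simps)
  then show "(1 + \<epsilon>) ^ 2 \<le> 1 + 3 * \<epsilon>" using e2 \<epsilon> by linarith
  show "1 - 4 * \<epsilon> \<le> (1 - \<epsilon>) ^ 4" "1 - 3 * \<epsilon> \<le> (1 - \<epsilon>) ^ 3"
    using Bernoulli_inequality[of "- \<epsilon>" 4] Bernoulli_inequality[of "- \<epsilon>" 3] \<epsilon> by simp_all
qed

lemma half: "1 / 2 \<le> 1 - \<epsilon>" using \<epsilon> by simp

lemma y1K_upper: "y1K / s \<le> (1 + \<epsilon>) * \<alpha>"
  using divide_right_mono[OF y1K_le, of s] s_pos y1_upper by linarith

lemma x2y1K_upper: "x2K * y1K / s ^ 2 \<le> (1 + \<epsilon>) * \<rho>"
proof -
  have "x2K * y1K / s ^ 2 \<le> x2 * y1 / s ^ 2"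
    using x2K_le y1K_le truncated_nonneg moments_nonneg s_pos
    by (intro divide_right_mono mult_mono) auto
  then show ?thesis using x2y1_upper by linarith
qed

lemma cube_y1_upper: "0 \<le> z \<Longrightarrow> z \<le> (1 + \<epsilon>) * \<alpha> \<Longrightarrow> x3 * z ^ 3 \<le> (1 + 5 * \<epsilon>) * A"
proof -
  assume z: "0 \<le> z" "z \<le> (1 + \<epsilon>) * \<alpha>"
  have "z ^ 3 \<le> ((1 + \<epsilon>) * \<alpha>) ^ 3" using z by (intro power_mono) auto
  also have "\<dots> = (1 + \<epsilon>) ^ 3 * \<alpha> ^ 3" by (simp add: power_mult_distrib)
  also have "\<dots> \<le> (1 + 5 * \<epsilon>) * \<alpha> ^ 3" using cube_bounds pos by (intro mult_right_mono) auto
  finally have "x3 * z ^ 3 \<le> x3 * ((1 + 5 * \<epsilon>) * \<alpha> ^ 3)"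
    using moments_nonneg by (intro mult_left_mono) auto
  then show ?thesis by (simp add: A_def mult_ac)
qed

lemma square_x2y1_upper: "0 \<le> z \<Longrightarrow> z \<le> (1 + \<epsilon>) * \<rho> \<Longrightarrow> y2 * z ^ 2 \<le> (1 + 3 * \<epsilon>) * B"
proof -
  assume z: "0 \<le> z" "z \<le> (1 + \<epsilon>) * \<rho>"
  have "z ^ 2 \<le> ((1 + \<epsilon>) * \<rho>) ^ 2" using z by (intro power_mono) auto
  also have "\<dots> = (1 + \<epsilon>) ^ 2 * \<rho> ^ 2" by (simp add: power_mult_distrib)
  also have "\<dots> \<le> (1 + 3 * \<epsilon>) * \<rho> ^ 2" using cube_bounds pos by (intro mult_right_mono) auto
  finally have "y2 * z ^ 2 \<le> y2 * ((1 + 3 * \<epsilon>) * \<rho> ^ 2)"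
    using moments_nonneg by (intro mult_left_mono) auto
  then show ?thesis by (simp add: B_def mult_ac)
qed

lemma \<mu>_ge: "i \<in> heavy_attrs \<Longrightarrow> L * \<alpha> / 2 \<le> \<mu> i"
proof -
  assume i: "i \<in> heavy_attrs"
  have "L * (1 / 2 * \<alpha>) \<le> x i * ((1 - \<epsilon>) * \<alpha>)"
    using heavy_attrD[OF i] half pos K_nonneg K_le_L by (intro mult_mono) auto
  also have "\<dots> \<le> x i * (y1K / s)"
    using heavy_attrD[OF i] y1K_lower by (intro mult_left_mono) auto
  finally show ?thesis by (simp add: \<mu>_def)
qed

lemma \<nu>_ge: "j \<in> heavy_vertices \<Longrightarrow> L * \<rho> / 2 \<le> \<nu> j"
proof -
  assume j: "j \<in> heavy_vertices"
  have "L * (1 / 2 * \<rho>) \<le> y j * ((1 - \<epsilon>) * \<rho>)"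
    using heavy_vertexD[OF j] half pos K_nonneg K_le_L by (intro mult_mono) auto
  also have "\<dots> \<le> y j * (x2K * y1K / s ^ 2)"
    using heavy_vertexD[OF j] x2y1K_lower by (intro mult_left_mono) auto
  finally show ?thesis by (simp add: \<nu>_def)
qed

lemma L_ge: "1 \<le> L * \<alpha> / 2" "1 \<le> L * \<rho> / 2"
proof -
  have L0: "0 \<le> L * \<alpha> / 2" "0 \<le> L * \<rho> / 2" using K_nonneg K_le_L pos by auto
  have 1: "\<epsilon> * (L * \<alpha> / 2) \<le> 1 * (L * \<alpha> / 2)" "\<epsilon> * (L * \<rho> / 2) \<le> 1 * (L * \<rho> / 2)"
    using L0 \<epsilon> by (intro mult_right_mono; simp)+
  have 2: "0 \<le> 1 / \<epsilon>" "0 \<le> (1 + K * (2 * \<alpha>)) / \<epsilon>" using \<epsilon> K_nonneg pos by auto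
  have "1 \<le> 3 * (2 + u)" "1 \<le> 1 + 2 * (1 + u)" if "0 \<le> u" for u :: real using that by simp_all
  note this(1)[OF 2(1)] this(2)[OF 2(2)]
  then show "1 \<le> L * \<alpha> / 2" "1 \<le> L * \<rho> / 2" using L_large 1 unfolding mult_1 by (blast intro: order_trans)+
qed

lemma \<mu>_sum: "(\<Sum>i\<in>heavy_attrs. \<mu> i ^ 3) = (\<Sum>i\<in>heavy_attrs. x i ^ 3) * (y1K / s) ^ 3"
  unfolding \<mu>_def power_mult_distrib[of "x _"] sum_distrib_right ..

lemma \<nu>_sum: "(\<Sum>j\<in>heavy_vertices. \<nu> j ^ 2) = (\<Sum>j\<in>heavy_vertices. y j ^ 2) * (x2K * y1K / s ^ 2) ^ 2"
  unfolding \<nu>_def power_mult_distrib[of "y _"] sum_distrib_right ..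

lemma \<mu>_sum_lower: "(1 - 4 * \<epsilon>) * A \<le> (\<Sum>i\<in>heavy_attrs. \<mu> i ^ 3)"
proof -
  have "(1 - 4 * \<epsilon>) * A \<le> (1 - \<epsilon>) ^ 4 * A"
    using cube_bounds AB_nonneg by (intro mult_right_mono) auto
  also have "\<dots> = ((1 - \<epsilon>) * x3) * ((1 - \<epsilon>) * \<alpha>) ^ 3"
    by (simp add: A_def eval_nat_numeral mult_ac)
  also have "\<dots> \<le> (\<Sum>i\<in>heavy_attrs. x i ^ 3) * (y1K / s) ^ 3"
    using x3_heavy y1K_lower half pos moments_nonneg heavy_attrD
    by (intro mult_mono power_mono sum_nonneg) auto
  finally show ?thesis unfolding \<mu>_sum .
qed

lemma \<nu>_sum_lower: "(1 - 3 * \<epsilon>) * B \<le> (\<Sum>j\<in>heavy_vertices. \<nu> j ^ 2)"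
proof -
  have "(1 - 3 * \<epsilon>) * B \<le> (1 - \<epsilon>) ^ 3 * B"
    using cube_bounds AB_nonneg by (intro mult_right_mono) auto
  also have "\<dots> = ((1 - \<epsilon>) * y2) * ((1 - \<epsilon>) * \<rho>) ^ 2"
    by (simp add: B_def eval_nat_numeral mult_ac)
  also have "\<dots> \<le> (\<Sum>j\<in>heavy_vertices. y j ^ 2) * (x2K * y1K / s ^ 2) ^ 2"
    using y2_heavy x2y1K_lower half pos moments_nonneg
    by (intro mult_mono power_mono sum_nonneg) auto
  finally show ?thesis unfolding \<nu>_sum .
qed

lemma \<mu>_sum_upper: "(\<Sum>i\<in>heavy_attrs. \<mu> i ^ 3) \<le> 4 * A"
proof -
  have "(\<Sum>i\<in>heavy_attrs. x i ^ 3) * (y1K / s) ^ 3 \<le> x3 * (y1K / s) ^ 3"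
    unfolding x3_def using x_nonneg truncated_nonneg s_pos
    by (intro mult_right_mono sum_mono2) (auto simp: heavy_attrs_def)
  also have "\<dots> \<le> (1 + 5 * \<epsilon>) * A"
    using y1K_upper truncated_nonneg s_pos by (intro cube_y1_upper) auto
  also have "\<dots> \<le> 4 * A" using \<epsilon> AB_nonneg by (intro mult_right_mono) auto
  finally show ?thesis unfolding \<mu>_sum .
qed

lemma \<nu>_sum_upper: "(\<Sum>j\<in>heavy_vertices. \<nu> j ^ 2) \<le> 3 * B"
proof -
  have "(\<Sum>j\<in>heavy_vertices. y j ^ 2) * (x2K * y1K / s ^ 2) ^ 2 \<le> y2 * (x2K * y1K / s ^ 2) ^ 2"
    unfolding y2_def by (intro mult_right_mono sum_mono2) (auto simp: heavy_vertices_def)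
  also have "\<dots> \<le> (1 + 3 * \<epsilon>) * B"
    using x2y1K_upper truncated_nonneg s_pos by (intro square_x2y1_upper) auto
  also have "\<dots> \<le> 3 * B" using \<epsilon> AB_nonneg by (intro mult_right_mono) auto
  finally show ?thesis unfolding \<nu>_sum .
qed

text \<open>The loss bound is used with deviation parameter \<epsilon>. The term linear in the
  deviation gives \<open>3 * \<epsilon> * \<mu> i ^ 3\<close>, the constants one more
  \<open>\<epsilon> * \<mu> i ^ 3\<close>, and the sum of cubes is at most \<open>4 * A\<close>; the
  overlap adds \<open>4 * \<epsilon> * A\<close>, whence 16 + 4 = 20.\<close>

lemma expectation_star_loss_le: "expectation star_loss \<le> 20 * \<epsilon> * A"
proof -
  have mu: "1 \<le> \<mu> i" "3 * (2 + 1 / \<epsilon>) \<le> \<epsilon> * \<mu> i" if "i \<in> heavy_attrs" for i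
  proof -
    show "1 \<le> \<mu> i" using \<mu>_ge[OF that] L_ge by linarith
    have "\<epsilon> * (L * \<alpha> / 2) \<le> \<epsilon> * \<mu> i" using \<mu>_ge[OF that] \<epsilon> by (intro mult_left_mono) auto
    then show "3 * (2 + 1 / \<epsilon>) \<le> \<epsilon> * \<mu> i" using L_large by linarith
  qed
  have mu0: "0 < \<mu> i" if "i \<in> heavy_attrs" for i using mu(1)[OF that] by linarith
  have "(\<Sum>i\<in>heavy_attrs. 3 * \<mu> i ^ 2 * (2 + (\<epsilon> * \<mu> i + 1 / \<epsilon>)))
      \<le> (\<Sum>i\<in>heavy_attrs. 4 * \<epsilon> * \<mu> i ^ 3)"
  proof (rule sum_mono)
    fix i assume i: "i \<in> heavy_attrs"
    have "3 * \<mu> i ^ 2 * (2 + (\<epsilon> * \<mu> i + 1 / \<epsilon>)) = \<mu> i ^ 2 * (3 * (2 + 1 / \<epsilon>)) + 3 * \<epsilon> * \<mu> i ^ 3"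
      by (simp add: algebra_simps power3_eq_cube power2_eq_square)
    also have "\<dots> \<le> \<mu> i ^ 2 * (\<epsilon> * \<mu> i) + 3 * \<epsilon> * \<mu> i ^ 3"
      using mu(2)[OF i] by (intro add_right_mono mult_left_mono) auto
    also have "\<dots> = 4 * \<epsilon> * \<mu> i ^ 3"
      by (simp add: algebra_simps power3_eq_cube power2_eq_square)
    finally show "3 * \<mu> i ^ 2 * (2 + (\<epsilon> * \<mu> i + 1 / \<epsilon>)) \<le> 4 * \<epsilon> * \<mu> i ^ 3" .
  qed
  also have "\<dots> = 4 * \<epsilon> * (\<Sum>i\<in>heavy_attrs. \<mu> i ^ 3)" by (simp add: sum_distrib_left)
  also have "\<dots> \<le> 4 * \<epsilon> * (4 * A)" using \<epsilon> \<mu>_sum_upper by (intro mult_left_mono) auto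
  finally have 1: "(\<Sum>i\<in>heavy_attrs. 3 * \<mu> i ^ 2 * (2 + (\<epsilon> * \<mu> i + 1 / \<epsilon>))) \<le> 4 * \<epsilon> * (4 * A)" .
  \<comment> \<open>Splits off one copy of the main term; the remaining factor is the quantity
    bounded by \<open>small_x3\<close>.\<close>
  have "x3 ^ 2 * (K * y1K) ^ 3 / s ^ 6 = (x3 * (y1K / s) ^ 3) * (K ^ 3 * x3 / s ^ 3)"
    by (simp add: eval_nat_numeral mult_ac)
  also have "\<dots> \<le> (4 * A) * \<epsilon>"
  proof (rule mult_mono[OF _ small_x3])
    have "x3 * (y1K / s) ^ 3 \<le> (1 + 5 * \<epsilon>) * A"
      using y1K_upper truncated_nonneg s_pos by (intro cube_y1_upper) auto
    also have "\<dots> \<le> 4 * A" using \<epsilon> AB_nonneg by (intro mult_right_mono) auto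
    finally show "x3 * (y1K / s) ^ 3 \<le> 4 * A" .
  qed (use AB_nonneg moments_nonneg K_nonneg s_pos in auto)
  finally show ?thesis using expectation_star_loss[OF \<epsilon>(1) mu0] 1 by (simp add: mult_ac)
qed

text \<open>Concentration and overlap each cost \<open>2 * \<epsilon> * \<nu> j ^ 2\<close>, and the
  constants collected in \<open>c\<close> cost one more \<open>\<epsilon> * \<nu> j ^ 2\<close>; the
  sum of squares is at most \<open>3 * B\<close>, whence 15.\<close>

lemma expectation_cherry_loss_le: "expectation cherry_loss \<le> 15 * \<epsilon> * B"
proof -
  define c where "c = 1 + (1 + K * (2 * \<alpha>)) / \<epsilon>"
  have nu: "1 \<le> \<nu> j" "1 + 2 * c \<le> \<epsilon> * \<nu> j" if "j \<in> heavy_vertices" for j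
  proof -
    show "1 \<le> \<nu> j" using \<nu>_ge[OF that] L_ge by linarith
    have "\<epsilon> * (L * \<rho> / 2) \<le> \<epsilon> * \<nu> j" using \<nu>_ge[OF that] \<epsilon> by (intro mult_left_mono) auto
    then show "1 + 2 * c \<le> \<epsilon> * \<nu> j" using L_large unfolding c_def by linarith
  qed
  have nu0: "0 < \<nu> j" if "j \<in> heavy_vertices" for j using nu(1)[OF that] by linarith
  have "(\<Sum>j\<in>heavy_vertices.
    1 + 2 * \<nu> j * (1 + (\<epsilon> * \<nu> j + (1 + K * (y1K / s)) / \<epsilon>) + \<nu> j * (K * y j * x2 / s ^ 2)))
    \<le> (\<Sum>j\<in>heavy_vertices. 5 * \<epsilon> * \<nu> j ^ 2)"
  proof (rule sum_mono)
    fix j assume j: "j \<in> heavy_vertices"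
    have "(1 + \<epsilon>) * \<alpha> \<le> 2 * \<alpha>" using \<epsilon> pos by (intro mult_right_mono) auto
    then have "K * (y1K / s) \<le> K * (2 * \<alpha>)" using y1K_upper K_nonneg by (intro mult_left_mono) auto
    then have "(1 + K * (y1K / s)) / \<epsilon> \<le> (1 + K * (2 * \<alpha>)) / \<epsilon>"
      using \<epsilon> by (intro divide_right_mono) auto
    moreover have "\<nu> j * (K * y j * x2 / s ^ 2) \<le> \<nu> j * \<epsilon>"
      using small_y heavy_vertexD[OF j] \<nu>_nonneg[OF j] by (intro mult_left_mono) auto
    ultimately have "1 + 2 * \<nu> j * (1 + (\<epsilon> * \<nu> j + (1 + K * (y1K / s)) / \<epsilon>) + \<nu> j * (K * y j * x2 / s ^ 2))
      \<le> 1 + 2 * \<nu> j * (c + \<epsilon> * \<nu> j + \<nu> j * \<epsilon>)"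
      unfolding c_def using \<nu>_nonneg[OF j] by (intro add_left_mono mult_left_mono) linarith+
    also have "\<dots> \<le> \<nu> j + 2 * \<nu> j * (c + \<epsilon> * \<nu> j + \<nu> j * \<epsilon>)"
      using nu(1)[OF j] by simp
    also have "\<dots> = \<nu> j * (1 + 2 * c) + 4 * \<epsilon> * \<nu> j ^ 2"
      by (simp add: power2_eq_square algebra_simps)
    also have "\<dots> \<le> \<nu> j * (\<epsilon> * \<nu> j) + 4 * \<epsilon> * \<nu> j ^ 2"
      using nu(2)[OF j] \<nu>_nonneg[OF j] by (intro add_right_mono mult_left_mono) auto
    also have "\<dots> = 5 * \<epsilon> * \<nu> j ^ 2" by (simp add: power2_eq_square)
    finally show "1 + 2 * \<nu> j * (1 + (\<epsilon> * \<nu> j + (1 + K * (y1K / s)) / \<epsilon>) + \<nu> j * (K * y j * x2 / s ^ 2))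
      \<le> 5 * \<epsilon> * \<nu> j ^ 2" .
  qed
  also have "\<dots> = 5 * \<epsilon> * (\<Sum>j\<in>heavy_vertices. \<nu> j ^ 2)" by (simp add: sum_distrib_left)
  also have "\<dots> \<le> 5 * \<epsilon> * (3 * B)" using \<epsilon> \<nu>_sum_upper by (intro mult_left_mono) auto
  finally show ?thesis using expectation_cherry_loss[OF \<epsilon>(1) nu0] by simp
qed

text \<open>If both weights are at most \<open>K\<close>, the second argument of the minimum is at
  most \<epsilon>. Otherwise the minimum is replaced by 1 and one of the two factors lies in the
  part of \<open>y1\<close> above \<open>K\<close>, which is at most
  \<open>4 * \<epsilon> * y1\<close>. The total is 1 + 2 * 4 = 9.\<close>

lemma sum_min_le:
  "(\<Sum>k<n. \<Sum>l<n. y k * y l * min 1 (x2 / s ^ 2 * (y k * y l))) \<le> 9 * \<epsilon> * y1 ^ 2"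
proof -
  define h where "h k = (if y k \<le> K then 0 else y k)" for k
  have h0: "0 \<le> h k" if "k < n" for k using y_nonneg that by (auto simp: h_def)
  have "y1 = (\<Sum>k\<in>light_vertices. y k) + (\<Sum>k<n. h k)"
  proof -
    have "(\<Sum>k\<in>light_vertices. y k) = (\<Sum>k<n. if y k \<le> K then y k else 0)"
      unfolding light_vertices_def
      by (subst sum.inter_filter[symmetric]) (auto intro!: sum.cong)
    then show ?thesis unfolding y1_def h_def by (simp add: sum.distrib[symmetric] if_distrib cong: if_cong)
  qed
  then have hsum: "(\<Sum>k<n. h k) = y1 - y1K" by (simp add: y1K_def)
  \<comment> \<open>The upper bound on \<open>y1\<close> and the lower bound on \<open>y1K\<close>
    differ by \<open>2 * \<epsilon> * \<alpha> * s\<close>, and \<open>\<alpha> * s\<close> is at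
    most twice \<open>y1K\<close> because \<open>1 - \<epsilon>\<close> is at least 1/2.\<close>
  have hle: "y1 - y1K \<le> 4 * \<epsilon> * y1"
  proof -
    have "y1 \<le> (1 + \<epsilon>) * \<alpha> * s" "(1 - \<epsilon>) * \<alpha> * s \<le> y1K"
      using y1_upper y1K_lower s_pos by (simp_all add: field_simps)
    then have "y1 - y1K \<le> 4 * \<epsilon> * (1 / 2 * \<alpha> * s)" by (simp add: algebra_simps)
    also have "\<dots> \<le> 4 * \<epsilon> * ((1 - \<epsilon>) * \<alpha> * s)"
      using \<epsilon> half pos s_pos by (intro mult_left_mono mult_right_mono) auto
    also have "\<dots> \<le> 4 * \<epsilon> * y1"
      using \<open>(1 - \<epsilon>) * \<alpha> * s \<le> y1K\<close> y1K_le \<epsilon> by (intro mult_left_mono) auto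
    finally show ?thesis .
  qed
  have "(\<Sum>k<n. \<Sum>l<n. y k * y l * min 1 (x2 / s ^ 2 * (y k * y l)))
    \<le> (\<Sum>k<n. \<Sum>l<n. y k * y l * \<epsilon> + (h k * y l + y k * h l))"
  proof (intro sum_mono)
    fix k l assume kl: "k \<in> {..<n}" "l \<in> {..<n}"
    then have nn: "0 \<le> y k" "0 \<le> y l" "0 \<le> h k" "0 \<le> h l" using y_nonneg h0 by auto
    show "y k * y l * min 1 (x2 / s ^ 2 * (y k * y l)) \<le> y k * y l * \<epsilon> + (h k * y l + y k * h l)"
    proof (cases "y k \<le> K \<and> y l \<le> K")
      case True
      have "x2 / s ^ 2 * (y k * y l) \<le> x2 / s ^ 2 * (K * K)"
        using True nn moments_nonneg s_pos K_nonneg by (intro mult_left_mono mult_mono) auto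
      also have "\<dots> \<le> \<epsilon>" using small_x2 by (simp add: power2_eq_square mult_ac)
      finally have "y k * y l * min 1 (x2 / s ^ 2 * (y k * y l)) \<le> y k * y l * \<epsilon>"
        using nn by (intro mult_left_mono) auto
      then show ?thesis using nn by (simp add: add_increasing2)
    next
      case False
      have "y k * y l * min 1 (x2 / s ^ 2 * (y k * y l)) \<le> y k * y l * 1"
        using nn by (intro mult_left_mono) auto
      also have "\<dots> \<le> h k * y l + y k * h l"
        using False nn by (auto simp: h_def)
      finally show ?thesis using nn \<epsilon> by (simp add: add_increasing)
    qed
  qed
  also have "\<dots> = y1 * y1 * \<epsilon> + ((\<Sum>k<n. h k) * y1 + y1 * (\<Sum>k<n. h k))"
    unfolding sum.distrib y1_def sum_distrib_left[symmetric] sum_distrib_right[symmetric] ..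
  also have "\<dots> = y1 * (y1 * \<epsilon> + 2 * (y1 - y1K))" unfolding hsum by (simp add: algebra_simps)
  also have "\<dots> \<le> y1 * (y1 * \<epsilon> + 2 * (4 * \<epsilon> * y1))"
    using hle moments_nonneg by (intro mult_left_mono add_mono) auto
  also have "\<dots> = 9 * \<epsilon> * y1 ^ 2" by (simp add: power2_eq_square algebra_simps)
  finally show ?thesis .
qed

lemma expectation_triangles_le: "expectation triangles \<le> A + (5 * \<epsilon> * A + 27 * \<epsilon> * B)"
proof -
  have "y2 * (x2 / s ^ 2) ^ 2 * (\<Sum>k<n. \<Sum>l<n. y k * y l * min 1 (x2 / s ^ 2 * (y k * y l)))
      \<le> y2 * (x2 / s ^ 2) ^ 2 * (9 * \<epsilon> * y1 ^ 2)"
    using moments_nonneg by (intro mult_left_mono sum_min_le) auto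
  also have "\<dots> = 9 * \<epsilon> * (y2 * (x2 * y1 / s ^ 2) ^ 2)" by (simp add: power_mult_distrib power_divide)
  also have "\<dots> \<le> 9 * \<epsilon> * ((1 + 3 * \<epsilon>) * B)"
    using \<epsilon> x2y1_upper moments_nonneg s_pos by (intro mult_left_mono square_x2y1_upper) auto
  also have "\<dots> \<le> 9 * \<epsilon> * (3 * B)"
    using \<epsilon> AB_nonneg by (intro mult_left_mono mult_right_mono) auto
  finally have 1: "y2 * (x2 / s ^ 2) ^ 2 * (\<Sum>k<n. \<Sum>l<n. y k * y l * min 1 (x2 / s ^ 2 * (y k * y l)))
    \<le> 9 * \<epsilon> * (3 * B)" .
  have "x3 * (y1 / s) ^ 3 \<le> (1 + 5 * \<epsilon>) * A"
    using y1_upper moments_nonneg s_pos by (intro cube_y1_upper) auto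
  then show ?thesis using expectation_triangles_total 1 by (simp add: algebra_simps)
qed

lemma expectation_cherries_upper: "expectation cherries \<le> (A + B) + (5 * \<epsilon> * A + 3 * \<epsilon> * B)"
proof -
  have "x3 * (y1 / s) ^ 3 \<le> (1 + 5 * \<epsilon>) * A"
    using y1_upper moments_nonneg s_pos by (intro cube_y1_upper) auto
  moreover have "y2 * (x2 * y1 / s ^ 2) ^ 2 \<le> (1 + 3 * \<epsilon>) * B"
    using x2y1_upper moments_nonneg s_pos by (intro square_x2y1_upper) auto
  ultimately show ?thesis using expectation_cherries_total by (simp add: algebra_simps)
qed

text \<open>The loss has a deterministic part, the shortfall \<open>4 * \<epsilon> * A\<close> of
  the sum of \<open>\<mu> i ^ 3\<close>, and the random part \<open>star_loss\<close>. The
  coefficients obtained are 5 + 2 * 24 = 53 for \<open>A\<close> and 27 for \<open>B\<close>,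
  rounded up to 60 so as to share one constant with \<open>cherries_L1\<close>.\<close>

lemma triangles_L1: "expectation (\<lambda>\<omega>. \<bar>triangles \<omega> - A\<bar>) \<le> 60 * \<epsilon> * (A + B)"
proof -
  have "expectation (\<lambda>\<omega>. \<bar>triangles \<omega> - A\<bar>) \<le> (5 * \<epsilon> * A + 27 * \<epsilon> * B) + 2 * (4 * \<epsilon> * A + 20 * \<epsilon> * A)"
  proof (rule expectation_abs_diff_le)
    show "integrable M (\<lambda>\<omega>. 4 * \<epsilon> * A + star_loss \<omega>)" using integrable_star_loss by simp
    show "A - (4 * \<epsilon> * A + star_loss \<omega>) \<le> triangles \<omega>" for \<omega>
      using triangles_ge[of \<omega>] star_count_ge[of \<omega>] \<mu>_sum_lower \<mu>_ge L_ge
      by (simp add: algebra_simps) (smt (verit))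
    show "0 \<le> 4 * \<epsilon> * A + star_loss \<omega>" for \<omega> using star_loss_nonneg \<epsilon> AB_nonneg by simp
    show "expectation (\<lambda>\<omega>. 4 * \<epsilon> * A + star_loss \<omega>) \<le> 4 * \<epsilon> * A + 20 * \<epsilon> * A"
      using integrable_star_loss expectation_star_loss_le by (simp add: prob_space)
  qed (use integrable_counts expectation_triangles_le in auto)
  also have "\<dots> \<le> 60 * \<epsilon> * (A + B)" using \<epsilon> AB_nonneg by (simp add: algebra_simps)
  finally show ?thesis .
qed

lemma cherries_L1: "expectation (\<lambda>\<omega>. \<bar>cherries \<omega> - (A + B)\<bar>) \<le> 60 * \<epsilon> * (A + B)"
proof -
  have "expectation (\<lambda>\<omega>. \<bar>cherries \<omega> - (A + B)\<bar>) \<le> (5 * \<epsilon> * A + 3 * \<epsilon> * B)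
    + 2 * (4 * \<epsilon> * A + 3 * \<epsilon> * B + (20 * \<epsilon> * A + 15 * \<epsilon> * B))"
  proof (rule expectation_abs_diff_le)
    let ?l = "\<lambda>\<omega>. 4 * \<epsilon> * A + 3 * \<epsilon> * B + (star_loss \<omega> + cherry_loss \<omega>)"
    show "integrable M ?l" using integrable_star_loss integrable_cherry_loss by simp
    show "(A + B) - ?l \<omega> \<le> cherries \<omega>" for \<omega>
      using cherries_ge[of \<omega>] star_count_ge[of \<omega>] \<mu>_sum_lower \<nu>_sum_lower \<mu>_ge L_ge
      by (simp add: algebra_simps) (smt (verit))
    show "0 \<le> ?l \<omega>" for \<omega> using star_loss_nonneg cherry_loss_nonneg \<epsilon> AB_nonneg by simp
    show "expectation ?l \<le> 4 * \<epsilon> * A + 3 * \<epsilon> * B + (20 * \<epsilon> * A + 15 * \<epsilon> * B)"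
      using integrable_star_loss integrable_cherry_loss expectation_star_loss_le expectation_cherry_loss_le
      by (simp add: prob_space)
  qed (use integrable_counts expectation_cherries_upper in auto)
  also have "\<dots> \<le> 60 * \<epsilon> * (A + B)" using \<epsilon> AB_nonneg by (simp add: algebra_simps)
  finally show ?thesis .
qed

end

section \<open>The model\<close>

abbreviation unif :: "real measure" where "unif \<equiv> uniform_measure lborel {0..1}"
abbreviation marks :: "(nat \<Rightarrow> nat \<Rightarrow> real) measure" where
  "marks \<equiv> PiM UNIV (\<lambda>_. PiM UNIV (\<lambda>_. unif))"

lemma prob_space_unif: "prob_space unif"
  by (rule prob_space_uniform_measure) auto

lemma prob_space_marks: "prob_space marks"
  by (intro prob_space_PiM prob_space_unif)

lemma measure_unif_atMost: "0 \<le> t \<Longrightarrow> t \<le> 1 \<Longrightarrow> measure unif {..t} = t"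
proof -
  assume "0 \<le> t" "t \<le> 1"
  then have "{0..1} \<inter> {..t} = {0..t}" by auto
  then show ?thesis using \<open>0 \<le> t\<close> by (simp add: measure_uniform_measure)
qed

lemma measure_PiM_Collect:
  assumes "prob_space N" "finite J" "\<And>i. i \<in> J \<Longrightarrow> A i \<in> sets N"
  shows "measure (PiM UNIV (\<lambda>_. N)) {f \<in> space (PiM UNIV (\<lambda>_. N)). \<forall>i\<in>J. f i \<in> A i}
    = (\<Prod>i\<in>J. measure N (A i))"
proof -
  interpret N: prob_space N by fact
  interpret product_prob_space "\<lambda>_. N" UNIV by unfold_locales
  interpret P: prob_space "PiM UNIV (\<lambda>_. N)" by (rule prob_space_PiM) unfold_locales
  have "emeasure (PiM UNIV (\<lambda>_. N)) {f \<in> space (PiM UNIV (\<lambda>_. N)). \<forall>i\<in>J. f i \<in> A i}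
      = (\<Prod>i\<in>J. emeasure N (A i))"
    using assms by (intro emeasure_PiM_Collect) auto
  then show ?thesis
    by (simp add: P.emeasure_eq_measure N.emeasure_eq_measure prod_ennreal prod_nonneg)
qed

text \<open>\<open>marks\<close> is a product of products, so the pairs in \<open>S\<close> are
  grouped by rows: row \<open>i\<close> has to lie in the cylinder \<open>A i\<close>, and the
  measure factorises first over the rows and then inside each row.\<close>

lemma measure_marks:
  assumes "finite S" and t: "\<And>i j. 0 \<le> t i j" "\<And>i j. t i j \<le> 1"
  shows "measure marks {u \<in> space marks. \<forall>(i, j)\<in>S. u i j \<le> t i j} = (\<Prod>(i, j)\<in>S. t i j)"
proof -
  let ?row = "PiM UNIV (\<lambda>_. unif) :: (nat \<Rightarrow> real) measure"
  define A where "A i = {v \<in> space ?row. \<forall>j\<in>S `` {i}. v j \<in> {..t i j}}" for i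
  have fin: "finite (S `` {i})" for i using assms(1) by (rule finite_Image)
  have A: "A i \<in> sets ?row" for i
    unfolding A_def using fin by measurable
  have mA: "measure ?row (A i) = (\<Prod>j\<in>S `` {i}. t i j)" for i
    unfolding A_def using measure_PiM_Collect[OF prob_space_unif fin[of i], of "\<lambda>j. {..t i j}"]
    by (simp add: measure_unif_atMost t)
  have "{u \<in> space marks. \<forall>(i, j)\<in>S. u i j \<le> t i j} = {u \<in> space marks. \<forall>i\<in>fst ` S. u i \<in> A i}"
    by (auto simp: A_def space_PiM PiE_def Pi_def)
  then have "measure marks {u \<in> space marks. \<forall>(i, j)\<in>S. u i j \<le> t i j} = (\<Prod>i\<in>fst ` S. measure ?row (A i))"
    by (simp only: measure_PiM_Collect[OF prob_space_PiM[OF prob_space_unif] finite_imageI[OF assms(1)] A])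
  also have "\<dots> = (\<Prod>(i, j)\<in>(SIGMA i:fst ` S. S `` {i}). t i j)"
    unfolding mA using assms(1) fin by (subst prod.Sigma) auto
  also have "(SIGMA i:fst ` S. S `` {i}) = S" by force
  finally show ?thesis .
qed

text \<open>The hypothesis on \<open>Q\<close> with \<eta> \<le> 1/2 keeps the denominator above
  half of \<open>A + B\<close>; the numerator error is then at most twice \<eta> (A + B).\<close>

lemma ratio_close:
  fixes A B T Q \<eta> :: real
  assumes "0 < A" "0 \<le> B" "0 < \<eta>" "\<eta> \<le> 1 / 2"
    and T: "\<bar>T - A\<bar> \<le> \<eta> * (A + B)" and Q: "\<bar>Q - (A + B)\<bar> \<le> \<eta> * (A + B)"
  shows "\<bar>T / Q - A / (A + B)\<bar> \<le> 4 * \<eta>"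
proof -
  define S where "S = A + B"
  have s: "0 < S" "A \<le> S" using assms by (auto simp: S_def)
  note T = T[folded S_def] and Q = Q[folded S_def]
  have "\<eta> * S \<le> 1 / 2 * S" using assms s by (intro mult_right_mono) auto
  then have Q2: "S / 2 \<le> Q" using Q by linarith
  then have Q0: "0 < Q" using s by linarith
  \<comment> \<open>Compares \<open>T\<close> with \<open>A / S * Q\<close>: one error comes from
    \<open>T\<close>, the other from \<open>Q\<close> with the weight \<open>A / S\<close>, which is
    at most 1.\<close>
  have "T / Q - A / S = ((T - A) + A / S * (S - Q)) / Q"
    using Q0 s by (simp add: field_simps)
  then have "\<bar>T / Q - A / S\<bar> = \<bar>(T - A) + A / S * (S - Q)\<bar> / Q"
    using Q0 by simp
  also have "\<dots> \<le> (2 * (\<eta> * S)) / Q"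
  proof (rule divide_right_mono)
    have "\<bar>A / S * (S - Q)\<bar> \<le> 1 * (\<eta> * S)"
      unfolding abs_mult using assms(1) s Q by (intro mult_mono) (auto simp: abs_minus_commute)
    then show "\<bar>(T - A) + A / S * (S - Q)\<bar> \<le> 2 * (\<eta> * S)" using T by linarith
  qed (use Q0 in simp)
  also have "\<dots> \<le> (2 * (\<eta> * S)) / (S / 2)"
    using assms s Q2 Q0 by (intro divide_left_mono) auto
  also have "\<dots> = 4 * \<eta>" using s by simp
  finally show ?thesis unfolding S_def .
qed

lemma measurable_marks [measurable (raw)]:
  assumes "f \<in> N \<rightarrow>\<^sub>M marks"
  shows "(\<lambda>\<omega>. f \<omega> i j) \<in> borel_measurable N"
proof -
  have "(\<lambda>u. u i) \<in> marks \<rightarrow>\<^sub>M PiM UNIV (\<lambda>_. unif)"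
    by (rule measurable_component_singleton) simp
  moreover have "(\<lambda>v. v j) \<in> PiM UNIV (\<lambda>_. unif) \<rightarrow>\<^sub>M unif"
    by (rule measurable_component_singleton) simp
  ultimately have "(\<lambda>u. u i j) \<in> marks \<rightarrow>\<^sub>M unif" by (rule measurable_compose)
  then have "(\<lambda>u. u i j) \<in> borel_measurable marks" by (simp cong: measurable_cong_sets)
  then show ?thesis using assms by (rule measurable_compose[rotated])
qed

lemma random_bipartite_marks:
  assumes "\<And>i. 0 \<le> x i" "\<And>j. 0 \<le> y j"
  shows "random_bipartite marks (\<lambda>i j u. edgeH m n (x, y, u) i j)
    (\<lambda>i j. min 1 (x i * y j / sqrt (real m * real n)))"
proof -
  interpret prob_space marks by (rule prob_space_marks)
  show ?thesis
  proof unfold_locales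
    show "Measurable.pred marks (\<lambda>u. edgeH m n (x, y, u) i j)" for i j
      unfolding edgeH_def prod.case by measurable
    fix S :: "(nat \<times> nat) set" assume "finite S"
    then show "prob {u \<in> space marks. \<forall>(i, j)\<in>S. edgeH m n (x, y, u) i j}
        = (\<Prod>(i, j)\<in>S. min 1 (x i * y j / sqrt (real m * real n)))"
      unfolding edgeH_def prod.case using assms by (intro measure_marks) auto
  qed
qed

context good_bipartite begin

lemma prob_ratio_far:
  assumes "0 < A" "0 < \<eta>" "\<eta> \<le> 1 / 2"
  shows "prob {\<omega> \<in> space M. 4 * \<eta> < \<bar>triangles \<omega> / cherries \<omega> - A / (A + B)\<bar>} \<le> 120 * \<epsilon> / \<eta>"
proof -
  have s: "0 < A + B" using assms AB_nonneg by simp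
  have [measurable]: "triangles \<in> borel_measurable M" "cherries \<in> borel_measurable M"
    using integrable_counts by auto
  have markov: "prob {\<omega> \<in> space M. \<bar>Z \<omega> - c\<bar> \<ge> \<eta> * (A + B)} \<le> 60 * \<epsilon> / \<eta>"
    if Z: "integrable M Z" "expectation (\<lambda>\<omega>. \<bar>Z \<omega> - c\<bar>) \<le> 60 * \<epsilon> * (A + B)" for Z and c :: real
  proof -
    have "prob {\<omega> \<in> space M. \<bar>Z \<omega> - c\<bar> \<ge> \<eta> * (A + B)}
        \<le> expectation (\<lambda>\<omega>. \<bar>Z \<omega> - c\<bar>) / (\<eta> * (A + B))"
      by (rule integral_Markov_inequality_measure[where A = "{}"]) (use Z assms s in auto)
    also have "\<dots> \<le> 60 * \<epsilon> * (A + B) / (\<eta> * (A + B))"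
      using Z assms s by (intro divide_right_mono) auto
    finally show ?thesis using s by simp
  qed
  have "prob {\<omega> \<in> space M. 4 * \<eta> < \<bar>triangles \<omega> / cherries \<omega> - A / (A + B)\<bar>}
    \<le> prob ({\<omega> \<in> space M. \<bar>triangles \<omega> - A\<bar> \<ge> \<eta> * (A + B)}
        \<union> {\<omega> \<in> space M. \<bar>cherries \<omega> - (A + B)\<bar> \<ge> \<eta> * (A + B)})"
  proof (rule finite_measure_mono)
    show "{\<omega> \<in> space M. 4 * \<eta> < \<bar>triangles \<omega> / cherries \<omega> - A / (A + B)\<bar>}
      \<subseteq> {\<omega> \<in> space M. \<bar>triangles \<omega> - A\<bar> \<ge> \<eta> * (A + B)}
        \<union> {\<omega> \<in> space M. \<bar>cherries \<omega> - (A + B)\<bar> \<ge> \<eta> * (A + B)}"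
    proof (rule subsetI, rule ccontr)
      fix \<omega> assume far: "\<omega> \<in> {\<omega> \<in> space M. 4 * \<eta> < \<bar>triangles \<omega> / cherries \<omega> - A / (A + B)\<bar>}"
        and "\<omega> \<notin> {\<omega> \<in> space M. \<bar>triangles \<omega> - A\<bar> \<ge> \<eta> * (A + B)}
          \<union> {\<omega> \<in> space M. \<bar>cherries \<omega> - (A + B)\<bar> \<ge> \<eta> * (A + B)}"
      then have "\<bar>triangles \<omega> / cherries \<omega> - A / (A + B)\<bar> \<le> 4 * \<eta>"
        by (intro ratio_close[OF assms(1) AB_nonneg(2) assms(2,3)]) auto
      then show False using far by simp
    qed
  qed measurable
  also have "\<dots> \<le> prob {\<omega> \<in> space M. \<bar>triangles \<omega> - A\<bar> \<ge> \<eta> * (A + B)}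
      + prob {\<omega> \<in> space M. \<bar>cherries \<omega> - (A + B)\<bar> \<ge> \<eta> * (A + B)}"
    by (rule measure_Un_le) measurable
  also have "\<dots> \<le> 60 * \<epsilon> / \<eta> + 60 * \<epsilon> / \<eta>"
    by (intro add_mono markov integrable_counts triangles_L1 cherries_L1)
  finally show ?thesis by simp
qed

end

text \<open>The last condition of \<open>good_x\<close> makes attributes of weight at most \<open>L\<close> negligible in \<open>S_X\<close>; the last
  condition of \<open>good_y\<close> bounds every single \<open>y j\<close> by \<open>\<delta> n\<close> as soon as \<open>K' \<le> \<delta> n\<close>.\<close>

definition good_x :: "real \<Rightarrow> real \<Rightarrow> real \<Rightarrow> real \<Rightarrow> real \<Rightarrow> nat \<Rightarrow> (nat \<Rightarrow> real) \<Rightarrow> bool" where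
  "good_x a2 \<theta> K L C m x \<longleftrightarrow> (\<Sum>i<m. x i ^ 2) \<le> (1 + \<theta>) * a2 * real m
    \<and> (1 - \<theta>) * a2 * real m \<le> (\<Sum>i<m. if x i \<le> K then x i ^ 2 else 0)
    \<and> L ^ 3 / (3 * \<theta>) * real m \<le> (\<Sum>i<m. if x i \<le> C then x i ^ 3 else 0)"

definition good_y :: "real \<Rightarrow> real \<Rightarrow> real \<Rightarrow> real \<Rightarrow> real \<Rightarrow> real \<Rightarrow> real \<Rightarrow> nat \<Rightarrow> (nat \<Rightarrow> real) \<Rightarrow> bool" where
  "good_y b1 \<theta> K L C \<delta> K' n y \<longleftrightarrow> (\<Sum>j<n. y j) \<le> (1 + \<theta>) * b1 * real n
    \<and> (1 - \<theta>) * b1 * real n \<le> (\<Sum>j<n. if y j \<le> K then y j else 0)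
    \<and> L ^ 2 / (3 * \<theta>) * real n \<le> (\<Sum>j<n. if y j \<le> C then y j ^ 2 else 0)
    \<and> (\<Sum>j<n. if y j \<le> K' then 0 else y j) \<le> \<delta> * real n"

text \<open>Weights up to \<open>L\<close> contribute at most \<open>N * L ^ r\<close>, which is at
  most \<open>e\<close> times the total once the total reaches \<open>L ^ r / e * N\<close>. The
  level \<open>C\<close> serves only to have a truncated sum with finite mean as a witness for that
  size.\<close>

lemma heavy_sum_ge:
  fixes w :: "nat \<Rightarrow> real"
  assumes "0 < e" "0 \<le> L" and w: "\<And>i. i < N \<Longrightarrow> 0 \<le> w i"
    and big: "L ^ r / e * real N \<le> (\<Sum>i<N. if w i \<le> C then w i ^ r else 0)"
  shows "(1 - e) * (\<Sum>i<N. w i ^ r) \<le> (\<Sum>i\<in>{i. i < N \<and> L < w i}. w i ^ r)"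
    and "L ^ r / e * real N \<le> (\<Sum>i<N. w i ^ r)"
proof -
  have "(\<Sum>i<N. if w i \<le> C then w i ^ r else 0) \<le> (\<Sum>i<N. w i ^ r)"
    using w by (intro sum_mono) auto
  with big show tot: "L ^ r / e * real N \<le> (\<Sum>i<N. w i ^ r)" by linarith
  have "(\<Sum>i<N. w i ^ r) = (\<Sum>i\<in>{i. i < N \<and> L < w i}. w i ^ r) + (\<Sum>i\<in>{i. i < N \<and> \<not> L < w i}. w i ^ r)"
    by (subst sum.union_disjoint[symmetric]) (auto intro!: sum.cong)
  moreover have "(\<Sum>i\<in>{i. i < N \<and> \<not> L < w i}. w i ^ r) \<le> e * (\<Sum>i<N. w i ^ r)"
  proof -
    have "(\<Sum>i\<in>{i. i < N \<and> \<not> L < w i}. w i ^ r) \<le> (\<Sum>i\<in>{i. i < N \<and> \<not> L < w i}. L ^ r)"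
      using w by (intro sum_mono power_mono) auto
    also have "\<dots> = real (card {i. i < N \<and> \<not> L < w i}) * L ^ r" by simp
    also have "\<dots> \<le> e * (L ^ r / e * real N)"
    proof -
      have "card {i. i < N \<and> \<not> L < w i} \<le> card {..<N}" by (intro card_mono) auto
      then have "real (card {i. i < N \<and> \<not> L < w i}) * L ^ r \<le> real N * L ^ r"
        using \<open>0 \<le> L\<close> by (intro mult_right_mono) auto
      then show ?thesis using \<open>0 < e\<close> by (simp add: mult.commute)
    qed
    also have "\<dots> \<le> e * (\<Sum>i<N. w i ^ r)" using tot \<open>0 < e\<close> by (intro mult_left_mono) auto
    finally show ?thesis .
  qed
  ultimately show "(1 - e) * (\<Sum>i<N. w i ^ r) \<le> (\<Sum>i\<in>{i. i < N \<and> L < w i}. w i ^ r)"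
    by (simp add: algebra_simps)
qed

text \<open>Identifies \<open>\<kappa> * SY / SX\<close> with the quotient of the two expected
  counts, using \<beta>^(3/2) = (sqrt \<beta>)^3.\<close>

lemma limit_ratio_eq:
  fixes \<beta> a2 b1 SX SY :: real
  assumes "0 < \<beta>" "0 < b1" "0 < SX"
  shows "1 / (1 + \<beta> powr (3/2) * a2 ^ 2 / b1 * SY / SX)
    = SX * (b1 / sqrt \<beta>) ^ 3 / (SX * (b1 / sqrt \<beta>) ^ 3 + SY * (a2 * b1) ^ 2)"
proof -
  have "\<beta> powr (3/2) = (\<beta> powr (1/2)) ^ 3"
    using assms by (simp add: powr_power)
  then have pw: "\<beta> powr (3/2) = sqrt \<beta> ^ 3" using assms by (simp add: powr_half_sqrt)
  have sb: "0 < sqrt \<beta>" using assms by simp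
  have "\<beta> powr (3/2) * a2 ^ 2 / b1 * SY / SX = SY * (a2 * b1) ^ 2 / (SX * (b1 / sqrt \<beta>) ^ 3)"
    unfolding pw using assms sb by (simp add: field_simps power2_eq_square power3_eq_cube)
  moreover have "1 / (1 + b / a) = a / (a + b)" if "0 < a" for a b :: real
  proof -
    have "1 + b / a = (a + b) / a" using that by (simp add: add_divide_distrib)
    then show ?thesis by simp
  qed
  moreover have "0 < SX * (b1 / sqrt \<beta>) ^ 3" using assms sb by simp
  ultimately show ?thesis by simp
qed

text \<open>Checks the assumptions of \<open>good_bipartite\<close> with error
  \<open>3 * \<theta>\<close>: products of two factors 1 + \<theta> or 1 - \<theta> stay within 1 +
  3 \<theta> and 1 - 3 \<theta>, and \<theta> \<le> 1/6 gives the required bound 1/2.\<close>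

lemma clustering_conditional:
  fixes x y :: "nat \<Rightarrow> real"
  assumes params: "0 < a2" "0 < b1" "0 < \<beta>" "0 < \<theta>" "\<theta> \<le> 1 / 6" "0 < K" "K \<le> L" "0 < \<delta>"
    and L: "3 * (2 + 1 / (3 * \<theta>)) \<le> 3 * \<theta> * (L * (b1 / sqrt \<beta>) / 2)"
      "1 + 2 * (1 + (1 + K * (2 * (b1 / sqrt \<beta>))) / (3 * \<theta>)) \<le> 3 * \<theta> * (L * (a2 * b1) / 2)"
    and \<delta>: "2 * K * \<delta> * a2 \<le> 3 * \<theta>" "2 * K * \<delta> \<le> sqrt \<beta>"
    and mn: "0 < m" "0 < n" "(1 - \<theta>) / sqrt \<beta> \<le> real n / sqrt (real m * real n)"
      "real n / sqrt (real m * real n) \<le> (1 + \<theta>) / sqrt \<beta>" "K' \<le> \<delta> * real n"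
      "2 * K ^ 2 * a2 \<le> 3 * \<theta> * real n"
    and nonneg: "\<And>i. 0 \<le> x i" "\<And>j. 0 \<le> y j"
    and gx: "good_x a2 \<theta> K L C m x" and gy: "good_y b1 \<theta> K L C' \<delta> K' n y"
    and \<eta>: "0 < \<eta>" "\<eta> \<le> 1 / 2"
  shows "measure marks {u \<in> space marks. 4 * \<eta> < \<bar>clustering m n (x, y, u)
      - 1 / (1 + \<beta> powr (3/2) * a2 ^ 2 / b1 * (\<Sum>j<n. y j ^ 2) / (\<Sum>i<m. x i ^ 3))\<bar>}
    \<le> 120 * (3 * \<theta>) / \<eta>"
proof -
  define s where "s = sqrt (real m * real n)"
  define p where "p i j = min 1 (x i * y j / s)" for i j
  have s: "0 < s" using mn by (simp add: s_def)
  have s2: "s ^ 2 = real m * real n" by (simp add: s_def)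
  have sb: "0 < sqrt \<beta>" using params by simp
  interpret rb: random_bipartite marks "\<lambda>i j u. edgeH m n (x, y, u) i j" p
    unfolding p_def s_def using nonneg by (rule random_bipartite_marks)
  interpret weighted_bipartite marks "\<lambda>i j u. edgeH m n (x, y, u) i j" p x y s m n
    by unfold_locales (use s nonneg in \<open>auto simp: p_def\<close>)
  have X2: "x2 \<le> (1 + \<theta>) * a2 * real m" and X2K: "(1 - \<theta>) * a2 * real m \<le> (\<Sum>i<m. if x i \<le> K then x i ^ 2 else 0)"
    and X3: "L ^ 3 / (3 * \<theta>) * real m \<le> (\<Sum>i<m. if x i \<le> C then x i ^ 3 else 0)"
    using gx by (auto simp: good_x_def x2_def)
  have Y1: "y1 \<le> (1 + \<theta>) * b1 * real n" and Y1K: "(1 - \<theta>) * b1 * real n \<le> (\<Sum>j<n. if y j \<le> K then y j else 0)"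
    and Y2: "L ^ 2 / (3 * \<theta>) * real n \<le> (\<Sum>j<n. if y j \<le> C' then y j ^ 2 else 0)"
    and Yt: "(\<Sum>j<n. if y j \<le> K' then 0 else y j) \<le> \<delta> * real n"
    using gy by (auto simp: good_y_def y1_def)
  have theta: "(1 + \<theta>) * (1 + \<theta>) \<le> 1 + 3 * \<theta>" "1 - 3 * \<theta> \<le> (1 - \<theta>) * (1 - \<theta>)" "1 + \<theta> \<le> 2"
  proof -
    have "\<theta> * \<theta> \<le> 1 * \<theta>" using params by (intro mult_right_mono) auto
    then show "(1 + \<theta>) * (1 + \<theta>) \<le> 1 + 3 * \<theta>" by (simp add: algebra_simps)
    have "0 \<le> \<theta> * \<theta>" by simp
    then show "1 - 3 * \<theta> \<le> (1 - \<theta>) * (1 - \<theta>)" using params by (simp add: algebra_simps)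
  qed (use params in auto)
  have X2': "x2 \<le> 2 * a2 * real m"
  proof -
    have "(1 + \<theta>) * a2 * real m \<le> 2 * a2 * real m"
      using theta(3) params by (intro mult_right_mono) auto
    then show ?thesis using X2 by linarith
  qed
  have x2s: "x2 / s ^ 2 \<le> 2 * a2 / real n"
    unfolding s2 using X2' mn by (simp add: field_simps)
  have sx2: "K ^ 2 * x2 / s ^ 2 \<le> 3 * \<theta>"
  proof -
    have "K ^ 2 * (x2 / s ^ 2) \<le> K ^ 2 * (2 * a2 / real n)"
      using x2s by (intro mult_left_mono) auto
    also have "\<dots> \<le> 3 * \<theta>" using mn by (simp add: field_simps)
    finally show ?thesis by simp
  qed
  \<comment> \<open>A single square is at most the whole sum \<open>x2\<close>, and
    \<open>K ^ 2 * x2\<close> is at most \<open>s ^ 2\<close>. With \<open>Ky\<close> this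
    deactivates the cap for every link with one weight at most \<open>K\<close>.\<close>
  have Kx: "K * x i \<le> s" if "i < m" for i
  proof -
    have "(K * x i) ^ 2 = K ^ 2 * x i ^ 2" by (simp add: power_mult_distrib)
    also have "\<dots> \<le> K ^ 2 * x2"
      unfolding x2_def using that by (intro mult_left_mono member_le_sum) auto
    also have "\<dots> \<le> 1 * s ^ 2"
    proof -
      have "K ^ 2 * x2 \<le> 3 * \<theta> * s ^ 2" using sx2 s by (simp add: pos_divide_le_eq)
      also have "\<dots> \<le> 1 * s ^ 2" using params by (intro mult_right_mono) auto
      finally show ?thesis .
    qed
    finally have "(K * x i) ^ 2 \<le> s ^ 2" by simp
    then show ?thesis by (rule power2_le_imp_le) (use s in simp)
  qed
  \<comment> \<open>A weight above \<open>K'\<close> is itself a summand of the tail sum, which is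
    at most \<open>\<delta> * n\<close>; a weight up to \<open>K'\<close> is covered by the
    assumption that n is large.\<close>
  have yd: "y j \<le> \<delta> * real n" if "j < n" for j
  proof (cases "y j \<le> K'")
    case False
    have "y j = (if y j \<le> K' then 0 else y j)" using False by simp
    also have "\<dots> \<le> (\<Sum>j<n. if y j \<le> K' then 0 else y j)"
      using that nonneg by (intro member_le_sum) auto
    finally show ?thesis using Yt by linarith
  qed (use mn in linarith)
  have ns: "real n \<le> 2 * s / sqrt \<beta>"
  proof -
    have "real n / s \<le> 2 / sqrt \<beta>"
      using mn(4) divide_right_mono[OF theta(3), of "sqrt \<beta>"] sb unfolding s_def by simp
    then show ?thesis using s by (simp add: pos_divide_le_eq)
  qed
  have Ky: "K * y j \<le> s" if "j < n" for j
  proof -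
    have "K * y j \<le> K * (\<delta> * (2 * s / sqrt \<beta>))"
      using yd[OF that] ns params s by (intro mult_left_mono order_trans[OF yd[OF that]] mult_left_mono) auto
    also have "\<dots> = (2 * K * \<delta>) * s / sqrt \<beta>" by simp
    also have "\<dots> \<le> sqrt \<beta> * s / sqrt \<beta>"
      using \<delta>(2) s sb by (intro divide_right_mono mult_right_mono) auto
    finally show ?thesis using sb by simp
  qed
  interpret truncated_bipartite marks "\<lambda>i j u. edgeH m n (x, y, u) i j" p x y s m n K L
  proof unfold_locales
    show "0 \<le> K" "K \<le> L" using params by auto
    fix i j assume ij: "i < m" "j < n" "x i \<le> K \<or> y j \<le> K"
    have "x i * y j \<le> s"
    proof (cases "x i \<le> K")
      case True
      then have "x i * y j \<le> K * y j" using nonneg by (intro mult_right_mono) auto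
      then show ?thesis using Ky[OF ij(2)] by linarith
    next
      case False
      then have "x i * y j \<le> x i * K" using ij nonneg by (intro mult_left_mono) auto
      then show ?thesis using Kx[OF ij(1)] by (simp add: mult.commute)
    qed
    then show "p i j = x i * y j / s" using s by (simp add: p_def)
  qed
  have y1K_eq: "(\<Sum>j<n. if y j \<le> K then y j else 0) = y1K"
    unfolding y1K_def light_vertices_def by (subst sum.inter_filter[symmetric]) (auto intro!: sum.cong)
  have x2K_eq: "(\<Sum>i<m. if x i \<le> K then x i ^ 2 else 0) = x2K"
    unfolding x2K_def light_attrs_def by (subst sum.inter_filter[symmetric]) (auto intro!: sum.cong)
  have L0: "0 < L" using params by linarith
  interpret good_bipartite marks "\<lambda>i j u. edgeH m n (x, y, u) i j" p x y s m n K L "3 * \<theta>" "b1 / sqrt \<beta>" "a2 * b1"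
  proof unfold_locales
    show "y1 / s \<le> (1 + 3 * \<theta>) * (b1 / sqrt \<beta>)"
    proof -
      have "y1 / s \<le> (1 + \<theta>) * b1 * (real n / s)"
        using divide_right_mono[OF Y1, of s] s by simp
      also have "\<dots> \<le> (1 + \<theta>) * b1 * ((1 + \<theta>) / sqrt \<beta>)"
        using mn(4) params by (intro mult_left_mono) (auto simp: s_def)
      also have "\<dots> = ((1 + \<theta>) * (1 + \<theta>)) * (b1 / sqrt \<beta>)" by simp
      also have "\<dots> \<le> (1 + 3 * \<theta>) * (b1 / sqrt \<beta>)"
        using theta params sb by (intro mult_right_mono) auto
      finally show ?thesis .
    qed
    show "x2 * y1 / s\<^sup>2 \<le> (1 + 3 * \<theta>) * (a2 * b1)"
    proof -
      have "x2 * y1 / s\<^sup>2 \<le> ((1 + \<theta>) * a2 * real m) * ((1 + \<theta>) * b1 * real n) / s\<^sup>2"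
        using X2 Y1 moments_nonneg params by (intro divide_right_mono mult_mono) auto
      also have "\<dots> = ((1 + \<theta>) * (1 + \<theta>)) * (a2 * b1)"
        unfolding s2 using mn by simp
      also have "\<dots> \<le> (1 + 3 * \<theta>) * (a2 * b1)"
        using theta params by (intro mult_right_mono) auto
      finally show ?thesis .
    qed
    show "(1 - 3 * \<theta>) * (b1 / sqrt \<beta>) \<le> y1K / s"
    proof -
      have "(1 - 3 * \<theta>) * (b1 / sqrt \<beta>) \<le> ((1 - \<theta>) * (1 - \<theta>)) * (b1 / sqrt \<beta>)"
        using theta params sb by (intro mult_right_mono) auto
      also have "\<dots> = (1 - \<theta>) * b1 * ((1 - \<theta>) / sqrt \<beta>)" by simp
      also have "\<dots> \<le> (1 - \<theta>) * b1 * (real n / s)"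
        using mn(3) params by (intro mult_left_mono) (auto simp: s_def)
      also have "\<dots> \<le> y1K / s"
        using divide_right_mono[OF Y1K[unfolded y1K_eq], of s] s by simp
      finally show ?thesis .
    qed
    show "(1 - 3 * \<theta>) * (a2 * b1) \<le> x2K * y1K / s\<^sup>2"
    proof -
      have "(1 - 3 * \<theta>) * (a2 * b1) \<le> ((1 - \<theta>) * (1 - \<theta>)) * (a2 * b1)"
        using theta params by (intro mult_right_mono) auto
      also have "\<dots> = ((1 - \<theta>) * a2 * real m) * ((1 - \<theta>) * b1 * real n) / s\<^sup>2"
        unfolding s2 using mn by simp
      also have "\<dots> \<le> x2K * y1K / s\<^sup>2"
        using X2K[unfolded x2K_eq] Y1K[unfolded y1K_eq] truncated_nonneg params
        by (intro divide_right_mono mult_mono) auto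
      finally show ?thesis .
    qed
    show "(1 - 3 * \<theta>) * x3 \<le> (\<Sum>i\<in>heavy_attrs. x i ^ 3)"
      unfolding x3_def heavy_attrs_def using X3 params L0 nonneg by (intro heavy_sum_ge(1)) auto
    show "(1 - 3 * \<theta>) * y2 \<le> (\<Sum>j\<in>heavy_vertices. (y j)\<^sup>2)"
      unfolding y2_def heavy_vertices_def using Y2 params L0 nonneg by (intro heavy_sum_ge(1)) auto
    show "K\<^sup>2 * x2 / s\<^sup>2 \<le> 3 * \<theta>" by (rule sx2)
    show "K ^ 3 * x3 / s ^ 3 \<le> 3 * \<theta>"
    proof -
      \<comment> \<open>Trading one factor \<open>K * x i\<close> for \<open>s\<close> reduces the
        third-moment condition to the second-moment condition \<open>sx2\<close>, so that no upper
        bound on \<open>S_X\<close> from its law is required.\<close>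
      have "K * x3 \<le> s * x2"
        unfolding x3_def x2_def sum_distrib_left
      proof (rule sum_mono)
        fix i assume "i \<in> {..<m}"
        then have "(K * x i) * x i ^ 2 \<le> s * x i ^ 2" using Kx by (intro mult_right_mono) auto
        then show "K * x i ^ 3 \<le> s * x i ^ 2" by (simp add: power3_eq_cube power2_eq_square mult.assoc)
      qed
      then have "K ^ 2 * (K * x3) / s ^ 3 \<le> K ^ 2 * (s * x2) / s ^ 3"
        using s by (intro divide_right_mono mult_left_mono) auto
      also have "\<dots> = K ^ 2 * x2 / s ^ 2" using s by (simp add: power3_eq_cube power2_eq_square)
      finally show ?thesis using sx2 by (simp add: power3_eq_cube power2_eq_square mult.assoc)
    qed
    show "K * y j * x2 / s\<^sup>2 \<le> 3 * \<theta>" if "j < n" for j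
    proof -
      have "K * y j * x2 / s\<^sup>2 = (K * y j) * (x2 / s\<^sup>2)" by simp
      also have "\<dots> \<le> (K * (\<delta> * real n)) * (2 * a2 / real n)"
        using yd[OF that] x2s params nonneg moments_nonneg by (intro mult_mono) auto
      also have "\<dots> = 2 * K * \<delta> * a2" using mn by simp
      finally show ?thesis using \<delta>(1) by linarith
    qed
    show "3 * (2 + 1 / (3 * \<theta>)) \<le> 3 * \<theta> * (L * (b1 / sqrt \<beta>) / 2)"
      "1 + 2 * (1 + (1 + K * (2 * (b1 / sqrt \<beta>))) / (3 * \<theta>)) \<le> 3 * \<theta> * (L * (a2 * b1) / 2)"
      by (fact L)+
  qed (use params sb in auto)
  \<comment> \<open>Positivity of \<open>x3\<close> keeps the quotient \<open>SY / SX\<close> away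
    from division by zero and provides \<open>0 < A\<close> for the ratio estimate.\<close>
  have "0 < L ^ 3 / (3 * \<theta>) * real m" using L0 params mn by simp
  also have "\<dots> \<le> x3"
    unfolding x3_def using X3 params L0 nonneg by (intro heavy_sum_ge(2)) auto
  finally have x3: "0 < x3" .
  have adj: "adjG m n (x, y, u) j k \<longleftrightarrow> j \<noteq> k \<and> adj j k u" for u j k
    by (auto simp: adjG_def adj_def)
  have tri: "6 * real (num_triangles m n (x, y, u)) = triangles u" for u
    unfolding num_triangles_eq_sum triangles_def by (intro sum.cong) (auto simp: adj)
  have che: "2 * real (num_paths2 m n (x, y, u)) = cherries u" for u
    unfolding num_paths2_eq_sum cherries_def by (intro sum.cong) (auto simp: adj)
  have clu: "clustering m n (x, y, u) = triangles u / cherries u" for u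
    unfolding clustering_def tri[symmetric] che[symmetric] by simp
  have "1 / (1 + \<beta> powr (3/2) * a2 ^ 2 / b1 * (\<Sum>j<n. y j ^ 2) / (\<Sum>i<m. x i ^ 3)) = A / (A + B)"
    using limit_ratio_eq[of \<beta> b1 x3 a2 y2] params x3 unfolding A_def B_def x3_def y2_def by simp
  moreover have "0 < A" using x3 params sb by (simp add: A_def)
  ultimately show ?thesis
    unfolding clu using prob_ratio_far[OF _ \<eta>] by simp
qed

section \<open>Truncated moments of the weight distributions\<close>

lemma truncated_integral_tendsto:
  fixes f :: "real \<Rightarrow> real"
  assumes sets: "sets P = sets borel" and int: "integrable P f"
  shows "integrable P (\<lambda>x. if x \<le> t then f x else 0)"
    and "(\<lambda>t::nat. \<integral>x. (if x \<le> real t then f x else 0) \<partial>P) \<longlonglongrightarrow> (\<integral>x. f x \<partial>P)"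
proof -
  have f [measurable]: "f \<in> borel_measurable P" using int by auto
  have id [measurable]: "(\<lambda>x. x) \<in> borel_measurable P" using sets by (simp cong: measurable_cong_sets)
  have m: "(\<lambda>x. if x \<le> t then f x else 0) \<in> borel_measurable P" for t by measurable
  show "integrable P (\<lambda>x. if x \<le> t then f x else 0)"
    using int m by (rule Bochner_Integration.integrable_bound) auto
  show "(\<lambda>t::nat. \<integral>x. (if x \<le> real t then f x else 0) \<partial>P) \<longlonglongrightarrow> (\<integral>x. f x \<partial>P)"
  proof (rule integral_dominated_convergence[where w = "\<lambda>x. \<bar>f x\<bar>"])
    show "AE x in P. (\<lambda>t. if x \<le> real t then f x else 0) \<longlonglongrightarrow> f x"
    proof (rule AE_I2, rule tendsto_eventually)
      fix x :: real
      show "\<forall>\<^sub>F t in sequentially. (if x \<le> real t then f x else 0) = f x"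
        using eventually_ge_at_top[of "nat \<lceil>x\<rceil>"]
        by eventually_elim (auto simp: nat_ceiling_le_eq)
    qed
  qed (use int m in auto)
qed

text \<open>If all truncated moments were at most \<open>c\<close>, monotone convergence would bound
  the full moment by \<open>c\<close>. Truncation at \<open>t\<close> leaves an almost surely
  bounded function, hence an integrable one.\<close>

lemma truncated_moment_unbounded:
  fixes P :: "real measure"
  assumes "prob_space P" and sets: "sets P = sets borel" and nonneg: "AE x in P. 0 \<le> x"
    and inf: "(\<integral>\<^sup>+ x. ennreal (x ^ r) \<partial>P) = \<infinity>"
  shows "\<exists>t::nat. integrable P (\<lambda>x. if x \<le> real t then x ^ r else 0)
    \<and> c < (\<integral>x. (if x \<le> real t then x ^ r else 0) \<partial>P)"
proof -
  interpret prob_space P by fact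
  have id [measurable]: "(\<lambda>x. x) \<in> borel_measurable P" using sets by (simp cong: measurable_cong_sets)
  let ?g = "\<lambda>(t::nat) x. if x \<le> real t then x ^ r else (0::real)"
  have int: "integrable P (?g t)" for t
  proof (rule integrable_const_bound[where B = "real t ^ r"])
    show "AE x in P. norm (?g t x) \<le> real t ^ r"
      using nonneg by eventually_elim (auto intro: power_mono)
  qed measurable
  have "\<exists>t. c < (\<integral>x. ?g t x \<partial>P)"
  proof (rule ccontr)
    assume "\<not> (\<exists>t. c < (\<integral>x. ?g t x \<partial>P))"
    then have le: "(\<integral>x. ?g t x \<partial>P) \<le> c" for t by (auto simp: not_less)
    have "ennreal (x ^ r) = (SUP t. ennreal (?g t x))" for x
    proof (rule antisym)
      have "ennreal (x ^ r) = ennreal (?g (nat \<lceil>x\<rceil>) x)"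
        using real_nat_ceiling_ge[of x] by simp
      also have "\<dots> \<le> (SUP t. ennreal (?g t x))" by (rule SUP_upper) simp
      finally show "ennreal (x ^ r) \<le> (SUP t. ennreal (?g t x))" .
    qed (auto intro!: SUP_least)
    then have "(\<integral>\<^sup>+ x. ennreal (x ^ r) \<partial>P) = (\<integral>\<^sup>+ x. (SUP t. ennreal (?g t x)) \<partial>P)" by simp
    \<comment> \<open>Negative values become 0 under \<open>ennreal\<close>, so the truncations
      increase at every point although nonnegativity holds only almost everywhere.\<close>
    also have "\<dots> = (SUP t. \<integral>\<^sup>+ x. ennreal (?g t x) \<partial>P)"
      by (rule nn_integral_monotone_convergence_SUP) (auto simp: incseq_def le_fun_def)
    also have "\<dots> \<le> ennreal c"
    proof (rule SUP_least)
      fix t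
      have "(\<integral>\<^sup>+ x. ennreal (?g t x) \<partial>P) = ennreal (\<integral>x. ?g t x \<partial>P)"
        using nonneg by (intro nn_integral_eq_integral int) auto
      also have "\<dots> \<le> ennreal c" using le by (rule ennreal_leI)
      finally show "(\<integral>\<^sup>+ x. ennreal (?g t x) \<partial>P) \<le> ennreal c" .
    qed
    finally show False using inf by (simp add: top_unique)
  qed
  then show ?thesis using int by blast
qed

text \<open>A vanishing moment would make the weight 0 almost surely and with it every positive
  moment. This supplies \<open>0 < a2\<close> and \<open>0 < b1\<close>, which the theorem does not
  assume.\<close>

lemma integral_pos_if_moment_infinite:
  fixes P :: "real measure"
  assumes nonneg: "AE x in P. 0 \<le> x" and sets: "sets P = sets borel"
    and int: "integrable P (\<lambda>x. x ^ q)" and inf: "(\<integral>\<^sup>+ x. ennreal (x ^ r) \<partial>P) = \<infinity>" and "0 < r"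
  shows "0 < (\<integral>x. x ^ q \<partial>P)"
proof (rule ccontr)
  have id [measurable]: "(\<lambda>x. x) \<in> borel_measurable P" using sets by (simp cong: measurable_cong_sets)
  have nn: "AE x in P. 0 \<le> x ^ q" using nonneg by eventually_elim simp
  assume "\<not> 0 < (\<integral>x. x ^ q \<partial>P)"
  moreover have "0 \<le> (\<integral>x. x ^ q \<partial>P)" using nn by (rule integral_nonneg_AE)
  ultimately have "(\<integral>x. x ^ q \<partial>P) = 0" by simp
  then have "AE x in P. x ^ q = 0" using integral_nonneg_eq_0_iff_AE[OF int nn] by simp
  then have "AE x in P. ennreal (x ^ r) = 0"
    by eventually_elim (use \<open>0 < r\<close> in auto)
  then have "(\<integral>\<^sup>+ x. ennreal (x ^ r) \<partial>P) = 0" by (subst nn_integral_0_iff_AE) auto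
  then show False using inf by simp
qed

section \<open>Measurability in the model and conditioning on the weights\<close>

context
  fixes PX PY :: "real measure"
  assumes PX: "prob_space PX" "sets PX = sets borel" and PY: "prob_space PY" "sets PY = sets borel"
begin

lemma measurable_model_components [measurable]:
  "(\<lambda>\<omega>. fst \<omega> i) \<in> borel_measurable (model PX PY)"
  "(\<lambda>\<omega>. fst (snd \<omega>) j) \<in> borel_measurable (model PX PY)"
  "(\<lambda>\<omega>. snd (snd \<omega>) i j) \<in> borel_measurable (model PX PY)"
proof -
  have cx: "(\<lambda>x. x i) \<in> borel_measurable (PiM UNIV (\<lambda>_. PX))" for i
    using measurable_component_singleton[of i UNIV "\<lambda>_. PX"] PX(2) by (simp cong: measurable_cong_sets)
  have cy: "(\<lambda>x. x i) \<in> borel_measurable (PiM UNIV (\<lambda>_. PY))" for i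
    using measurable_component_singleton[of i UNIV "\<lambda>_. PY"] PY(2) by (simp cong: measurable_cong_sets)
  show "(\<lambda>\<omega>. fst \<omega> i) \<in> borel_measurable (model PX PY)"
    unfolding model_def by (rule measurable_compose[OF measurable_fst cx])
  show "(\<lambda>\<omega>. fst (snd \<omega>) j) \<in> borel_measurable (model PX PY)"
    unfolding model_def
    by (rule measurable_compose[OF measurable_snd measurable_compose[OF measurable_fst cy]])
  show "(\<lambda>\<omega>. snd (snd \<omega>) i j) \<in> borel_measurable (model PX PY)"
    unfolding model_def by (intro measurable_marks) measurable
qed

lemma pred_edgeH [measurable]: "Measurable.pred (model PX PY) (\<lambda>\<omega>. edgeH m n \<omega> i j)"
  unfolding edgeH_def case_prod_beta by measurable

lemma pred_adjG [measurable]: "Measurable.pred (model PX PY) (\<lambda>\<omega>. adjG m n \<omega> a b)"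
  unfolding adjG_def by measurable

text \<open>In the form with ordered triples both counts are finite sums of indicators, which
  reduces the claim to measurability of adjacency.\<close>

lemma measurable_clustering [measurable]: "clustering m n \<in> borel_measurable (model PX PY)"
proof -
  have "clustering m n = (\<lambda>\<omega>. (6 * real (num_triangles m n \<omega>)) / (2 * real (num_paths2 m n \<omega>)))"
    by (auto simp: clustering_def)
  moreover have "(\<lambda>\<omega>. 6 * real (num_triangles m n \<omega>)) \<in> borel_measurable (model PX PY)"
    "(\<lambda>\<omega>. 2 * real (num_paths2 m n \<omega>)) \<in> borel_measurable (model PX PY)"
    unfolding num_triangles_eq_sum num_paths2_eq_sum case_prod_beta
    by (intro borel_measurable_sum; measurable)+
  ultimately show ?thesis by (simp only: borel_measurable_divide)
qed

text \<open>Integrates out the marks first: the conditional probability is at most 1 for weights in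
  \<open>G1\<close> or \<open>G2\<close> and at most \<open>q\<close> otherwise. The condition is
  imposed almost everywhere because the weights are nonnegative only almost surely.\<close>

lemma measure_model_le:
  assumes "G1 \<in> sets (PiM UNIV (\<lambda>_. PX))" "G2 \<in> sets (PiM UNIV (\<lambda>_. PY))" "S \<in> sets (model PX PY)" "0 \<le> q"
    and cond: "AE x in PiM UNIV (\<lambda>_. PX). AE y in PiM UNIV (\<lambda>_. PY).
      x \<notin> G1 \<longrightarrow> y \<notin> G2 \<longrightarrow> measure marks {u \<in> space marks. (x, y, u) \<in> S} \<le> q"
  shows "measure (model PX PY) S
    \<le> measure (PiM UNIV (\<lambda>_. PX)) G1 + measure (PiM UNIV (\<lambda>_. PY)) G2 + q"
proof -
  let ?X = "PiM UNIV (\<lambda>_. PX) :: (nat \<Rightarrow> real) measure" and ?Y = "PiM UNIV (\<lambda>_. PY) :: (nat \<Rightarrow> real) measure"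
  interpret X: prob_space ?X by (intro prob_space_PiM PX)
  interpret Y: prob_space ?Y by (intro prob_space_PiM PY)
  interpret U: prob_space marks by (rule prob_space_marks)
  interpret YU: pair_prob_space ?Y marks ..
  interpret XYU: pair_prob_space ?X "?Y \<Otimes>\<^sub>M marks" ..
  have S: "S \<in> sets (?X \<Otimes>\<^sub>M (?Y \<Otimes>\<^sub>M marks))" using assms(3) by (simp add: model_def)
  have "emeasure (model PX PY) S = (\<integral>\<^sup>+ x. emeasure (?Y \<Otimes>\<^sub>M marks) (Pair x -` S) \<partial>?X)"
    unfolding model_def using S by (rule YU.emeasure_pair_measure_alt)
  also have "\<dots> = (\<integral>\<^sup>+ x. \<integral>\<^sup>+ y. emeasure marks (Pair y -` Pair x -` S) \<partial>?Y \<partial>?X)"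
    by (intro nn_integral_cong U.emeasure_pair_measure_alt sets_Pair1[OF S])
  also have "\<dots> \<le> (\<integral>\<^sup>+ x. \<integral>\<^sup>+ y. indicator G1 x + (indicator G2 y + ennreal q) \<partial>?Y \<partial>?X)"
  proof (rule nn_integral_mono_AE)
    show "AE x in ?X. (\<integral>\<^sup>+ y. emeasure marks (Pair y -` Pair x -` S) \<partial>?Y)
        \<le> (\<integral>\<^sup>+ y. indicator G1 x + (indicator G2 y + ennreal q) \<partial>?Y)"
      using cond
    proof eventually_elim
      case (elim x)
      then show ?case
      proof (intro nn_integral_mono_AE, eventually_elim)
        case (elim y)
        have 1: "emeasure marks (Pair y -` Pair x -` S) \<le> 1 + z" for z
          using U.emeasure_le_1 by (rule add_increasing2[OF zero_le])
        have 2: "emeasure marks (Pair y -` Pair x -` S) \<le> ennreal q" if "x \<notin> G1" "y \<notin> G2"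
        proof -
          have "Pair y -` Pair x -` S \<in> sets marks" by (intro sets_Pair1[OF sets_Pair1[OF S]])
          then have "Pair y -` Pair x -` S \<subseteq> space marks" by (rule sets.sets_into_space)
          then have "Pair y -` Pair x -` S = {u \<in> space marks. (x, y, u) \<in> S}" by auto
          then show ?thesis using elim that by (simp add: U.emeasure_eq_measure ennreal_leI)
        qed
        show ?case
          using 1 2 by (cases "x \<in> G1"; cases "y \<in> G2") simp_all
      qed
    qed
  qed
  also have "\<dots> = emeasure ?X G1 + (emeasure ?Y G2 + ennreal q)"
    using assms by (simp add: nn_integral_add X.emeasure_space_1 Y.emeasure_space_1)
  also have "\<dots> = ennreal (measure ?X G1 + measure ?Y G2 + q)"
    using assms(4) by (simp add: X.emeasure_eq_measure Y.emeasure_eq_measure ennreal_plus[symmetric] add.assoc del: ennreal_plus)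
  finally have le: "emeasure (model PX PY) S \<le> ennreal (measure ?X G1 + measure ?Y G2 + q)" .
  show ?thesis
    unfolding measure_def[of "model PX PY"] using le assms(4) by (intro enn2real_leI) auto
qed

end

section \<open>The weights are good with probability tending to 1\<close>

lemma tendsto_measure_Un:
  assumes "\<And>N. A N \<in> sets W" "\<And>N. B N \<in> sets W"
    and "(\<lambda>N. measure W (A N)) \<longlonglongrightarrow> 0" "(\<lambda>N. measure W (B N)) \<longlonglongrightarrow> 0"
  shows "(\<lambda>N. measure W (A N \<union> B N)) \<longlonglongrightarrow> 0"
proof (rule tendsto_sandwich[where f = "\<lambda>_. 0"])
  show "\<forall>\<^sub>F N in sequentially. measure W (A N \<union> B N) \<le> measure W (A N) + measure W (B N)"
    using assms by (intro always_eventually allI measure_Un_le)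
  show "(\<lambda>N. measure W (A N) + measure W (B N)) \<longlonglongrightarrow> 0"
    using tendsto_add[OF assms(3,4)] by simp
qed auto

text \<open>The complement is a union of three deviation events. Each threshold differs strictly
  from the relevant mean, so the one-sided laws of large numbers apply; for the third power,
  \<open>C\<close> makes a truncated mean exceed the threshold.\<close>

lemma not_good_x_tendsto:
  fixes PX :: "real measure"
  assumes P: "prob_space PX" "sets PX = sets borel" and int: "integrable PX (\<lambda>x. x ^ 2)"
    and a2: "a2 = (\<integral>x. x ^ 2 \<partial>PX)" "0 < a2" and "0 < \<theta>"
    and K: "(1 - \<theta>) * a2 < (\<integral>x. (if x \<le> K then x ^ 2 else 0) \<partial>PX)"
    and C: "integrable PX (\<lambda>x. if x \<le> C then x ^ 3 else 0)" "L ^ 3 / (3 * \<theta>) < (\<integral>x. (if x \<le> C then x ^ 3 else 0) \<partial>PX)"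
  shows "\<And>N. {x \<in> space (PiM UNIV (\<lambda>_. PX)). \<not> good_x a2 \<theta> K L C N x} \<in> sets (PiM UNIV (\<lambda>_. PX))"
    and "(\<lambda>N. measure (PiM UNIV (\<lambda>_. PX)) {x \<in> space (PiM UNIV (\<lambda>_. PX)). \<not> good_x a2 \<theta> K L C N x}) \<longlonglongrightarrow> 0"
proof -
  let ?W = "PiM UNIV (\<lambda>_. PX) :: (nat \<Rightarrow> real) measure"
  have id [measurable]: "(\<lambda>x. x) \<in> borel_measurable PX" using P(2) by (simp cong: measurable_cong_sets)
  have comp [measurable]: "(\<lambda>x. x i) \<in> borel_measurable ?W" for i
    using measurable_component_singleton[of i UNIV "\<lambda>_. PX"] P(2) by (simp cong: measurable_cong_sets)
  let ?A = "\<lambda>N. {x \<in> space ?W. (1 + \<theta>) * a2 * real N < (\<Sum>i<N. x i ^ 2)}"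
  let ?B = "\<lambda>N. {x \<in> space ?W. (\<Sum>i<N. if x i \<le> K then x i ^ 2 else 0) < (1 - \<theta>) * a2 * real N}"
  let ?C = "\<lambda>N. {x \<in> space ?W. (\<Sum>i<N. if x i \<le> C then x i ^ 3 else 0) < L ^ 3 / (3 * \<theta>) * real N}"
  have eq: "{x \<in> space ?W. \<not> good_x a2 \<theta> K L C N x} = ?A N \<union> (?B N \<union> ?C N)" for N
    by (auto simp: good_x_def not_le)
  show "\<And>N. {x \<in> space ?W. \<not> good_x a2 \<theta> K L C N x} \<in> sets ?W"
    unfolding eq by measurable
  show "(\<lambda>N. measure ?W {x \<in> space ?W. \<not> good_x a2 \<theta> K L C N x}) \<longlonglongrightarrow> 0"
    unfolding eq
  proof (intro tendsto_measure_Un)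
    show "(\<lambda>N. measure ?W (?A N)) \<longlonglongrightarrow> 0"
      using P(1) int a2 \<open>0 < \<theta>\<close> by (intro weak_lln_upper) auto
    show "(\<lambda>N. measure ?W (?B N)) \<longlonglongrightarrow> 0"
      using P(1) truncated_integral_tendsto(1)[OF P(2) int] K by (intro weak_lln_lower) auto
    show "(\<lambda>N. measure ?W (?C N)) \<longlonglongrightarrow> 0"
      using P(1) C by (intro weak_lln_lower) auto
  qed measurable
qed

text \<open>As for the attributes, with one more event: the part of the weights above
  \<open>K'\<close> has mean below \<delta>, so its sum rarely exceeds
  \<open>\<delta> * N\<close>.\<close>

lemma not_good_y_tendsto:
  fixes PY :: "real measure"
  assumes P: "prob_space PY" "sets PY = sets borel" and int: "integrable PY (\<lambda>y. y)"
    and b1: "b1 = (\<integral>y. y \<partial>PY)" "0 < b1" and "0 < \<theta>"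
    and K: "(1 - \<theta>) * b1 < (\<integral>y. (if y \<le> K then y else 0) \<partial>PY)"
    and C: "integrable PY (\<lambda>y. if y \<le> C then y ^ 2 else 0)" "L ^ 2 / (3 * \<theta>) < (\<integral>y. (if y \<le> C then y ^ 2 else 0) \<partial>PY)"
    and K': "b1 - (\<integral>y. (if y \<le> K' then y else 0) \<partial>PY) < \<delta>"
  shows "\<And>N. {y \<in> space (PiM UNIV (\<lambda>_. PY)). \<not> good_y b1 \<theta> K L C \<delta> K' N y} \<in> sets (PiM UNIV (\<lambda>_. PY))"
    and "(\<lambda>N. measure (PiM UNIV (\<lambda>_. PY)) {y \<in> space (PiM UNIV (\<lambda>_. PY)). \<not> good_y b1 \<theta> K L C \<delta> K' N y}) \<longlonglongrightarrow> 0"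
proof -
  let ?W = "PiM UNIV (\<lambda>_. PY) :: (nat \<Rightarrow> real) measure"
  have id [measurable]: "(\<lambda>x. x) \<in> borel_measurable PY" using P(2) by (simp cong: measurable_cong_sets)
  have comp [measurable]: "(\<lambda>x. x i) \<in> borel_measurable ?W" for i
    using measurable_component_singleton[of i UNIV "\<lambda>_. PY"] P(2) by (simp cong: measurable_cong_sets)
  note trunc = truncated_integral_tendsto(1)[OF P(2) int]
  have tail: "(\<lambda>y. if y \<le> K' then 0 else y) = (\<lambda>y. y - (if y \<le> K' then y else 0))" by auto
  have tail_int: "integrable PY (\<lambda>y. if y \<le> K' then 0 else y)"
    unfolding tail using int trunc by (rule Bochner_Integration.integrable_diff)
  have tail_val: "(\<integral>y. (if y \<le> K' then 0 else y) \<partial>PY) = b1 - (\<integral>y. (if y \<le> K' then y else 0) \<partial>PY)"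
    unfolding tail b1 using int trunc by (rule Bochner_Integration.integral_diff)
  let ?A = "\<lambda>N. {y \<in> space ?W. (1 + \<theta>) * b1 * real N < (\<Sum>j<N. y j)}"
  let ?B = "\<lambda>N. {y \<in> space ?W. (\<Sum>j<N. if y j \<le> K then y j else 0) < (1 - \<theta>) * b1 * real N}"
  let ?C = "\<lambda>N. {y \<in> space ?W. (\<Sum>j<N. if y j \<le> C then y j ^ 2 else 0) < L ^ 2 / (3 * \<theta>) * real N}"
  let ?D = "\<lambda>N. {y \<in> space ?W. \<delta> * real N < (\<Sum>j<N. if y j \<le> K' then 0 else y j)}"
  have eq: "{y \<in> space ?W. \<not> good_y b1 \<theta> K L C \<delta> K' N y} = ?A N \<union> (?B N \<union> (?C N \<union> ?D N))" for N
    by (auto simp: good_y_def not_le)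
  show "\<And>N. {y \<in> space ?W. \<not> good_y b1 \<theta> K L C \<delta> K' N y} \<in> sets ?W"
    unfolding eq by measurable
  show "(\<lambda>N. measure ?W {y \<in> space ?W. \<not> good_y b1 \<theta> K L C \<delta> K' N y}) \<longlonglongrightarrow> 0"
    unfolding eq
  proof (intro tendsto_measure_Un)
    show "(\<lambda>N. measure ?W (?A N)) \<longlonglongrightarrow> 0"
      using P(1) int b1 \<open>0 < \<theta>\<close> by (intro weak_lln_upper) auto
    show "(\<lambda>N. measure ?W (?B N)) \<longlonglongrightarrow> 0"
      using P(1) trunc K by (intro weak_lln_lower) auto
    show "(\<lambda>N. measure ?W (?C N)) \<longlonglongrightarrow> 0"
      using P(1) C by (intro weak_lln_lower) auto
    show "(\<lambda>N. measure ?W (?D N)) \<longlonglongrightarrow> 0"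
      using P(1) tail_int tail_val K' by (intro weak_lln_upper) auto
  qed measurable
qed

lemma ratio_sqrt_tendsto:
  fixes m n :: "nat \<Rightarrow> nat"
  assumes "0 < \<beta>" "filterlim n at_top sequentially" "(\<lambda>k. real (m k) / real (n k)) \<longlonglongrightarrow> \<beta>"
  shows "(\<lambda>k. real (n k) / sqrt (real (m k) * real (n k))) \<longlonglongrightarrow> 1 / sqrt \<beta>"
proof (rule Lim_transform_eventually)
  show "(\<lambda>k. 1 / sqrt (real (m k) / real (n k))) \<longlonglongrightarrow> 1 / sqrt \<beta>"
    using assms by (intro tendsto_intros) auto
  have "\<forall>\<^sub>F k in sequentially. 1 \<le> n k"
    using assms(2) by (auto simp: filterlim_at_top)
  then show "\<forall>\<^sub>F k in sequentially. 1 / sqrt (real (m k) / real (n k)) = real (n k) / sqrt (real (m k) * real (n k))"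
  proof eventually_elim
    case (elim k)
    have "real (m k) * real (n k) = real (m k) / real (n k) * real (n k) ^ 2"
      using elim by (simp add: power2_eq_square)
    then have "sqrt (real (m k) * real (n k)) = sqrt (real (m k) / real (n k) * real (n k) ^ 2)"
      by (rule arg_cong)
    also have "\<dots> = sqrt (real (m k) / real (n k)) * sqrt (real (n k) ^ 2)"
      by (rule real_sqrt_mult)
    finally show ?case using elim by simp
  qed
qed

lemma prob_space_model:
  assumes "prob_space PX" "prob_space PY"
  shows "prob_space (model PX PY)"
proof -
  interpret X: prob_space "PiM UNIV (\<lambda>_. PX) :: (nat \<Rightarrow> real) measure" by (intro prob_space_PiM assms)
  interpret Y: prob_space "PiM UNIV (\<lambda>_. PY) :: (nat \<Rightarrow> real) measure" by (intro prob_space_PiM assms)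
  interpret U: prob_space marks by (rule prob_space_marks)
  interpret YU: pair_prob_space "PiM UNIV (\<lambda>_. PY) :: (nat \<Rightarrow> real) measure" marks ..
  interpret XYU: pair_prob_space "PiM UNIV (\<lambda>_. PX) :: (nat \<Rightarrow> real) measure"
    "(PiM UNIV (\<lambda>_. PY) :: (nat \<Rightarrow> real) measure) \<Otimes>\<^sub>M marks" ..
  show ?thesis unfolding model_def by unfold_locales
qed

theorem theorem3:
  fixes PX PY :: "real measure" and \<beta> :: real and m n :: "nat \<Rightarrow> nat"
  assumes "prob_space PX" "prob_space PY"
    and "sets PX = sets borel" "sets PY = sets borel"
    and "AE x in PX. 0 \<le> x" "AE y in PY. 0 \<le> y"
    and "\<beta> > 0"
    and "filterlim m at_top sequentially" "filterlim n at_top sequentially"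
    and "(\<lambda>k. real (m k) / real (n k)) \<longlonglongrightarrow> \<beta>"
    and "(\<integral>\<^sup>+ x. ennreal (x ^ 2) \<partial>PX) < \<infinity>"
    and "(\<integral>\<^sup>+ x. ennreal (x ^ 3) \<partial>PX) = \<infinity>"
    and "(\<integral>\<^sup>+ y. ennreal y \<partial>PY) < \<infinity>"
    and "(\<integral>\<^sup>+ y. ennreal (y ^ 2) \<partial>PY) = \<infinity>"
  shows "\<forall>\<epsilon>>0. (\<lambda>k. measure (model PX PY)
           {\<omega> \<in> space (model PX PY).
              (let a2 = (\<integral>x. x ^ 2 \<partial>PX); b1 = (\<integral>y. y \<partial>PY);
                   \<kappa> = \<beta> powr (3/2) * a2 ^ 2 / b1;
                   SX = (\<Sum>i<m k. (fst \<omega>) i ^ 3);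
                   SY = (\<Sum>j<n k. (fst (snd \<omega>)) j ^ 2)
               in \<bar>clustering (m k) (n k) \<omega> - 1 / (1 + \<kappa> * SY / SX)\<bar> > \<epsilon>)})
         \<longlonglongrightarrow> 0"
proof (intro allI impI tendstoI)
  fix e \<eta>\<^sub>0 :: real assume e: "0 < e" and \<eta>\<^sub>0: "0 < \<eta>\<^sub>0"
  let ?X = "PiM UNIV (\<lambda>_. PX) :: (nat \<Rightarrow> real) measure" and ?Y = "PiM UNIV (\<lambda>_. PY) :: (nat \<Rightarrow> real) measure"
  have idX: "(\<lambda>x. x) \<in> borel_measurable PX" and idY: "(\<lambda>x. x) \<in> borel_measurable PY"
    using assms(3,4) by (simp_all cong: measurable_cong_sets)
  have intX: "integrable PX (\<lambda>x. x ^ 2)"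
    using assms(11) idX by (intro integrableI_nonneg) auto
  have intY: "integrable PY (\<lambda>y. y)"
    using assms(6,13) idY by (intro integrableI_nonneg) auto
  define a2 where "a2 = (\<integral>x. x ^ 2 \<partial>PX)"
  define b1 where "b1 = (\<integral>y. y \<partial>PY)"
  have a2: "0 < a2"
    unfolding a2_def using assms(5,3) intX assms(12) by (rule integral_pos_if_moment_infinite) simp
  have b1: "0 < b1"
    unfolding b1_def using integral_pos_if_moment_infinite[OF assms(6,4) _ assms(14), of 1] intY by simp
  \<comment> \<open>The ratio estimate allows an error of \<open>4 * \<eta>\<close>, which has to
    stay within the prescribed accuracy \<open>e\<close>.\<close>
  define \<eta> where "\<eta> = min (1 / 2) (e / 4)"
  have \<eta>: "0 < \<eta>" "\<eta> \<le> 1 / 2" "4 * \<eta> \<le> e" using e by (auto simp: \<eta>_def)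
  \<comment> \<open>720 = 2 * 120 * 3 makes the conditional failure probability
    \<open>120 * (3 * \<theta>) / \<eta>\<close> at most half of the target
    \<open>\<eta>\<^sub>0\<close>.\<close>
  define \<theta> where "\<theta> = min (1 / 6) (\<eta>\<^sub>0 * \<eta> / 720)"
  have \<theta>: "0 < \<theta>" "\<theta> \<le> 1 / 6" "\<theta> \<le> \<eta>\<^sub>0 * \<eta> / 720" using \<eta> \<eta>\<^sub>0 by (auto simp: \<theta>_def)
  have \<theta>_small: "120 * (3 * \<theta>) / \<eta> \<le> \<eta>\<^sub>0 / 2" using \<theta>(3) \<eta>(1) by (simp add: field_simps)
  have "\<forall>\<^sub>F t::nat in sequentially. (1 - \<theta>) * a2 < (\<integral>x. (if x \<le> real t then x ^ 2 else 0) \<partial>PX)"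
    by (rule order_tendstoD(1)[OF truncated_integral_tendsto(2)[OF assms(3) intX]]) (use a2 \<theta> in \<open>simp add: a2_def\<close>)
  moreover have "\<forall>\<^sub>F t::nat in sequentially. (1 - \<theta>) * b1 < (\<integral>y. (if y \<le> real t then y else 0) \<partial>PY)"
    by (rule order_tendstoD(1)[OF truncated_integral_tendsto(2)[OF assms(4) intY]]) (use b1 \<theta> in \<open>simp add: b1_def\<close>)
  moreover have "\<forall>\<^sub>F t::nat in sequentially. 1 \<le> t" by (rule eventually_ge_at_top)
  ultimately have "\<forall>\<^sub>F t::nat in sequentially. (1 - \<theta>) * a2 < (\<integral>x. (if x \<le> real t then x ^ 2 else 0) \<partial>PX)
    \<and> (1 - \<theta>) * b1 < (\<integral>y. (if y \<le> real t then y else 0) \<partial>PY) \<and> 1 \<le> t" by eventually_elim auto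
  then obtain t :: nat where t: "(1 - \<theta>) * a2 < (\<integral>x. (if x \<le> real t then x ^ 2 else 0) \<partial>PX)"
    "(1 - \<theta>) * b1 < (\<integral>y. (if y \<le> real t then y else 0) \<partial>PY)" "1 \<le> t"
    using eventually_happens'[OF sequentially_bot] by blast
  define K where "K = real t"
  have K: "0 < K" using t(3) by (simp add: K_def)
  \<comment> \<open>\<open>c\<^sub>1\<close> and \<open>c\<^sub>2\<close> are the left sides of the
    two conditions on \<open>L\<close>, and \<open>d\<^sub>1\<close>, \<open>d\<^sub>2\<close> the
    coefficients of \<open>L\<close> on their right sides. As \<open>c\<^sub>2\<close> contains
    \<open>K\<close>, the level \<open>L\<close> can only be chosen after \<open>K\<close>.\<close>
  define c\<^sub>1 where "c\<^sub>1 = 3 * (2 + 1 / (3 * \<theta>))"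
  define c\<^sub>2 where "c\<^sub>2 = 1 + 2 * (1 + (1 + K * (2 * (b1 / sqrt \<beta>))) / (3 * \<theta>))"
  define d\<^sub>1 where "d\<^sub>1 = 3 * \<theta> * (b1 / sqrt \<beta>) / 2"
  define d\<^sub>2 where "d\<^sub>2 = 3 * \<theta> * (a2 * b1) / 2"
  have d: "0 < d\<^sub>1" "0 < d\<^sub>2" using \<theta> b1 a2 assms(7) by (auto simp: d\<^sub>1_def d\<^sub>2_def)
  define L where "L = max K (max (c\<^sub>1 / d\<^sub>1) (c\<^sub>2 / d\<^sub>2))"
  have "c\<^sub>1 \<le> L * d\<^sub>1" "c\<^sub>2 \<le> L * d\<^sub>2" using d by (simp_all add: pos_divide_le_eq[symmetric] L_def)
  then have L: "K \<le> L" "c\<^sub>1 \<le> 3 * \<theta> * (L * (b1 / sqrt \<beta>) / 2)" "c\<^sub>2 \<le> 3 * \<theta> * (L * (a2 * b1) / 2)"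
    by (simp_all add: L_def d\<^sub>1_def d\<^sub>2_def mult_ac)
  \<comment> \<open>The infinite moments enter here: however large \<open>L\<close> is, some
    truncated third moment of the attribute weights, and likewise second moment of the vertex
    weights, exceeds the threshold it dictates.\<close>
  obtain C :: nat where C: "integrable PX (\<lambda>x. if x \<le> real C then x ^ 3 else 0)"
    "L ^ 3 / (3 * \<theta>) < (\<integral>x. (if x \<le> real C then x ^ 3 else 0) \<partial>PX)"
    using truncated_moment_unbounded[OF assms(1,3,5,12)] by blast
  obtain C' :: nat where C': "integrable PY (\<lambda>x. if x \<le> real C' then x ^ 2 else 0)"
    "L ^ 2 / (3 * \<theta>) < (\<integral>x. (if x \<le> real C' then x ^ 2 else 0) \<partial>PY)"
    using truncated_moment_unbounded[OF assms(2,4,6,14)] by blast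
  \<comment> \<open>The first term keeps the relative size of double connections below
    \<open>3 * \<theta>\<close>; the second gives \<open>K * y j \<le> s\<close>, so that the cap
    stays inactive.\<close>
  define \<delta> where "\<delta> = min (3 * \<theta> / (2 * K * a2)) (sqrt \<beta> / (2 * K))"
  have \<delta>: "0 < \<delta>" using \<theta> K a2 assms(7) by (simp add: \<delta>_def)
  have "\<delta> \<le> 3 * \<theta> / (2 * K * a2)" "\<delta> \<le> sqrt \<beta> / (2 * K)" by (auto simp: \<delta>_def)
  then have \<delta>': "2 * K * \<delta> * a2 \<le> 3 * \<theta>" "2 * K * \<delta> \<le> sqrt \<beta>"
    using K a2 by (simp_all add: pos_le_divide_eq mult_ac)
  \<comment> \<open>\<open>K'\<close> is fixed before n grows, so
    \<open>K' \<le> \<delta> * n\<close> holds eventually, and the mean of the weights above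
    \<open>K'\<close> is less than \<delta>.\<close>
  have "\<forall>\<^sub>F t::nat in sequentially. b1 - \<delta> < (\<integral>y. (if y \<le> real t then y else 0) \<partial>PY)"
    by (rule order_tendstoD(1)[OF truncated_integral_tendsto(2)[OF assms(4) intY]]) (use \<delta> in \<open>simp add: b1_def\<close>)
  then obtain t' :: nat where t': "b1 - \<delta> < (\<integral>y. (if y \<le> real t' then y else 0) \<partial>PY)"
    using eventually_happens'[OF sequentially_bot] by blast
  define K' where "K' = real t'"
  define GX where "GX N = {x \<in> space ?X. \<not> good_x a2 \<theta> K L C N x}" for N
  define GY where "GY N = {y \<in> space ?Y. \<not> good_y b1 \<theta> K L C' \<delta> K' N y}" for N
  have GX: "GX N \<in> sets ?X" "(\<lambda>N. measure ?X (GX N)) \<longlonglongrightarrow> 0" for N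
    using not_good_x_tendsto[OF assms(1,3) intX a2_def a2 \<theta>(1) t(1) C] unfolding GX_def K_def by auto
  have GY: "GY N \<in> sets ?Y" "(\<lambda>N. measure ?Y (GY N)) \<longlonglongrightarrow> 0" for N
    using not_good_y_tendsto[OF assms(2,4) intY b1_def b1 \<theta>(1) t(2) C', of t' \<delta>] t' unfolding GY_def K_def K'_def
    by (auto simp: algebra_simps)
  have nonneg: "AE x in ?X. \<forall>i. 0 \<le> x i" "AE y in ?Y. \<forall>j. 0 \<le> y j"
    unfolding AE_all_countable using assms(1,2,5,6)
    by (auto intro!: AE_PiM_component[where P = "\<lambda>x. 0 \<le> x"])
  let ?lim = "\<lambda>k \<omega>. 1 / (1 + \<beta> powr (3/2) * a2 ^ 2 / b1 * (\<Sum>j<n k. fst (snd \<omega>) j ^ 2) / (\<Sum>i<m k. fst \<omega> i ^ 3))"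
  define S where "S k = {\<omega> \<in> space (model PX PY). 4 * \<eta> < \<bar>clustering (m k) (n k) \<omega> - ?lim k \<omega>\<bar>}" for k
  have S: "S k \<in> sets (model PX PY)" for k
  proof -
    note [measurable] = measurable_model_components[OF assms(1,3,2,4)] measurable_clustering[OF assms(1,3,2,4)]
    show ?thesis unfolding S_def by measurable
  qed
  have bound: "measure (model PX PY) (S k) \<le> measure ?X (GX (m k)) + measure ?Y (GY (n k)) + \<eta>\<^sub>0 / 2"
    if k: "0 < m k" "0 < n k" "(1 - \<theta>) / sqrt \<beta> < real (n k) / sqrt (real (m k) * real (n k))"
      "real (n k) / sqrt (real (m k) * real (n k)) < (1 + \<theta>) / sqrt \<beta>" "K' \<le> \<delta> * real (n k)"
      "2 * K ^ 2 * a2 \<le> 3 * \<theta> * real (n k)" for k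
  proof (rule measure_model_le[OF assms(1,3,2,4) GX(1) GY(1) S])
    show "0 \<le> \<eta>\<^sub>0 / 2" using \<eta>\<^sub>0 by simp
    show "AE x in ?X. AE y in ?Y. x \<notin> GX (m k) \<longrightarrow> y \<notin> GY (n k)
      \<longrightarrow> measure marks {u \<in> space marks. (x, y, u) \<in> S k} \<le> \<eta>\<^sub>0 / 2"
      using nonneg(1) AE_space
    proof eventually_elim
      case x: (elim x)
      show ?case using nonneg(2) AE_space
      proof eventually_elim
        case y: (elim y)
        show ?case
        proof (intro impI)
          assume "x \<notin> GX (m k)" "y \<notin> GY (n k)"
          then have gx: "good_x a2 \<theta> K L C (m k) x" and gy: "good_y b1 \<theta> K L C' \<delta> K' (n k) y"
            using x y by (auto simp: GX_def GY_def)
          have "{u \<in> space marks. (x, y, u) \<in> S k} = {u \<in> space marks. 4 * \<eta> < \<bar>clustering (m k) (n k) (x, y, u)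
            - 1 / (1 + \<beta> powr (3/2) * a2 ^ 2 / b1 * (\<Sum>j<n k. y j ^ 2) / (\<Sum>i<m k. x i ^ 3))\<bar>}"
            using x y by (auto simp: S_def model_def space_pair_measure)
          moreover have "measure marks {u \<in> space marks. 4 * \<eta> < \<bar>clustering (m k) (n k) (x, y, u)
            - 1 / (1 + \<beta> powr (3/2) * a2 ^ 2 / b1 * (\<Sum>j<n k. y j ^ 2) / (\<Sum>i<m k. x i ^ 3))\<bar>}
            \<le> 120 * (3 * \<theta>) / \<eta>"
            using a2 b1 assms(7) \<theta>(1,2) K L(1) \<delta> L(2,3)[unfolded c\<^sub>1_def c\<^sub>2_def] \<delta>' k(1,2)
              less_imp_le[OF k(3)] less_imp_le[OF k(4)] k(5,6) x(1)[rule_format] y(1)[rule_format] gx gy \<eta>(1,2)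
            by (rule clustering_conditional)
          ultimately have "measure marks {u \<in> space marks. (x, y, u) \<in> S k} \<le> 120 * (3 * \<theta>) / \<eta>"
            by (simp only:)
          then show "measure marks {u \<in> space marks. (x, y, u) \<in> S k} \<le> \<eta>\<^sub>0 / 2"
            using \<theta>_small by (rule order_trans)
        qed
      qed
    qed
  qed
  \<comment> \<open>Applied to \<open>K' / \<delta>\<close> and to
    \<open>2 * K ^ 2 * a2 / (3 * \<theta>)\<close>, the two lower bounds on n that
    \<open>bound\<close> asks for.\<close>
  have n_large: "\<forall>\<^sub>F k in sequentially. z \<le> real (n k)" for z
    using filterlim_compose[OF filterlim_real_sequentially assms(9)] by (auto simp: filterlim_at_top)
  have "(\<lambda>k. measure ?X (GX (m k)) + measure ?Y (GY (n k)) + \<eta>\<^sub>0 / 2) \<longlonglongrightarrow> 0 + 0 + \<eta>\<^sub>0 / 2"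
    using filterlim_compose[OF GX(2) assms(8)] filterlim_compose[OF GY(2) assms(9)]
    by (intro tendsto_intros) auto
  then have "\<forall>\<^sub>F k in sequentially. measure ?X (GX (m k)) + measure ?Y (GY (n k)) + \<eta>\<^sub>0 / 2 < \<eta>\<^sub>0"
    by (rule order_tendstoD(2)) (use \<eta>\<^sub>0 in simp)
  moreover have "\<forall>\<^sub>F k in sequentially. 0 < m k"
    by (rule eventually_compose_filterlim[OF eventually_gt_at_top assms(8)])
  moreover have "\<forall>\<^sub>F k in sequentially. 0 < n k"
    by (rule eventually_compose_filterlim[OF eventually_gt_at_top assms(9)])
  moreover have "\<forall>\<^sub>F k in sequentially. (1 - \<theta>) / sqrt \<beta> < real (n k) / sqrt (real (m k) * real (n k))"
    by (rule order_tendstoD(1)[OF ratio_sqrt_tendsto[OF assms(7,9,10)]])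
      (use \<theta> assms(7) in \<open>simp add: divide_strict_right_mono\<close>)
  moreover have "\<forall>\<^sub>F k in sequentially. real (n k) / sqrt (real (m k) * real (n k)) < (1 + \<theta>) / sqrt \<beta>"
    by (rule order_tendstoD(2)[OF ratio_sqrt_tendsto[OF assms(7,9,10)]])
      (use \<theta> assms(7) in \<open>simp add: divide_strict_right_mono\<close>)
  ultimately show "\<forall>\<^sub>F k in sequentially. dist (measure (model PX PY)
           {\<omega> \<in> space (model PX PY).
              (let a2 = (\<integral>x. x ^ 2 \<partial>PX); b1 = (\<integral>y. y \<partial>PY);
                   \<kappa> = \<beta> powr (3/2) * a2 ^ 2 / b1;
                   SX = (\<Sum>i<m k. (fst \<omega>) i ^ 3);
                   SY = (\<Sum>j<n k. (fst (snd \<omega>)) j ^ 2)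
               in \<bar>clustering (m k) (n k) \<omega> - 1 / (1 + \<kappa> * SY / SX)\<bar> > e)}) 0 < \<eta>\<^sub>0"
    using n_large[of "K' / \<delta>"] n_large[of "2 * K ^ 2 * a2 / (3 * \<theta>)"]
  proof eventually_elim
    case (elim k)
    let ?T = "{\<omega> \<in> space (model PX PY).
              (let a2 = (\<integral>x. x ^ 2 \<partial>PX); b1 = (\<integral>y. y \<partial>PY);
                   \<kappa> = \<beta> powr (3/2) * a2 ^ 2 / b1;
                   SX = (\<Sum>i<m k. (fst \<omega>) i ^ 3);
                   SY = (\<Sum>j<n k. (fst (snd \<omega>)) j ^ 2)
               in \<bar>clustering (m k) (n k) \<omega> - 1 / (1 + \<kappa> * SY / SX)\<bar> > e)}"
    interpret prob_space "model PX PY" by (rule prob_space_model[OF assms(1,2)])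
    have "?T \<subseteq> S k"
      using \<eta>(3) unfolding S_def Let_def a2_def b1_def by auto
    then have "prob ?T \<le> prob (S k)" using S by (rule finite_measure_mono)
    also have "\<dots> \<le> measure ?X (GX (m k)) + measure ?Y (GY (n k)) + \<eta>\<^sub>0 / 2"
      using elim \<delta> \<theta>(1) by (intro bound) (auto simp: pos_divide_le_eq mult.commute)
    also have "\<dots> < \<eta>\<^sub>0" by (fact elim(1))
    finally show ?case by simp
  qed
qed

end
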